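(* Let $m\ge 3$ be an integer and let $U_1,U_2,\ldots$ be independent points uniformly distributed on the unit circumference $\mathbb{S}$. For $n\ge m$ let $$\mathcal{P}_n^m=\max_{1\le i_1<\ldots<i_m\le n}\mathrm{peri}(U_{i_1},\ldots,U_{i_m})$$ be the maximal perimeter among the perimeters of all convex $m$-polygons generated by $m$ points from $U_1,\ldots,U_n$. Then for each $t>0$ $$\lim_{n\to\infty}P\left\{n^{\frac{2m}{m-1}}\left(2m\sin\frac{\pi}{m}-\mathcal{P}_n^m\right)\le t\right\}=1-\exp\left\{-\frac{t^{\frac{m-1}{2}}}{K_{1m}}\right\},$$ where $$K_{1m}=m^{\frac32}\left(\pi\sin\frac{\pi}{m}\right)^{\frac{m-1}{2}}\Gamma\left(\frac{m+1}{2}\right).$$ The rate of convergence is $O\left(n^{-\frac{1}{m-1}}\right)$; that is, for each fixed $t>0$ the absolute difference between the probability on the left and its limit is $O\left(n^{-\frac{1}{m-1}}\right)$ as $n\to\infty$.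
   Context: The unit circumference $\mathbb{S}$ is the circle of radius $1$ in the plane. For $m$ distinct points $u_1,\ldots,u_m\in\mathbb{S}$, $\mathrm{peri}(u_1,\ldots,u_m)$ denotes the perimeter of the convex $m$-polygon inscribed in the circle whose vertex set is $\{u_1,\ldots,u_m\}$ (consecutive vertices are those adjacent in cyclic order along the circle). The points are almost surely distinct. $\Gamma$ is Euler's gamma function. Here $m$ is fixed as $n\to\infty$. *)

theory Defs
  imports "HOL-Probability.Probability"
begin

abbreviation unit_circle :: "complex set" where
  "unit_circle \<equiv> sphere 0 1"

abbreviation circle_borel :: "complex measure" where
  "circle_borel \<equiv> restrict_space borel unit_circle"

definition uniform_circle :: "complex measure" where
  "uniform_circle = distr (uniform_measure lborel {0..<2 * pi}) circle_borel cis"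

definition closed_polygon_length :: "complex list \<Rightarrow> real" where
  "closed_polygon_length vs =
     (\<Sum>k<length vs. dist (vs ! k) (vs ! (Suc k mod length vs)))"

(* Arg2pi is injective on the unit circle, so for a finite set S of points of the circle
   the list below enumerates S without repetition in counterclockwise order. *)
definition peri :: "complex set \<Rightarrow> real" where
  "peri S = closed_polygon_length (sorted_key_list_of_set Arg2pi S)"

(* A choice i_1 < ... < i_m of indices is encoded by the set I of these indices.
   The maximum ranges over a nonempty set only for n \<ge> m. If some of the points
   coincide (a null event), U ` I has fewer than m elements and peri is the perimeter
   of the polygon spanned by the remaining distinct points. *)
definition max_peri :: "nat \<Rightarrow> nat \<Rightarrow> (nat \<Rightarrow> complex) \<Rightarrow> real" where
  "max_peri m n u = Max {peri (u ` I) | I. I \<subseteq> {1..n} \<and> card I = m}"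

definition K1 :: "nat \<Rightarrow> real" where
  "K1 m = real m powr (3 / 2) * (pi * sin (pi / real m)) powr ((real m - 1) / 2)
            * Gamma ((real m + 1) / 2)"

end

(* Let e = t n^(-2m/(m-1)) and call an m-subset of the points good if its perimeter defect
   2m sin(pi/m) - peri is at most e; the event in the theorem is that some m-subset is good.
   Write peri as the sum of 2 sin(g/2) over the arcs g between neighbours. Since sin is concave on
   [0, pi] and the g sum up to 2 pi, the defect is a quadratic form in the deviations g - 2 pi/m up
   to a cubic error, so a fixed m-subset is good with probability m! c e^((m-1)/2) (1 + O(sqrt e)),
   where c comes from the volume of an ellipsoid.
   All points of a good m-subset lie within O(sqrt e) of one rotated regular m-gon. Hence two
   m-subsets with a common point and a union of s points are both good with probability
   O(e^((s-1)/2)), and the sum over all such pairs of distinct subsets is O(n^(-1/(m-1))). By the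
   Chen-Stein method the number of good m-subsets is then zero with probability
   exp(- n^m c e^((m-1)/2)) + O(n^(-1/(m-1))). *)

theory Submission
  imports Defs "HOL-Combinatorics.Multiset_Permutations"
begin

text \<open>The exponents come from one scaling. With x = sqrt e, the expected number of good
  subsets is of order n^m x^(m-1), so x is of order n^(-m/(m-1)), and the natural small parameter n
  x is of order n^(-1/(m-1)). Pairs with a union of s points contribute order n^s x^(s-1) = n (n
  x)^(s-1). Since n is of order (n x)^(-(m-1)), unions of m + 1 points dominate and give the rate.
  The relative errors of the volume (order x) and of replacing the binomial coefficient by n^m / m!
  (order 1/n) are no larger. The quadratic form describes the defect only near the regular polygon.
  A coarse lower bound for the defect, valid for all polygons, therefore comes before the sharp
  expansion: it forces the gaps of a good subset to be close to 2 pi / m. The constant collects the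
  density (2 pi)^(-m), the volume of the ellipsoid and the length 2 pi / m of the range of the
  smallest angle. The factor m! counts the ways to order the points by angle and cancels against the
  binomial coefficient.\<close>

section \<open>Poisson approximation for dissociated events\<close>

text \<open>Here z will be the number of neighbouring events that occur. A bound linear in z is
  wanted because its expectation is a sum of probabilities.\<close>

lemma abs_power_add_diff_le:
  fixes x :: real
  assumes "0 \<le> x" "x \<le> 1"
  shows "\<bar>x ^ (v + z) - x ^ v\<bar> \<le> real z"
proof (cases "z = 0")
  case False
  have "0 \<le> x ^ (v + z)" "x ^ (v + z) \<le> 1" "0 \<le> x ^ v" "x ^ v \<le> 1"
    using assms by (auto intro: power_le_one)
  then have "\<bar>x ^ (v + z) - x ^ v\<bar> \<le> 1" by linarith
  also have "1 \<le> real z" using False by simp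
  finally show ?thesis .
qed simp

text \<open>A Chen-Stein bound with dependency neighbourhoods \<open>N i\<close>, proved by
  interpolating the generating function instead of solving a Stein equation. Independence is asked
  between an event and the number of occurrences outside its neighbourhood, which is exactly what
  splits an expectation of \<open>indicator (E i) \<omega> * x ^ count\<close>.\<close>

lemma (in prob_space) prob_no_event_poisson:
  fixes E :: "'i \<Rightarrow> 'a set" and N :: "'i \<Rightarrow> 'i set"
  assumes fin: "finite F"
    and ev: "\<And>i. i \<in> F \<Longrightarrow> E i \<in> events"
    and N: "\<And>i. i \<in> F \<Longrightarrow> i \<in> N i" "\<And>i. i \<in> F \<Longrightarrow> N i \<subseteq> F"
    and ind: "\<And>i. i \<in> F \<Longrightarrow>
      indep_var (count_space UNIV) (indicator (E i) :: 'a \<Rightarrow> nat)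
        (count_space UNIV) (\<lambda>\<omega>. \<Sum>j\<in>F - N i. indicator (E j) \<omega> :: nat)"
  shows "\<bar>prob {\<omega> \<in> space M. \<forall>i\<in>F. \<omega> \<notin> E i} - exp (- (\<Sum>i\<in>F. prob (E i)))\<bar>
    \<le> (\<Sum>i\<in>F. (\<Sum>j\<in>N i. prob (E i) * prob (E j)) + (\<Sum>j\<in>N i - {i}. prob (E i \<inter> E j)))"
    (is "_ \<le> ?\<delta>")
proof -
  define c where "c S \<omega> = (\<Sum>j\<in>S. indicator (E j) \<omega> :: nat)" for S \<omega>
  define \<Lambda> where "\<Lambda> = (\<Sum>i\<in>F. prob (E i))"
  define \<psi> where "\<psi> x = expectation (\<lambda>\<omega>. x ^ c F \<omega>)" for x :: real
  txt \<open>\<^term>\<open>\<psi> 0\<close> is the probability that no event occurs and \<^term>\<open>\<psi> 1\<close> is 1. Dependence only enters through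
    the neighbourhoods, so \<^term>\<open>\<psi>\<close> solves the differential equation \<open>\<psi>' = \<Lambda> \<psi>\<close> of the Poisson
    generating function up to the error bound of the lemma.\<close>
  have finS: "finite S" if "S \<subseteq> F" for S using that fin finite_subset by blast
  have evS: "E i \<in> events" if "i \<in> S" "S \<subseteq> F" for i S using that ev by blast
  have c_le: "c S \<omega> \<le> card F" if "S \<subseteq> F" for S \<omega>
  proof -
    have "c S \<omega> \<le> (\<Sum>j\<in>S. 1)" unfolding c_def by (intro sum_mono) (auto simp: indicator_def)
    also have "\<dots> \<le> card F" using that fin by (simp add: card_mono)
    finally show ?thesis .
  qed
  have c_meas: "c S \<in> measurable M (count_space UNIV)" if "S \<subseteq> F" for S
    using finS[OF that] that
  proof (induction S rule: finite_induct)
    case empty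
    then show ?case by (simp add: c_def[abs_def])
  next
    case (insert i S)
    then have [measurable]: "c S \<in> measurable M (count_space UNIV)" "E i \<in> sets M"
      using ev by auto
    have "c (insert i S) = (\<lambda>\<omega>. (if \<omega> \<in> E i then 1 else 0) + c S \<omega>)"
      using insert by (auto simp: c_def indicator_def)
    then show ?case by simp
  qed
  have c_union: "c (S \<union> T) \<omega> = c S \<omega> + c T \<omega>" if "S \<subseteq> F" "T \<subseteq> F" "S \<inter> T = {}" for S T \<omega>
    unfolding c_def using that finS by (intro sum.union_disjoint) auto
  have int_c: "integrable M (\<lambda>\<omega>. g (c S \<omega>) :: real)" if "S \<subseteq> F" for S g
  proof (rule integrable_const_bound)
    show "AE \<omega> in M. norm (g (c S \<omega>)) \<le> (\<Sum>k\<le>card F. \<bar>g k\<bar>)"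
      using c_le[OF that] by (auto intro!: AE_I2 member_le_sum[where f = "\<lambda>k. \<bar>g k\<bar>"])
    show "(\<lambda>\<omega>. g (c S \<omega>)) \<in> borel_measurable M"
      using c_meas[OF that] by measurable
  qed
  have int_ind_c: "integrable M (\<lambda>\<omega>. indicator (E i) \<omega> * (g (c S \<omega>) :: real))"
    if "S \<subseteq> F" "i \<in> F" for S g i
    using integrable_mult_indicator[OF ev[OF that(2)] int_c[OF that(1)]] by simp
  have E_c: "expectation (\<lambda>\<omega>. real (c S \<omega>)) = (\<Sum>j\<in>S. prob (E j))" if "S \<subseteq> F" for S
  proof -
    have "(\<lambda>\<omega>. real (c S \<omega>)) = (\<lambda>\<omega>. \<Sum>j\<in>S. indicator (E j) \<omega>)"
      by (auto simp: c_def indicator_def)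
    then show ?thesis
      using evS[OF _ that] by (simp add: Bochner_Integration.integral_sum emeasure_eq_measure less_top[symmetric])
  qed
  have E_g: "expectation (\<lambda>\<omega>. g (c F \<omega>) :: real) = (\<Sum>k\<le>card F. g k * prob {\<omega> \<in> space M. c F \<omega> = k})" for g
  proof -
    have [measurable]: "c F \<in> measurable M (count_space UNIV)" by (rule c_meas) simp
    have "expectation (\<lambda>\<omega>. g (c F \<omega>)) =
        expectation (\<lambda>\<omega>. \<Sum>k\<le>card F. g k * indicator {\<omega> \<in> space M. c F \<omega> = k} \<omega>)"
      using c_le[of F]
      by (intro Bochner_Integration.integral_cong refl) (auto simp: indicator_def if_distrib cong: if_cong)
    also have "\<dots> = (\<Sum>k\<le>card F. g k * prob {\<omega> \<in> space M. c F \<omega> = k})"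
      by (subst Bochner_Integration.integral_sum) (auto simp: emeasure_eq_measure intro!: integrable_mult_right)
    finally show ?thesis .
  qed
  define \<psi>' where "\<psi>' x = expectation (\<lambda>\<omega>. real (c F \<omega>) * x ^ (c F \<omega> - 1))" for x :: real
  \<comment> \<open>The count is at most \<open>card F\<close>, so \<psi> is a polynomial and can be
    differentiated term by term.\<close>
  have deriv: "(\<psi> has_real_derivative \<psi>' x) (at x)" for x
  proof -
    have "\<psi> = (\<lambda>x. \<Sum>k\<le>card F. x ^ k * prob {\<omega> \<in> space M. c F \<omega> = k})"
      unfolding \<psi>_def by (intro ext E_g)
    moreover have "\<psi>' x = (\<Sum>k\<le>card F. (real k * x ^ (k - 1)) * prob {\<omega> \<in> space M. c F \<omega> = k})"
      unfolding \<psi>'_def by (rule E_g)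
    ultimately show ?thesis
      by (auto intro!: derivative_eq_intros sum.cong)
  qed
  have bound: "\<bar>\<psi>' x - \<Lambda> * \<psi> x\<bar> \<le> ?\<delta>" if x: "0 \<le> x" "x \<le> 1" for x
  proof -
    \<comment> \<open>The factor \<open>c F \<omega>\<close> is spread over the events that occur:
      on \<open>E i\<close>, the exponent \<open>c F \<omega> - 1\<close> is the number of the other
      occurrences.\<close>
    have "\<psi>' x = expectation (\<lambda>\<omega>. \<Sum>i\<in>F. indicator (E i) \<omega> * x ^ c (F - {i}) \<omega>)"
      unfolding \<psi>'_def
    proof (intro Bochner_Integration.integral_cong refl)
      fix \<omega>
      have "real (c F \<omega>) * x ^ (c F \<omega> - 1) = (\<Sum>i\<in>F. indicator (E i) \<omega> * x ^ (c F \<omega> - 1))"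
        by (simp add: c_def sum_distrib_right indicator_def if_distrib of_nat_sum cong: if_cong)
      also have "\<dots> = (\<Sum>i\<in>F. indicator (E i) \<omega> * x ^ c (F - {i}) \<omega>)"
      proof (intro sum.cong refl)
        fix i assume i: "i \<in> F"
        then have "F = {i} \<union> (F - {i})" by auto
        then have "c F \<omega> = c {i} \<omega> + c (F - {i}) \<omega>" using c_union[of "{i}" "F - {i}"] i by auto
        then show "indicator (E i) \<omega> * x ^ (c F \<omega> - 1) = indicator (E i) \<omega> * x ^ c (F - {i}) \<omega>"
          by (auto simp: c_def indicator_def)
      qed
      finally show "real (c F \<omega>) * x ^ (c F \<omega> - 1) = (\<Sum>i\<in>F. indicator (E i) \<omega> * x ^ c (F - {i}) \<omega>)" .
    qed
    also have "\<dots> = (\<Sum>i\<in>F. expectation (\<lambda>\<omega>. indicator (E i) \<omega> * x ^ c (F - {i}) \<omega>))"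
      by (intro Bochner_Integration.integral_sum int_ind_c) auto
    finally have psi': "\<psi>' x = \<dots>" .
    have "\<bar>\<psi>' x - \<Lambda> * \<psi> x\<bar> =
        \<bar>\<Sum>i\<in>F. expectation (\<lambda>\<omega>. indicator (E i) \<omega> * x ^ c (F - {i}) \<omega>) - prob (E i) * \<psi> x\<bar>"
      unfolding psi' \<Lambda>_def by (simp add: sum_subtractf sum_distrib_right)
    also have "\<dots> \<le> (\<Sum>i\<in>F. \<bar>expectation (\<lambda>\<omega>. indicator (E i) \<omega> * x ^ c (F - {i}) \<omega>) - prob (E i) * \<psi> x\<bar>)"
      by (rule sum_abs)
    also have "\<dots> \<le> ?\<delta>"
    proof (rule sum_mono)
      fix i assume i: "i \<in> F"
      note Ni = N[OF i]
      define V where "V = F - N i"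
      have sub: "V \<subseteq> F" "N i - {i} \<subseteq> F" "N i \<subseteq> F" "F - {i} \<subseteq> F" using Ni by (auto simp: V_def)
      have FV: "F = V \<union> N i" "F - {i} = V \<union> (N i - {i})" using Ni by (auto simp: V_def)
      have cF: "c F \<omega> = c V \<omega> + c (N i) \<omega>" for \<omega>
        by (subst FV(1), rule c_union) (use sub in \<open>auto simp: V_def\<close>)
      have cFi: "c (F - {i}) \<omega> = c V \<omega> + c (N i - {i}) \<omega>" for \<omega>
        by (subst FV(2), rule c_union) (use sub in \<open>auto simp: V_def\<close>)
      have indep: "expectation (\<lambda>\<omega>. indicator (E i) \<omega> * x ^ c V \<omega>) = prob (E i) * expectation (\<lambda>\<omega>. x ^ c V \<omega>)"
      proof -
        have "indep_var borel (real \<circ> (indicator (E i) :: 'a \<Rightarrow> nat)) borel ((\<lambda>k. x ^ k) \<circ> c V)"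
          using ind[OF i] unfolding c_def[abs_def] V_def
          by (rule indep_var_compose) auto
        moreover have "real \<circ> (indicator (E i) :: 'a \<Rightarrow> nat) = indicator (E i)"
          by (auto simp: indicator_def)
        ultimately have "indep_var borel (indicator (E i) :: 'a \<Rightarrow> real) borel (\<lambda>\<omega>. x ^ c V \<omega>)"
          by (simp add: comp_def)
        then show ?thesis
          using ev[OF i] int_c[OF sub(1), of "\<lambda>k. x ^ k"]
          by (subst indep_var_lebesgue_integral) (auto simp: emeasure_eq_measure)
      qed
      \<comment> \<open>Deleting the neighbours of i from the exponent costs at most their number on
        \<open>E i\<close>; this is the source of the joint probabilities in the error. What remains
        is independent of \<open>E i\<close>.\<close>
      have 1: "\<bar>expectation (\<lambda>\<omega>. indicator (E i) \<omega> * x ^ c (F - {i}) \<omega>)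
          - expectation (\<lambda>\<omega>. indicator (E i) \<omega> * x ^ c V \<omega>)\<bar> \<le> (\<Sum>j\<in>N i - {i}. prob (E i \<inter> E j))"
      proof -
        have "\<bar>expectation (\<lambda>\<omega>. indicator (E i) \<omega> * x ^ c (F - {i}) \<omega>)
          - expectation (\<lambda>\<omega>. indicator (E i) \<omega> * x ^ c V \<omega>)\<bar> =
          \<bar>expectation (\<lambda>\<omega>. indicator (E i) \<omega> * x ^ c (F - {i}) \<omega> - indicator (E i) \<omega> * x ^ c V \<omega>)\<bar>"
          using i sub by (subst Bochner_Integration.integral_diff) (auto intro!: int_ind_c)
        also have "\<dots> \<le> expectation (\<lambda>\<omega>. \<bar>indicator (E i) \<omega> * x ^ c (F - {i}) \<omega> - indicator (E i) \<omega> * x ^ c V \<omega>\<bar>)"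
          by (rule integral_abs_bound)
        also have "\<dots> \<le> expectation (\<lambda>\<omega>. indicator (E i) \<omega> * real (c (N i - {i}) \<omega>))"
        proof (rule integral_mono)
          fix \<omega>
          show "\<bar>indicator (E i) \<omega> * x ^ c (F - {i}) \<omega> - indicator (E i) \<omega> * x ^ c V \<omega>\<bar>
            \<le> indicator (E i) \<omega> * real (c (N i - {i}) \<omega>)"
            using abs_power_add_diff_le[OF x, of "c V \<omega>" "c (N i - {i}) \<omega>"]
            by (auto simp: cFi indicator_def)
        qed (use i sub in \<open>auto intro!: int_ind_c integrable_abs Bochner_Integration.integrable_diff\<close>)
        also have "(\<lambda>\<omega>. indicator (E i) \<omega> * real (c (N i - {i}) \<omega>)) =
            (\<lambda>\<omega>. \<Sum>j\<in>N i - {i}. indicator (E i \<inter> E j) \<omega>)"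
          by (auto simp: c_def sum_distrib_left indicator_def fun_eq_iff)
        also have "expectation \<dots> = (\<Sum>j\<in>N i - {i}. prob (E i \<inter> E j))"
          using ev[OF i] evS[OF _ sub(2)]
          by (simp add: Bochner_Integration.integral_sum emeasure_eq_measure less_top[symmetric] sets.Int)
        finally show ?thesis .
      qed
      \<comment> \<open>After the factorization the whole neighbourhood is put back, i included, to
        recover \<open>\<psi> x\<close>; this is the source of the products of probabilities in the
        error.\<close>
      have 2: "\<bar>expectation (\<lambda>\<omega>. x ^ c V \<omega>) - \<psi> x\<bar> \<le> (\<Sum>j\<in>N i. prob (E j))"
      proof -
        have "\<bar>expectation (\<lambda>\<omega>. x ^ c V \<omega>) - \<psi> x\<bar> = \<bar>expectation (\<lambda>\<omega>. x ^ c V \<omega> - x ^ c F \<omega>)\<bar>"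
          unfolding \<psi>_def using sub
          by (subst Bochner_Integration.integral_diff) (auto intro!: int_c)
        also have "\<dots> \<le> expectation (\<lambda>\<omega>. \<bar>x ^ c V \<omega> - x ^ c F \<omega>\<bar>)"
          by (rule integral_abs_bound)
        also have "\<dots> \<le> expectation (\<lambda>\<omega>. real (c (N i) \<omega>))"
        proof (rule integral_mono)
          fix \<omega>
          show "\<bar>x ^ c V \<omega> - x ^ c F \<omega>\<bar> \<le> real (c (N i) \<omega>)"
            using abs_power_add_diff_le[OF x, of "c V \<omega>" "c (N i) \<omega>"]
            by (simp add: cF abs_minus_commute)
        qed (use sub in \<open>auto intro!: int_c integrable_abs Bochner_Integration.integrable_diff\<close>)
        also have "\<dots> = (\<Sum>j\<in>N i. prob (E j))"
          using sub by (intro E_c)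
        finally show ?thesis .
      qed
      have "\<bar>prob (E i) * expectation (\<lambda>\<omega>. x ^ c V \<omega>) - prob (E i) * \<psi> x\<bar>
          = prob (E i) * \<bar>expectation (\<lambda>\<omega>. x ^ c V \<omega>) - \<psi> x\<bar>"
        by (simp add: abs_mult flip: right_diff_distrib)
      also have "\<dots> \<le> prob (E i) * (\<Sum>j\<in>N i. prob (E j))"
        using 2 by (intro mult_left_mono) auto
      finally show "\<bar>expectation (\<lambda>\<omega>. indicator (E i) \<omega> * x ^ c (F - {i}) \<omega>) - prob (E i) * \<psi> x\<bar>
        \<le> (\<Sum>j\<in>N i. prob (E i) * prob (E j)) + (\<Sum>j\<in>N i - {i}. prob (E i \<inter> E j))"
        using 1 unfolding indep sum_distrib_left by linarith
    qed
    finally show ?thesis .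
  qed
  \<comment> \<open>The integrating factor turns the approximate differential equation into a small
    derivative. As \<open>\<Lambda> \<ge> 0\<close>, the exponential does not enlarge the error, and
    the mean value theorem compares \<open>h 0 = \<psi> 0\<close> with
    \<open>h 1 = exp (- \<Lambda>)\<close>.\<close>
  define h where "h x = \<psi> x * exp (- (\<Lambda> * x))" for x
  have "\<Lambda> \<ge> 0" unfolding \<Lambda>_def by (intro sum_nonneg) auto
  have h': "(h has_real_derivative ((\<psi>' x - \<Lambda> * \<psi> x) * exp (- (\<Lambda> * x)))) (at x)" for x
    unfolding h_def by (auto intro!: derivative_eq_intros deriv simp: algebra_simps)
  obtain z where z: "0 < z" "z < 1" "h 1 - h 0 = (1 - 0) * ((\<psi>' z - \<Lambda> * \<psi> z) * exp (- (\<Lambda> * z)))"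
    using MVT2[of 0 1 h "\<lambda>x. (\<psi>' x - \<Lambda> * \<psi> x) * exp (- (\<Lambda> * x))"] h' by auto
  have "\<bar>h 1 - h 0\<bar> = \<bar>\<psi>' z - \<Lambda> * \<psi> z\<bar> * exp (- (\<Lambda> * z))"
    unfolding z by (simp add: abs_mult)
  also have "\<dots> \<le> \<bar>\<psi>' z - \<Lambda> * \<psi> z\<bar> * 1"
    using \<open>\<Lambda> \<ge> 0\<close> z by (intro mult_left_mono) auto
  also have "\<dots> \<le> ?\<delta>" using bound[of z] z by simp
  finally have "\<bar>h 1 - h 0\<bar> \<le> ?\<delta>" .
  moreover have "h 1 = exp (- \<Lambda>)" by (simp add: h_def \<psi>_def prob_space)
  moreover have "h 0 = prob {\<omega> \<in> space M. \<forall>i\<in>F. \<omega> \<notin> E i}"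
  proof -
    have "h 0 = expectation (\<lambda>\<omega>. indicator {\<omega> \<in> space M. \<forall>i\<in>F. \<omega> \<notin> E i} \<omega>)"
      unfolding h_def \<psi>_def using fin
      by (auto intro!: Bochner_Integration.integral_cong simp: c_def indicator_def power_0_left)
    also have "\<dots> = prob ({\<omega> \<in> space M. \<forall>i\<in>F. \<omega> \<notin> E i} \<inter> space M)" by simp
    also have "{\<omega> \<in> space M. \<forall>i\<in>F. \<omega> \<notin> E i} \<inter> space M = {\<omega> \<in> space M. \<forall>i\<in>F. \<omega> \<notin> E i}" by auto
    finally show ?thesis .
  qed
  ultimately show ?thesis unfolding \<Lambda>_def by (simp add: abs_minus_commute)
qed

section \<open>Volume of an ellipsoid\<close>

text \<open>The Beta value is the integral of (1 - x^2)^(n/2) over [-1, 1]: the ball of dimension n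
  + 1 is sliced along one coordinate.\<close>

lemma unit_ball_vol_Suc:
  "unit_ball_vol (real n) * Beta (1/2) (real n / 2 + 1) = unit_ball_vol (real (Suc n))"
  by (auto simp: unit_ball_vol_def Beta_def Gamma_eq_zero_iff field_simps
        Gamma_one_half_real powr_half_sqrt [symmetric] powr_add [symmetric])

text \<open>The slice integral for the ellipsoid induction. Centring at b and scaling by
  \<open>sqrt (\<rho> / c)\<close> carries the interval of integration to [-1, 1].\<close>

lemma nn_integral_sqrt_power_quadratic:
  fixes b c \<rho> :: real
  assumes "c > 0"
  shows "(\<integral>\<^sup>+ y. ennreal (if c * (y - b)\<^sup>2 \<le> \<rho> then sqrt (\<rho> - c * (y - b)\<^sup>2) ^ n else 0) \<partial>lborel) =
    ennreal (if 0 \<le> \<rho> then Beta (1/2) (real n / 2 + 1) * sqrt \<rho> ^ Suc n / sqrt c else 0)"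
proof (cases "\<rho> > 0")
  case True
  define d where "d = sqrt (\<rho> / c)"
  have d: "d > 0" "d\<^sup>2 = \<rho> / c" using True assms by (auto simp: d_def)
  have *: "c * (d * x)\<^sup>2 = \<rho> * x\<^sup>2" for x
    using d assms by (simp add: power_mult_distrib)
  have **: "sqrt (\<rho> - \<rho> * x\<^sup>2) = sqrt \<rho> * sqrt (1 - x\<^sup>2)" for x
    by (simp add: real_sqrt_mult[symmetric] algebra_simps)
  have le: "\<rho> * x\<^sup>2 \<le> \<rho> \<longleftrightarrow> -1 \<le> x \<and> x \<le> 1" for x
    using True by (simp add: abs_square_le_1 abs_le_iff) linarith
  have "(\<integral>\<^sup>+ y. ennreal (if c * (y - b)\<^sup>2 \<le> \<rho> then sqrt (\<rho> - c * (y - b)\<^sup>2) ^ n else 0) \<partial>lborel) =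
    \<bar>d\<bar> * (\<integral>\<^sup>+ x. ennreal (if c * (b + d * x - b)\<^sup>2 \<le> \<rho> then sqrt (\<rho> - c * (b + d * x - b)\<^sup>2) ^ n else 0) \<partial>lborel)"
    using d by (intro nn_integral_real_affine) auto
  also have "\<dots> = ennreal d * (\<integral>\<^sup>+ x. ennreal (sqrt \<rho> ^ n) * ennreal (indicator {-1..1} x * sqrt (1 - x\<^sup>2) ^ n) \<partial>lborel)"
    using d True
    by (intro arg_cong2[where f = "(*)"] nn_integral_cong)
       (auto simp: * ** le indicator_def power_mult_distrib ennreal_mult' intro!: arg_cong[where f = ennreal])
  also have "\<dots> = ennreal d * (ennreal (sqrt \<rho> ^ n) * ennreal (Beta (1/2) (real n / 2 + 1)))"
    by (subst nn_integral_cmult) (auto simp: emeasure_cball_aux_integral)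
  also have "\<dots> = ennreal (d * (sqrt \<rho> ^ n * Beta (1/2) (real n / 2 + 1)))"
    using d True by (simp add: ennreal_mult')
  also have "d * (sqrt \<rho> ^ n * Beta (1/2) (real n / 2 + 1)) = Beta (1/2) (real n / 2 + 1) * sqrt \<rho> ^ Suc n / sqrt c"
    by (simp add: d_def real_sqrt_divide)
  finally show ?thesis using True by simp
next
  case False
  \<comment> \<open>For \<rho> = 0 and n = 0 the integrand is 0^0 = 1 at the single point b, so it
    vanishes only almost everywhere.\<close>
  have "AE y in lborel. y \<noteq> b" by (rule AE_lborel_singleton)
  then have "AE y in lborel. ennreal (if c * (y - b)\<^sup>2 \<le> \<rho> then sqrt (\<rho> - c * (y - b)\<^sup>2) ^ n else 0) = 0"
  proof eventually_elim
    case (elim y)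
    then have "c * (y - b)\<^sup>2 > 0" using assms by simp
    then show ?case using False by auto
  qed
  then have "(\<integral>\<^sup>+ y. ennreal (if c * (y - b)\<^sup>2 \<le> \<rho> then sqrt (\<rho> - c * (y - b)\<^sup>2) ^ n else 0) \<partial>lborel)
      = (\<integral>\<^sup>+ (y::real). 0 \<partial>lborel)"
    by (rule nn_integral_cong_AE)
  then show ?thesis using False by (cases "\<rho> = 0") auto
qed

text \<open>The chain \<open>s = a\<^sub>0, a\<^sub>1, \<dots>, a\<^sub>k, a\<^sub>k\<^sub>+\<^sub>1 = e\<close> has fixed endpoints; the induction removes \<open>a\<^sub>k\<close> by completing
  the square.\<close>

lemma emeasure_chain_ellipsoid:
  fixes h s e \<rho> :: real
  shows "emeasure (\<Pi>\<^sub>M i\<in>{1..k}. lborel) {a \<in> space (\<Pi>\<^sub>M i\<in>{1..k}. lborel).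
      (\<Sum>i\<le>k. ((a(0 := s, Suc k := e)) (Suc i) - (a(0 := s, Suc k := e)) i - h)\<^sup>2) \<le> \<rho>} =
    ennreal (if (e - s - real (Suc k) * h)\<^sup>2 / real (Suc k) \<le> \<rho>
      then unit_ball_vol (real k) * sqrt (\<rho> - (e - s - real (Suc k) * h)\<^sup>2 / real (Suc k)) ^ k / sqrt (real (Suc k))
      else 0)"
proof (induction k arbitrary: e \<rho>)
  case 0
  show ?case by (simp add: space_PiM emeasure_PiM_empty)
next
  case (Suc k)
  interpret product_sigma_finite "\<lambda>_::nat. lborel :: real measure" by standard
  let ?Q = "\<lambda>k e a. (\<Sum>i\<le>k. ((a(0 := s, Suc k := e)) (Suc i) - (a(0 := s, Suc k := e)) i - h)\<^sup>2)"
  let ?P = "\<lambda>k. \<Pi>\<^sub>M i\<in>{1..k}. (lborel :: real measure)"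
  \<comment> \<open>With the last free coordinate y fixed and the others optimized, the form is (e -
    y - h)^2 + (y - s - (k + 1) h)^2 / (k + 1). As a function of y it has leading coefficient c = 1
    + 1 / (k + 1), and its minimum u^2 / (k + 2) is attained at y = b; \<sigma> is the budget left
    at the minimum.\<close>
  define u where "u = e - s - real (Suc (Suc k)) * h"
  define b where "b = s + real (Suc k) * h + real (Suc k) / real (Suc (Suc k)) * u"
  define c where "c = real (Suc (Suc k)) / real (Suc k)"
  define \<sigma> where "\<sigma> = \<rho> - u\<^sup>2 / real (Suc (Suc k))"
  have comp: "(\<lambda>a. (a(0 := s, Suc k := e)) j) \<in> borel_measurable (?P k)" if "j \<le> Suc k" for j k and e :: real
  proof (cases "j = 0 \<or> j = Suc k")
    case False
    then have "(\<lambda>a. a j) \<in> measurable (?P k) lborel"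
      using that by (intro measurable_component_singleton) auto
    then show ?thesis using False by simp
  qed (auto simp: fun_upd_def)
  have meas: "?Q k e \<in> borel_measurable (?P k)" for k e
    by (intro borel_measurable_sum borel_measurable_power borel_measurable_diff borel_measurable_const comp) auto
  have [measurable]: "{a \<in> space (?P k). ?Q k e a \<le> \<rho>} \<in> sets (?P k)" for k e \<rho>
    using meas by measurable
  have ind_meas: "(indicator {a \<in> space (?P (Suc k)). ?Q (Suc k) e a \<le> \<rho>} :: _ \<Rightarrow> ennreal)
      \<in> borel_measurable (?P (Suc k))"
    by (rule borel_measurable_indicator) measurable
  have Q: "?Q (Suc k) e (a(Suc k := y)) = ?Q k y a + (e - y - h)\<^sup>2" for a y
    by (auto intro!: sum.cong)
  have square: "\<rho> - (e - y - h)\<^sup>2 - (y - s - real (Suc k) * h)\<^sup>2 / real (Suc k) = \<sigma> - c * (y - b)\<^sup>2" for y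
  proof -
    define w where "w = y - s - real (Suc k) * h"
    have 1: "e - y - h = u - w" by (simp add: u_def w_def algebra_simps)
    have 2: "y - b = w - real (Suc k) / real (Suc (Suc k)) * u" by (simp add: b_def w_def)
    show ?thesis
      unfolding 1 2 \<sigma>_def c_def w_def[symmetric]
      by (simp add: divide_simps) (simp add: power2_eq_square algebra_simps)
  qed
  have ins: "{1..Suc k} = insert (Suc k) {1..k}" by auto
  have "emeasure (?P (Suc k)) {a \<in> space (?P (Suc k)). ?Q (Suc k) e a \<le> \<rho>} =
      (\<integral>\<^sup>+ a. indicator {a \<in> space (?P (Suc k)). ?Q (Suc k) e a \<le> \<rho>} a \<partial>?P (Suc k))"
    by (rule nn_integral_indicator[symmetric]) measurable
  also have "\<dots> = (\<integral>\<^sup>+ y. \<integral>\<^sup>+ a. indicator {a \<in> space (?P (Suc k)). ?Q (Suc k) e a \<le> \<rho>} (a(Suc k := y)) \<partial>?P k \<partial>lborel)"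
    unfolding ins
    by (rule product_nn_integral_insert_rev[OF _ _ ind_meas[unfolded ins]]) auto
  also have "\<dots> = (\<integral>\<^sup>+ y. \<integral>\<^sup>+ a. indicator {a \<in> space (?P k). ?Q k y a \<le> \<rho> - (e - y - h)\<^sup>2} a \<partial>?P k \<partial>lborel)"
  proof (intro nn_integral_cong)
    fix y a assume "a \<in> space (?P k)"
    then have "a(Suc k := y) \<in> space (?P (Suc k))"
      by (auto simp: space_PiM PiE_iff extensional_def)
    moreover have "?Q (Suc k) e (a(Suc k := y)) \<le> \<rho> \<longleftrightarrow> ?Q k y a \<le> \<rho> - (e - y - h)\<^sup>2"
      unfolding Q by linarith
    ultimately show "indicator {a \<in> space (?P (Suc k)). ?Q (Suc k) e a \<le> \<rho>} (a(Suc k := y)) =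
        (indicator {a \<in> space (?P k). ?Q k y a \<le> \<rho> - (e - y - h)\<^sup>2} a :: ennreal)"
      using \<open>a \<in> space (?P k)\<close> unfolding indicator_def mem_Collect_eq by presburger
  qed
  also have "\<dots> = (\<integral>\<^sup>+ y. emeasure (?P k) {a \<in> space (?P k). ?Q k y a \<le> \<rho> - (e - y - h)\<^sup>2} \<partial>lborel)"
    by (intro nn_integral_cong nn_integral_indicator) measurable
  also have "\<dots> = (\<integral>\<^sup>+ y. ennreal (unit_ball_vol (real k) / sqrt (real (Suc k))) *
      ennreal (if c * (y - b)\<^sup>2 \<le> \<sigma> then sqrt (\<sigma> - c * (y - b)\<^sup>2) ^ k else 0) \<partial>lborel)"
  proof (intro nn_integral_cong)
    fix y :: real
    have "(y - s - real (Suc k) * h)\<^sup>2 / real (Suc k) \<le> \<rho> - (e - y - h)\<^sup>2 \<longleftrightarrow> c * (y - b)\<^sup>2 \<le> \<sigma>"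
      using square[of y] by linarith
    then show "emeasure (?P k) {a \<in> space (?P k). ?Q k y a \<le> \<rho> - (e - y - h)\<^sup>2} =
        ennreal (unit_ball_vol (real k) / sqrt (real (Suc k))) *
        ennreal (if c * (y - b)\<^sup>2 \<le> \<sigma> then sqrt (\<sigma> - c * (y - b)\<^sup>2) ^ k else 0)"
      unfolding Suc.IH square by (simp add: ennreal_mult'[symmetric])
  qed
  also have "\<dots> = ennreal (unit_ball_vol (real k) / sqrt (real (Suc k))) *
      ennreal (if 0 \<le> \<sigma> then Beta (1/2) (real k / 2 + 1) * sqrt \<sigma> ^ Suc k / sqrt c else 0)"
  proof -
    have "c > 0" by (simp add: c_def)
    then show ?thesis by (subst nn_integral_cmult) (auto simp: nn_integral_sqrt_power_quadratic)
  qed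
  also have "\<dots> = ennreal (if 0 \<le> \<sigma> then (unit_ball_vol (real k) * Beta (1/2) (real k / 2 + 1)) * sqrt \<sigma> ^ Suc k
      / (sqrt (real (Suc k)) * sqrt c) else 0)"
    by (simp add: ennreal_mult'[symmetric] mult_ac)
  \<comment> \<open>The leading coefficients multiply up to the determinant of the quadratic form,
    which telescopes: k + 1 becomes k + 2.\<close>
  also have "sqrt (real (Suc k)) * sqrt c = sqrt (real (Suc (Suc k)))"
    by (simp add: c_def real_sqrt_mult[symmetric])
  also note unit_ball_vol_Suc
  finally show ?case
    unfolding \<sigma>_def u_def by simp
qed

section \<open>Perimeter defect and gap deviations\<close>

lemma abs_sin_minus_self_le: "\<bar>sin w - w\<bar> \<le> \<bar>w\<bar> ^ 3 / 6" for w :: real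
  using Maclaurin_sin_bound[of w 3]
  by (simp add: sin_coeff_def eval_nat_numeral fact_numeral field_simps)

lemma abs_cos_minus_quadratic_le: "\<bar>cos w - (1 - w\<^sup>2 / 2)\<bar> \<le> \<bar>w\<bar> ^ 3 / 6" for w :: real
proof -
  obtain u where "cos w = (\<Sum>i<3. cos_coeff i * w ^ i) + cos (u + 1/2 * real 3 * pi) / fact 3 * w ^ 3"
    using Maclaurin_cos_expansion[of w 3] by blast
  then have "cos w - (1 - w\<^sup>2 / 2) = cos (u + 1/2 * real 3 * pi) * w ^ 3 / 6"
    by (simp add: cos_coeff_def eval_nat_numeral fact_numeral field_simps)
  then have "\<bar>cos w - (1 - w\<^sup>2 / 2)\<bar> = \<bar>cos (u + 1/2 * real 3 * pi)\<bar> * \<bar>w\<bar> ^ 3 / 6"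
    by (simp only: abs_mult abs_divide power_abs abs_numeral)
  also have "\<dots> \<le> 1 * \<bar>w\<bar> ^ 3 / 6"
    by (intro divide_right_mono mult_right_mono abs_cos_le_one) auto
  finally show ?thesis by simp
qed

text \<open>The constant is what the cubic Taylor bound leaves: pi / 2 \<le> 2 gives w^2 / 6 \<le> 2
  / 3.\<close>

lemma sin_ge_third:
  fixes w :: real
  assumes "0 \<le> w" "w \<le> pi / 2"
  shows "w / 3 \<le> sin w"
proof -
  have "w \<le> 2" using assms pi_less_4 by linarith
  have "w\<^sup>2 \<le> 2\<^sup>2" using assms \<open>w \<le> 2\<close> by (intro power_mono) auto
  then have "w * w\<^sup>2 \<le> w * 4" using assms by (intro mult_left_mono) auto
  moreover have "w - sin w \<le> w * w\<^sup>2 / 6"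
  proof -
    have "\<bar>w\<bar> ^ 3 = w * w\<^sup>2" using assms by (simp add: power3_eq_cube power2_eq_square)
    then show ?thesis using abs_sin_minus_self_le[of w] by linarith
  qed
  ultimately show ?thesis by linarith
qed

text \<open>The second derivative of the sine vanishes at 0 and pi, so no uniform bound on it gives
  a quadratic estimate on all of [0, pi]. Instead cos \<phi> - cos z is written as a product of two
  sines: the one at the midpoint stays above sin (\<phi> / 2), the other is at least linear in the
  distance from \<phi>. Integrating from \<phi> gives the quadratic term.\<close>

lemma sin_tangent_gap_lower:
  fixes \<phi> z :: real
  assumes \<phi>: "0 < \<phi>" "\<phi> \<le> pi / 2" and z: "0 \<le> z" "z \<le> pi"
  shows "sin (\<phi> / 2) / 6 * (z - \<phi>)\<^sup>2 \<le> sin \<phi> + (z - \<phi>) * cos \<phi> - sin z"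
proof -
  define c where "c = sin (\<phi> / 2)"
  define f where "f z = sin \<phi> + (z - \<phi>) * cos \<phi> - sin z - c / 6 * (z - \<phi>)\<^sup>2" for z
  have c: "c \<ge> 0" unfolding c_def using \<phi> by (intro sin_ge_zero) auto
  have f': "(f has_real_derivative (cos \<phi> - cos z - c / 3 * (z - \<phi>))) (at z)" for z
    unfolding f_def by (auto intro!: derivative_eq_intros simp: field_simps)
  \<comment> \<open>The midpoint lies in [\<phi> / 2, pi - \<phi> / 2]; the upper end is where
    \<phi> \<le> pi / 2 enters.\<close>
  have mid: "c \<le> sin ((\<phi> + z) / 2)" if "0 \<le> z" "z \<le> pi" for z
  proof (cases "(\<phi> + z) / 2 \<le> pi / 2")
    case True
    then show ?thesis unfolding c_def using \<phi> that by (intro sin_monotone_2pi_le) auto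
  next
    case False
    have "c \<le> sin (pi - (\<phi> + z) / 2)"
      unfolding c_def using \<phi> that False by (intro sin_monotone_2pi_le) (auto simp: field_simps)
    then show ?thesis by simp
  qed
  have diff: "cos \<phi> - cos z = 2 * sin ((\<phi> + z) / 2) * sin ((z - \<phi>) / 2)" for z
    by (rule cos_diff_cos)
  have f\<phi>: "f \<phi> = 0" by (simp add: f_def)
  have "0 \<le> f z"
  proof (cases "\<phi> \<le> z")
    case True
    have "f \<phi> \<le> f z"
    proof (rule DERIV_nonneg_imp_nondecreasing[OF True])
      fix x assume x: "\<phi> \<le> x" "x \<le> z"
      have "c * ((x - \<phi>) / 2 / 3) \<le> sin ((\<phi> + x) / 2) * sin ((x - \<phi>) / 2)"
        using x \<phi> z c by (intro mult_mono mid sin_ge_third) (auto intro: order_trans[OF c mid])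
      moreover have "c * ((x - \<phi>) / 2 / 3) = c / 3 * (x - \<phi>) / 2" by simp
      ultimately have "0 \<le> cos \<phi> - cos x - c / 3 * (x - \<phi>)"
        using diff[of x] by linarith
      then show "\<exists>y. (f has_real_derivative y) (at x) \<and> 0 \<le> y"
        using f' by blast
    qed
    then show ?thesis by (simp add: f\<phi>)
  next
    case False
    then have le: "z \<le> \<phi>" by simp
    have "f \<phi> \<le> f z"
    proof (rule DERIV_nonpos_imp_nonincreasing[OF le])
      fix x assume x: "z \<le> x" "x \<le> \<phi>"
      have "c * ((\<phi> - x) / 2 / 3) \<le> sin ((\<phi> + x) / 2) * sin ((\<phi> - x) / 2)"
        using x \<phi> z c by (intro mult_mono mid sin_ge_third) (auto intro: order_trans[OF c mid])
      moreover have "c * ((\<phi> - x) / 2 / 3) = c / 3 * (\<phi> - x) / 2" by simp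
      moreover have "c / 3 * (x - \<phi>) = - (c / 3 * (\<phi> - x))"
        using mult_minus_right[of "c / 3" "\<phi> - x"] unfolding minus_diff_eq .
      moreover have "sin ((x - \<phi>) / 2) = - sin ((\<phi> - x) / 2)"
        using sin_minus[of "(\<phi> - x) / 2"] unfolding minus_divide_left minus_diff_eq .
      then have "cos \<phi> - cos x = - (2 * (sin ((\<phi> + x) / 2) * sin ((\<phi> - x) / 2)))"
        unfolding diff by (simp only: mult_minus_right mult.assoc)
      ultimately have "cos \<phi> - cos x - c / 3 * (x - \<phi>) \<le> 0"
        by linarith
      then show "\<exists>y. (f has_real_derivative y) (at x) \<and> y \<le> 0"
        using f' by blast
    qed
    then show ?thesis by (simp add: f\<phi>)
  qed
  then show ?thesis by (simp add: f_def c_def)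
qed

text \<open>The addition theorem reduces the error to the Taylor remainders of sine and cosine at 0,
  each at most |w|^3 / 6, with coefficients sin \<phi> and cos \<phi>; hence the bound is uniform in
  \<phi>.\<close>

lemma sin_tangent_gap_approx:
  fixes \<phi> w :: real
  shows "\<bar>(sin \<phi> + w * cos \<phi> - sin (\<phi> + w)) - sin \<phi> / 2 * w\<^sup>2\<bar> \<le> \<bar>w\<bar> ^ 3 / 3"
proof -
  have eq: "(sin \<phi> + w * cos \<phi> - sin (\<phi> + w)) - sin \<phi> / 2 * w\<^sup>2 =
      - (sin \<phi> * (cos w - (1 - w\<^sup>2 / 2)) + cos \<phi> * (sin w - w))"
    unfolding sin_add by algebra
  have "\<bar>sin \<phi> * (cos w - (1 - w\<^sup>2 / 2)) + cos \<phi> * (sin w - w)\<bar>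
      \<le> \<bar>sin \<phi>\<bar> * \<bar>cos w - (1 - w\<^sup>2 / 2)\<bar> + \<bar>cos \<phi>\<bar> * \<bar>sin w - w\<bar>"
    by (rule order_trans[OF abs_triangle_ineq]) (simp add: abs_mult)
  also have "\<dots> \<le> 1 * (\<bar>w\<bar> ^ 3 / 6) + 1 * (\<bar>w\<bar> ^ 3 / 6)"
    by (intro add_mono mult_mono abs_sin_minus_self_le abs_cos_minus_quadratic_le) auto
  finally show ?thesis unfolding eq abs_minus_cancel by simp
qed

text \<open>The function \<open>b\<close> lists the angles of an \<open>m\<close>-gon in increasing order on \<open>{..<m}\<close>; other arguments are
  irrelevant.\<close>

definition arc_gap :: "nat \<Rightarrow> (nat \<Rightarrow> real) \<Rightarrow> nat \<Rightarrow> real" where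
  "arc_gap m b k = (if Suc k = m then b 0 + 2 * pi else b (Suc k)) - b k"

definition defect :: "nat \<Rightarrow> (nat \<Rightarrow> real) \<Rightarrow> real" where
  "defect m b = 2 * real m * sin (pi / real m) - (\<Sum>k<m. 2 * sin (arc_gap m b k / 2))"

definition gap_deviation :: "nat \<Rightarrow> (nat \<Rightarrow> real) \<Rightarrow> real" where
  "gap_deviation m b = (\<Sum>k<m. (arc_gap m b k - 2 * pi / real m)\<^sup>2)"

lemma sum_arc_gap_aux:
  "k < m \<Longrightarrow> (\<Sum>i<k. arc_gap m b i) = b k - b 0"
  by (induction k) (auto simp: arc_gap_def)

lemma sum_arc_gap:
  assumes "m > 0"
  shows "(\<Sum>k<m. arc_gap m b k) = 2 * pi"
proof -
  obtain l where m: "m = Suc l" using assms by (cases m) auto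
  show ?thesis using sum_arc_gap_aux[of l m b] by (simp add: m arc_gap_def)
qed

text \<open>The gaps sum to 2 pi, so their deviations sum to zero and the linear tangent terms can
  be inserted for free. This removes the first order part of the defect and leaves a sum of
  single-gap errors.\<close>

lemma defect_eq_sum_tangent_gap:
  assumes "m > 0"
  defines "\<phi> \<equiv> pi / real m"
  shows "defect m b =
    (\<Sum>k<m. 2 * (sin \<phi> + (arc_gap m b k / 2 - \<phi>) * cos \<phi> - sin (\<phi> + (arc_gap m b k / 2 - \<phi>))))"
proof -
  have "(\<Sum>k<m. arc_gap m b k / 2 - \<phi>) = 0"
    using assms sum_arc_gap[of m b] by (simp add: sum_subtractf flip: sum_divide_distrib)
  then have "(\<Sum>k<m. 2 * ((arc_gap m b k / 2 - \<phi>) * cos \<phi>)) = 0"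
    by (simp flip: sum_distrib_left sum_distrib_right)
  moreover have "defect m b = (\<Sum>k<m. 2 * sin \<phi> - 2 * sin (arc_gap m b k / 2))"
    by (simp add: defect_def sum_subtractf \<phi>_def)
  moreover have "(\<Sum>k<m. 2 * (sin \<phi> + (arc_gap m b k / 2 - \<phi>) * cos \<phi> - sin (\<phi> + (arc_gap m b k / 2 - \<phi>)))) =
      (\<Sum>k<m. 2 * ((arc_gap m b k / 2 - \<phi>) * cos \<phi>)) + (\<Sum>k<m. 2 * sin \<phi> - 2 * sin (arc_gap m b k / 2))"
    unfolding sum.distrib[symmetric] by (intro sum.cong refl) simp
  ultimately show ?thesis by simp
qed

text \<open>The coarse bound that localizes: it holds however far the polygon is from regular. The
  factor 1/12 is 2 (each chord is twice a sine) times 1/6 times 1/4 (from halving the gaps).\<close>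

lemma defect_lower:
  assumes m: "m \<ge> 2" and gap: "\<And>k. k < m \<Longrightarrow> 0 \<le> arc_gap m b k \<and> arc_gap m b k \<le> 2 * pi"
  shows "sin (pi / real m / 2) / 12 * gap_deviation m b \<le> defect m b"
proof -
  define \<phi> where "\<phi> = pi / real m"
  have \<phi>: "0 < \<phi>" "\<phi> \<le> pi / 2" using m by (auto simp: \<phi>_def field_simps)
  show ?thesis
    using m unfolding gap_deviation_def defect_eq_sum_tangent_gap[OF less_le_trans[OF pos2 m]] sum_distrib_left
  proof (intro sum_mono, fold \<phi>_def)
    fix k assume k: "k \<in> {..<m}"
    have "sin (\<phi> / 2) / 6 * (arc_gap m b k / 2 - \<phi>)\<^sup>2
      \<le> sin \<phi> + (arc_gap m b k / 2 - \<phi>) * cos \<phi> - sin (arc_gap m b k / 2)"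
      using gap[of k] k \<phi> by (intro sin_tangent_gap_lower) auto
    moreover have "arc_gap m b k - 2 * pi / real m = 2 * (arc_gap m b k / 2 - \<phi>)"
      by (simp add: \<phi>_def)
    then have "(arc_gap m b k - 2 * pi / real m)\<^sup>2 = 4 * (arc_gap m b k / 2 - \<phi>)\<^sup>2"
      by (simp only: power_mult_distrib) simp
    ultimately show "sin (\<phi> / 2) / 12 * (arc_gap m b k - 2 * pi / real m)\<^sup>2 \<le>
        2 * (sin \<phi> + (arc_gap m b k / 2 - \<phi>) * cos \<phi> - sin (\<phi> + (arc_gap m b k / 2 - \<phi>)))"
      by simp
  qed
qed

lemma abs_gap_le_sqrt_deviation:
  assumes "k < m"
  shows "\<bar>arc_gap m b k - 2 * pi / real m\<bar> \<le> sqrt (gap_deviation m b)"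
proof -
  have "(arc_gap m b k - 2 * pi / real m)\<^sup>2 \<le> gap_deviation m b"
    unfolding gap_deviation_def using assms
    by (intro member_le_sum[where f = "\<lambda>k. (arc_gap m b k - 2 * pi / real m)\<^sup>2"]) auto
  then show ?thesis using real_sqrt_le_mono by fastforce
qed

lemma gap_deviation_nonneg: "0 \<le> gap_deviation m b"
  unfolding gap_deviation_def by (intro sum_nonneg) auto

text \<open>In the cubic error of each gap, one factor is bounded by the square root of the total
  deviation and the other two are summed to the deviation itself. The coefficient sin (pi / m) / 4
  is half the second derivative of the chord deficit with respect to the gap.\<close>

lemma defect_approx:
  assumes m: "m > 0"
  shows "\<bar>defect m b - sin (pi / real m) / 4 * gap_deviation m b\<bar> \<le> gap_deviation m b * sqrt (gap_deviation m b)"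
proof -
  define \<phi> where "\<phi> = pi / real m"
  define x where "x k = arc_gap m b k - 2 * pi / real m" for k
  have half: "arc_gap m b k / 2 - \<phi> = x k / 2" for k by (simp add: \<phi>_def x_def)
  have "\<bar>defect m b - sin \<phi> / 4 * gap_deviation m b\<bar> =
    \<bar>(\<Sum>k<m. 2 * ((sin \<phi> + (x k / 2) * cos \<phi> - sin (\<phi> + x k / 2)) - sin \<phi> / 2 * (x k / 2)\<^sup>2))\<bar>"
    unfolding defect_eq_sum_tangent_gap[OF m] \<phi>_def[symmetric] half gap_deviation_def x_def[symmetric]
    unfolding sum_distrib_left sum_subtractf[symmetric]
    by (intro arg_cong[where f = abs] sum.cong refl) (simp add: power_divide)
  also have "\<dots> \<le> (\<Sum>k<m. \<bar>2 * ((sin \<phi> + (x k / 2) * cos \<phi> - sin (\<phi> + x k / 2)) - sin \<phi> / 2 * (x k / 2)\<^sup>2)\<bar>)"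
    by (rule sum_abs)
  also have "\<dots> \<le> (\<Sum>k<m. (x k)\<^sup>2 * sqrt (gap_deviation m b))"
  proof (rule sum_mono)
    fix k assume k: "k \<in> {..<m}"
    have "\<bar>2 * ((sin \<phi> + (x k / 2) * cos \<phi> - sin (\<phi> + x k / 2)) - sin \<phi> / 2 * (x k / 2)\<^sup>2)\<bar>
      \<le> 2 * (\<bar>x k / 2\<bar> ^ 3 / 3)"
      unfolding abs_mult[of 2] abs_numeral by (rule mult_left_mono[OF sin_tangent_gap_approx]) simp
    also have "\<dots> \<le> \<bar>x k\<bar> ^ 3" by (simp add: power_divide)
    also have "\<dots> = (x k)\<^sup>2 * \<bar>x k\<bar>" by (simp add: power3_eq_cube power2_eq_square abs_mult)
    also have "\<dots> \<le> (x k)\<^sup>2 * sqrt (gap_deviation m b)"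
      using abs_gap_le_sqrt_deviation[of k m b] k by (intro mult_left_mono) (auto simp: x_def)
    finally show "\<bar>2 * ((sin \<phi> + (x k / 2) * cos \<phi> - sin (\<phi> + x k / 2)) - sin \<phi> / 2 * (x k / 2)\<^sup>2)\<bar>
      \<le> (x k)\<^sup>2 * sqrt (gap_deviation m b)" .
  qed
  finally show ?thesis
    unfolding \<phi>_def by (simp add: gap_deviation_def x_def sum_distrib_right)
qed

section \<open>Probability of a nearly regular polygon\<close>

lemma emeasure_PiM_uniform:
  fixes A :: "real set" and c :: real
  assumes "finite I" and A: "A \<in> sets borel" "emeasure lborel A = ennreal c" "c > 0"
    and X: "X \<in> sets (PiM I (\<lambda>_. lborel))"
  shows "emeasure (PiM I (\<lambda>_. uniform_measure lborel A)) X =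
    ennreal ((1 / c) ^ card I) * emeasure (PiM I (\<lambda>_. lborel)) (PiE I (\<lambda>_. A) \<inter> X)"
proof -
  let ?u = "uniform_measure lborel A" and ?L = "PiM I (\<lambda>_. lborel :: real measure)"
  have fact: "emeasure ?u B = ennreal (1 / c) * emeasure lborel (A \<inter> B)" if "B \<in> sets borel" for B
    using A that by (simp add: divide_ennreal_def inverse_ennreal mult.commute inverse_eq_divide)
  interpret u: prob_space ?u using A by (intro prob_space_uniform_measure) auto
  interpret U: product_sigma_finite "\<lambda>_. ?u" ..
  interpret L: product_sigma_finite "\<lambda>_. lborel :: real measure" ..
  have box: "PiE I (\<lambda>_. A) \<in> sets ?L" using assms by (intro sets_PiM_I_finite) auto
  have dens: "emeasure (density ?L (\<lambda>x. ennreal ((1 / c) ^ card I) * indicator (PiE I (\<lambda>_. A)) x)) X =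
      ennreal ((1 / c) ^ card I) * emeasure ?L (PiE I (\<lambda>_. A) \<inter> X)" if "X \<in> sets ?L" for X
    using that box
    by (simp add: emeasure_density nn_integral_cmult mult.assoc flip: indicator_inter_arith)
  have "density ?L (\<lambda>x. ennreal ((1 / c) ^ card I) * indicator (PiE I (\<lambda>_. A)) x) = PiM I (\<lambda>_. ?u)"
  proof (rule U.PiM_eqI)
    show "sets (density ?L (\<lambda>x. ennreal ((1 / c) ^ card I) * indicator (PiE I (\<lambda>_. A)) x)) = sets (PiM I (\<lambda>_. ?u))"
      by (simp, intro sets_PiM_cong) auto
    fix B assume "\<And>i. i \<in> I \<Longrightarrow> B i \<in> sets ?u"
    then have B: "\<And>i. i \<in> I \<Longrightarrow> B i \<in> sets borel" by simp
    then have "PiE I B \<in> sets ?L" using \<open>finite I\<close> by (intro sets_PiM_I_finite) auto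
    then have "emeasure (density ?L (\<lambda>x. ennreal ((1 / c) ^ card I) * indicator (PiE I (\<lambda>_. A)) x)) (PiE I B) =
      ennreal ((1 / c) ^ card I) * emeasure ?L (PiE I (\<lambda>i. A \<inter> B i))"
      by (simp add: dens PiE_Int)
    also have "emeasure ?L (PiE I (\<lambda>i. A \<inter> B i)) = (\<Prod>i\<in>I. emeasure lborel (A \<inter> B i))"
      using B A \<open>finite I\<close> by (intro L.emeasure_PiM) auto
    also have "ennreal ((1 / c) ^ card I) * (\<Prod>i\<in>I. emeasure lborel (A \<inter> B i)) = (\<Prod>i\<in>I. emeasure ?u (B i))"
    proof -
      have "ennreal ((1 / c) ^ card I) = (\<Prod>i\<in>I. ennreal (1 / c))"
        using A by (simp add: ennreal_power)
      then show ?thesis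
        using B by (simp only: prod.distrib[symmetric]) (intro prod.cong refl, simp only: fact)
    qed
    finally show "emeasure (density ?L (\<lambda>x. ennreal ((1 / c) ^ card I) * indicator (PiE I (\<lambda>_. A)) x)) (PiE I B) =
        (\<Prod>i\<in>I. emeasure ?u (B i))" .
  qed fact
  then show ?thesis using dens[OF X] by simp
qed

lemma measurable_PiM_component:
  "i \<in> I \<Longrightarrow> (\<lambda>a. a i) \<in> borel_measurable (PiM I (\<lambda>_. lborel :: real measure))"
  using measurable_component_singleton[of i I "\<lambda>_. lborel :: real measure"] by simp

lemma measurable_arc_gap:
  assumes "k < m" "\<And>j. j < m \<Longrightarrow> (\<lambda>x. f x j) \<in> borel_measurable N"
  shows "(\<lambda>x. arc_gap m (f x) k) \<in> borel_measurable N"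
proof (cases "Suc k = m")
  case True
  then show ?thesis using assms(2)[of 0] assms(2)[of k] by (simp add: arc_gap_def)
next
  case False
  then show ?thesis using assms(1) assms(2)[of "Suc k"] assms(2)[of k] by (simp add: arc_gap_def)
qed

lemma measurable_defect:
  assumes "\<And>j. j < m \<Longrightarrow> (\<lambda>x. f x j) \<in> borel_measurable N"
  shows "(\<lambda>x. defect m (f x)) \<in> borel_measurable N"
proof -
  have [measurable]: "(\<lambda>x. arc_gap m (f x) k) \<in> borel_measurable N" if "k < m" for k
    using that assms by (rule measurable_arc_gap)
  show ?thesis unfolding defect_def
    by (intro borel_measurable_diff borel_measurable_sum borel_measurable_const) measurable
qed

lemma measurable_gap_deviation:
  assumes "\<And>j. j < m \<Longrightarrow> (\<lambda>x. f x j) \<in> borel_measurable N"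
  shows "(\<lambda>x. gap_deviation m (f x)) \<in> borel_measurable N"
  unfolding gap_deviation_def
  by (intro borel_measurable_sum borel_measurable_power borel_measurable_diff borel_measurable_const
      measurable_arc_gap assms) auto

lemma indicator_eq_mult:
  "(x \<in> A \<longleftrightarrow> y \<in> B \<and> z \<in> C) \<Longrightarrow> indicator A x = (indicator B y * indicator C z :: ennreal)"
  by (auto simp: indicator_def)

text \<open>With b 0 = y fixed, the angles form a chain from y to y + 2 pi with target step 2 pi /
  m. The total matches m steps exactly, so the offset in \<open>emeasure_chain_ellipsoid\<close> is
  zero and the volume does not depend on y.\<close>

lemma emeasure_gap_deviation_ball:
  assumes J: "J \<in> sets borel" and "\<rho> \<ge> 0"
  shows "emeasure (PiM {..<Suc k} (\<lambda>_. lborel))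
      {b \<in> space (PiM {..<Suc k} (\<lambda>_. lborel)). b 0 \<in> J \<and> gap_deviation (Suc k) b \<le> \<rho>} =
    emeasure lborel J * ennreal (unit_ball_vol (real k) * sqrt \<rho> ^ k / sqrt (real (Suc k)))"
proof -
  interpret product_sigma_finite "\<lambda>_::nat. lborel :: real measure" by standard
  let ?P = "PiM {..<Suc k} (\<lambda>_. lborel :: real measure)"
  let ?P' = "PiM {1..k} (\<lambda>_. lborel :: real measure)"
  let ?Q = "\<lambda>y a. (\<Sum>i\<le>k. ((a(0 := y, Suc k := y + 2 * pi)) (Suc i)
      - (a(0 := y, Suc k := y + 2 * pi)) i - 2 * pi / real (Suc k))\<^sup>2)"
  let ?Y = "{b \<in> space ?P. b 0 \<in> J \<and> gap_deviation (Suc k) b \<le> \<rho>}"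
  have [measurable]: "(\<lambda>b. gap_deviation (Suc k) b) \<in> borel_measurable ?P"
    by (intro measurable_gap_deviation measurable_PiM_component) auto
  have [measurable]: "(\<lambda>b. b 0) \<in> borel_measurable ?P"
    by (intro measurable_PiM_component) auto
  note J[measurable]
  have Y: "?Y \<in> sets ?P" by measurable
  have ins: "{..<Suc k} = insert 0 {1..k}" by auto
  have dev: "gap_deviation (Suc k) (a(0 := y)) = ?Q y a" for a y
    unfolding gap_deviation_def lessThan_Suc_atMost
    by (intro sum.cong refl) (auto simp: arc_gap_def)
  have "emeasure ?P ?Y = (\<integral>\<^sup>+ b. indicator ?Y b \<partial>?P)"
    by (rule nn_integral_indicator[symmetric]) (rule Y)
  also have "\<dots> = (\<integral>\<^sup>+ y. \<integral>\<^sup>+ a. indicator ?Y (a(0 := y)) \<partial>?P' \<partial>lborel)"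
    unfolding ins
    by (rule product_nn_integral_insert_rev[OF _ _ borel_measurable_indicator[OF Y, unfolded ins]]) auto
  also have "\<dots> = (\<integral>\<^sup>+ y. \<integral>\<^sup>+ a. indicator J y * indicator {a \<in> space ?P'. ?Q y a \<le> \<rho>} a \<partial>?P' \<partial>lborel)"
  proof (intro nn_integral_cong)
    fix y a assume "a \<in> space ?P'"
    then have "a(0 := y) \<in> space ?P"
      by (auto simp: space_PiM PiE_iff extensional_def)
    then have "a(0 := y) \<in> ?Y \<longleftrightarrow> y \<in> J \<and> a \<in> {a \<in> space ?P'. ?Q y a \<le> \<rho>}"
      using \<open>a \<in> space ?P'\<close> dev[of a y] by (simp del: fun_upd_apply) simp
    then show "indicator ?Y (a(0 := y)) = (indicator J y * indicator {a \<in> space ?P'. ?Q y a \<le> \<rho>} a :: ennreal)"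
      by (rule indicator_eq_mult)
  qed
  also have "\<dots> = (\<integral>\<^sup>+ y. ennreal (unit_ball_vol (real k) * sqrt \<rho> ^ k / sqrt (real (Suc k))) * indicator J y \<partial>lborel)"
  proof (intro nn_integral_cong)
    fix y :: real
    have set: "{a \<in> space ?P'. ?Q y a \<le> \<rho>} \<in> sets ?P'"
    proof -
      have comp: "(\<lambda>a. (a(0 := y)) j) \<in> borel_measurable ?P'" if "j < Suc k" for j
      proof (cases "j = 0")
        case False
        then show ?thesis using that by (simp add: measurable_PiM_component)
      qed simp
      then have "(\<lambda>a. gap_deviation (Suc k) (a(0 := y))) \<in> borel_measurable ?P'"
        by (rule measurable_gap_deviation)
      then show ?thesis unfolding dev by measurable
    qed
    have "(\<integral>\<^sup>+ a. indicator J y * indicator {a \<in> space ?P'. ?Q y a \<le> \<rho>} a \<partial>?P') =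
        indicator J y * emeasure ?P' {a \<in> space ?P'. ?Q y a \<le> \<rho>}"
      using set by (subst nn_integral_cmult_indicator) auto
    also have "emeasure ?P' {a \<in> space ?P'. ?Q y a \<le> \<rho>} =
        ennreal (unit_ball_vol (real k) * sqrt \<rho> ^ k / sqrt (real (Suc k)))"
      using \<open>\<rho> \<ge> 0\<close> by (subst emeasure_chain_ellipsoid) simp
    finally show "(\<integral>\<^sup>+ a. indicator J y * indicator {a \<in> space ?P'. ?Q y a \<le> \<rho>} a \<partial>?P') =
        ennreal (unit_ball_vol (real k) * sqrt \<rho> ^ k / sqrt (real (Suc k))) * indicator J y"
      by (simp only: mult.commute)
  qed
  also have "\<dots> = emeasure lborel J * ennreal (unit_ball_vol (real k) * sqrt \<rho> ^ k / sqrt (real (Suc k)))"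
    using J by (subst nn_integral_cmult_indicator) (auto simp: mult.commute)
  finally show ?thesis .
qed

text \<open>A condition on ordered tuples. Strict increase makes the conditions for different
  enumerations of the same points mutually exclusive, so their probabilities add up.\<close>

definition near_regular :: "nat \<Rightarrow> real \<Rightarrow> (nat \<Rightarrow> real) \<Rightarrow> bool" where
  "near_regular m \<epsilon> b \<longleftrightarrow> (\<forall>k. Suc k < m \<longrightarrow> b k < b (Suc k)) \<and> defect m b \<le> \<epsilon>"

text \<open>Reciprocal of the coefficient in \<open>defect_lower\<close>.\<close>

definition deviation_const :: "nat \<Rightarrow> real" where
  "deviation_const m = 12 / sin (pi / real m / 2)"

lemma deviation_const_pos: "m \<ge> 2 \<Longrightarrow> deviation_const m > 0"
  unfolding deviation_const_def by (intro divide_pos_pos sin_gt_zero) (auto simp: field_simps)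

lemma increasing_chain_less:
  fixes b :: "nat \<Rightarrow> real"
  assumes "\<forall>k. Suc k < m \<longrightarrow> b k < b (Suc k)" "i < j" "j < m"
  shows "b i < b j"
  using assms(2,3)
proof (induction j)
  case (Suc j)
  then have "b j < b (Suc j)" "i < j \<or> i = j" using assms(1) by auto
  then show ?case using Suc by auto
qed simp

lemma near_regular_gaps:
  assumes "near_regular m \<epsilon> b" "\<And>k. k < m \<Longrightarrow> 0 \<le> b k \<and> b k < 2 * pi" "k < m"
  shows "0 \<le> arc_gap m b k \<and> arc_gap m b k \<le> 2 * pi"
proof (cases "Suc k = m")
  case True
  have "b 0 \<le> b k"
    using increasing_chain_less[of m b 0 k] assms by (cases "k = 0") (auto simp: near_regular_def)
  then show ?thesis using True assms(2)[OF assms(3)] assms(2)[of 0] assms(3) by (simp add: arc_gap_def)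
next
  case False
  then have "b k < b (Suc k)" using assms(1,3) by (auto simp: near_regular_def)
  then show ?thesis using assms(2)[OF assms(3)] assms(2)[of "Suc k"] assms(3) False by (simp add: arc_gap_def)
qed

lemma near_regular_deviation:
  assumes m: "m \<ge> 2" and b: "near_regular m \<epsilon> b" "\<And>k. k < m \<Longrightarrow> 0 \<le> b k \<and> b k < 2 * pi"
  shows "gap_deviation m b \<le> deviation_const m * \<epsilon>"
proof -
  have pos: "sin (pi / real m / 2) > 0" using m by (intro sin_gt_zero) (auto simp: field_simps)
  have "sin (pi / real m / 2) / 12 * gap_deviation m b \<le> defect m b"
    using near_regular_gaps[OF b] by (intro defect_lower m) auto
  also have "\<dots> \<le> \<epsilon>" using b by (simp add: near_regular_def)
  finally show ?thesis using pos by (simp add: deviation_const_def field_simps)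
qed

text \<open>Bootstrapping: the coarse bound makes every gap deviation at most \<delta>, and this
  \<delta> then controls the cubic error of the sharp expansion. The bound on b 0 comes from the
  closing gap, because the last angle is below 2 pi.\<close>

lemma near_regular_upper:
  assumes m: "m \<ge> 2" and b: "near_regular m \<epsilon> b" "\<And>k. k < m \<Longrightarrow> 0 \<le> b k \<and> b k < 2 * pi"
  defines "\<delta> \<equiv> sqrt (deviation_const m * \<epsilon>)"
  shows "b 0 \<in> {0..2 * pi / real m + \<delta>}"
    and "gap_deviation m b \<le> 4 / sin (pi / real m) * (\<epsilon> + \<delta> ^ 3)"
proof -
  have dev: "sqrt (gap_deviation m b) \<le> \<delta>"
    unfolding \<delta>_def using near_regular_deviation[OF m b] by (rule real_sqrt_le_mono)
  have "\<bar>arc_gap m b (m - 1) - 2 * pi / real m\<bar> \<le> \<delta>"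
    using abs_gap_le_sqrt_deviation[of "m - 1" m b] m dev by linarith
  then show "b 0 \<in> {0..2 * pi / real m + \<delta>}"
    using b(2)[of 0] b(2)[of "m - 1"] m by (auto simp: arc_gap_def)
  have s: "sin (pi / real m) > 0" using m by (intro sin_gt_zero) (auto simp: field_simps)
  have "gap_deviation m b * sqrt (gap_deviation m b) = sqrt (gap_deviation m b) ^ 3"
    using gap_deviation_nonneg[of m b] by (simp add: power3_eq_cube)
  also have "\<dots> \<le> \<delta> ^ 3" using dev gap_deviation_nonneg[of m b] by (intro power_mono) auto
  finally have "sin (pi / real m) / 4 * gap_deviation m b \<le> \<epsilon> + \<delta> ^ 3"
    using defect_approx[of m b] m b(1) by (simp add: near_regular_def abs_le_iff)
  then show "gap_deviation m b \<le> 4 / sin (pi / real m) * (\<epsilon> + \<delta> ^ 3)"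
    using s by (simp add: field_simps)
qed

text \<open>The converse inclusion. A radius below 2 pi / m keeps the gaps positive, hence the
  angles sorted; the margin \<open>sqrt \<rho>\<close> in the bound on b 0 keeps the last angle
  below 2 pi.\<close>

lemma near_regular_lower:
  assumes m: "m \<ge> 2" and dev: "gap_deviation m b \<le> \<rho>" and \<rho>: "sqrt \<rho> < 2 * pi / real m"
    and b0: "0 \<le> b 0" "b 0 < 2 * pi / real m - sqrt \<rho>"
    and \<epsilon>: "sin (pi / real m) / 4 * \<rho> + sqrt \<rho> ^ 3 \<le> \<epsilon>"
  shows "near_regular m \<epsilon> b" and "k < m \<Longrightarrow> 0 \<le> b k \<and> b k < 2 * pi"
proof -
  have sq: "sqrt (gap_deviation m b) \<le> sqrt \<rho>" using dev by (rule real_sqrt_le_mono)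
  have gap: "\<bar>arc_gap m b k - 2 * pi / real m\<bar> \<le> sqrt \<rho>" if "k < m" for k
    using abs_gap_le_sqrt_deviation[OF that, of b] sq by linarith
  have inc: "\<forall>k. Suc k < m \<longrightarrow> b k < b (Suc k)"
  proof (intro allI impI)
    fix k assume k: "Suc k < m"
    then show "b k < b (Suc k)" using gap[of k] \<rho> by (auto simp: arc_gap_def abs_le_iff)
  qed
  have s: "sin (pi / real m) > 0" using m by (intro sin_gt_zero) (auto simp: field_simps)
  have "gap_deviation m b * sqrt (gap_deviation m b) = sqrt (gap_deviation m b) ^ 3"
    using gap_deviation_nonneg[of m b] by (simp add: power3_eq_cube)
  also have "\<dots> \<le> sqrt \<rho> ^ 3" using sq gap_deviation_nonneg[of m b] by (intro power_mono) auto
  finally have "gap_deviation m b * sqrt (gap_deviation m b) \<le> sqrt \<rho> ^ 3" .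
  moreover have "sin (pi / real m) / 4 * gap_deviation m b \<le> sin (pi / real m) / 4 * \<rho>"
    using s dev by (intro mult_left_mono) auto
  ultimately have "defect m b \<le> \<epsilon>"
    using defect_approx[of m b] m \<epsilon> by (simp add: abs_le_iff)
  with inc show "near_regular m \<epsilon> b" by (simp add: near_regular_def)
  assume k: "k < m"
  have "b 0 \<le> b k" using increasing_chain_less[OF inc, of 0 k] k by (cases "k = 0") auto
  moreover have "b k \<le> b (m - 1)"
  proof (cases "k < m - 1")
    case True
    then show ?thesis using increasing_chain_less[OF inc True] by simp
  next
    case False
    then have "k = m - 1" using k by simp
    then show ?thesis by simp
  qed
  moreover have "b (m - 1) < 2 * pi"
    using gap[of "m - 1"] m b0 by (auto simp: arc_gap_def abs_le_iff)
  ultimately show "0 \<le> b k \<and> b k < 2 * pi" using b0 by linarith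
qed

lemma measurable_near_regular:
  assumes "\<And>j. j < m \<Longrightarrow> (\<lambda>x. f x j) \<in> borel_measurable N"
  shows "Measurable.pred N (\<lambda>x. near_regular m \<epsilon> (f x))"
proof -
  have "Measurable.pred N (\<lambda>x. f x k < f x (Suc k))" if "Suc k < m" for k
  proof -
    have [measurable]: "(\<lambda>x. f x k) \<in> borel_measurable N" "(\<lambda>x. f x (Suc k)) \<in> borel_measurable N"
      using that by (auto intro!: assms)
    show ?thesis by measurable
  qed
  then have "Measurable.pred N (\<lambda>x. Suc k < m \<longrightarrow> f x k < f x (Suc k))" for k
    by (cases "Suc k < m") auto
  moreover have "Measurable.pred N (\<lambda>x. defect m (f x) \<le> \<epsilon>)"
  proof -
    have [measurable]: "(\<lambda>x. defect m (f x)) \<in> borel_measurable N"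
      by (intro measurable_defect assms)
    show ?thesis by measurable
  qed
  ultimately show ?thesis unfolding near_regular_def by (intro pred_intros_logic(3) pred_intros_countable(1))
qed

definition angle_measure :: "real measure" where
  "angle_measure = uniform_measure lborel {0..<2 * pi}"

lemma sets_angle_measure [simp, measurable_cong]: "sets angle_measure = sets borel"
  by (simp add: angle_measure_def)

lemma space_angle_measure [simp]: "space angle_measure = UNIV"
  by (simp add: angle_measure_def)

lemma prob_space_angle_measure: "prob_space angle_measure"
  unfolding angle_measure_def by (intro prob_space_uniform_measure) auto

definition near_regular_prob :: "nat \<Rightarrow> real \<Rightarrow> real" where
  "near_regular_prob m \<epsilon> = measure (PiM {..<m} (\<lambda>_. angle_measure))
     {b \<in> space (PiM {..<m} (\<lambda>_. angle_measure)). near_regular m \<epsilon> b}"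

text \<open>For fixed first angle \<open>b 0\<close> the other angles range over an ellipsoid. The condition that the angles
  are sorted within \<open>[0, 2 * pi)\<close> confines \<open>b 0\<close> to an interval of length \<open>2 * pi / m\<close>, up to the size
  of the gap deviations; so no reduction modulo \<open>2 * pi\<close> is needed.\<close>

lemma near_regular_prob_bounds:
  fixes k :: nat
  defines "m \<equiv> Suc k"
  defines "s \<equiv> sin (pi / real m)"
  defines "\<kappa> \<equiv> (1 / (2 * pi)) ^ m * (unit_ball_vol (real k) / sqrt (real m))"
  assumes k: "k \<ge> 1" and x: "x \<ge> 0"
  shows "near_regular_prob m (x\<^sup>2) \<le> \<kappa> * (2 * pi / real m + sqrt (deviation_const m) * x)
      * sqrt (4 / s * (x\<^sup>2 + (sqrt (deviation_const m) * x) ^ 3)) ^ k"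
    and "\<rho> \<ge> 0 \<Longrightarrow> sqrt \<rho> < 2 * pi / real m \<Longrightarrow> s / 4 * \<rho> + sqrt \<rho> ^ 3 \<le> x\<^sup>2 \<Longrightarrow>
      \<kappa> * (2 * pi / real m - sqrt \<rho>) * sqrt \<rho> ^ k \<le> near_regular_prob m (x\<^sup>2)"
proof -
  have m: "m \<ge> 2" using k by (simp add: m_def)
  let ?L = "PiM {..<m} (\<lambda>_. lborel :: real measure)" and ?U = "PiM {..<m} (\<lambda>_. angle_measure)"
  define Z where "Z = {b \<in> space ?L. near_regular m (x\<^sup>2) b \<and> (\<forall>k<m. 0 \<le> b k \<and> b k < 2 * pi)}"
  interpret prob_space ?U
    by (intro prob_space_PiM prob_space_angle_measure)
  have spaces: "space ?U = space ?L" by (simp add: space_PiM)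
  have sets: "{b \<in> space ?L. near_regular m (x\<^sup>2) b} \<in> sets ?L"
    using measurable_near_regular[of m "\<lambda>b. b" ?L "x\<^sup>2"] measurable_PiM_component[of _ "{..<m}"]
    by (auto simp: pred_def)
  have sq: "(\<Pi>\<^sub>E k\<in>{..<m}. {0..<2 * pi}) \<in> sets ?L"
    by (intro sets_PiM_I_finite) auto
  have Z_eq: "(\<Pi>\<^sub>E k\<in>{..<m}. {0..<2 * pi}) \<inter> {b \<in> space ?L. near_regular m (x\<^sup>2) b} = Z"
  proof -
    have "b \<in> (\<Pi>\<^sub>E k\<in>{..<m}. {0..<2 * pi}) \<longleftrightarrow> b \<in> space ?L \<and> (\<forall>k<m. 0 \<le> b k \<and> b k < 2 * pi)" for b
      unfolding space_PiM PiE_iff by force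
    then show ?thesis unfolding Z_def by blast
  qed
  have Z: "Z \<in> sets ?L" using sets sq unfolding Z_eq[symmetric] by auto
  have prob: "ennreal (near_regular_prob m (x\<^sup>2)) = ennreal ((1 / (2 * pi)) ^ m) * emeasure ?L Z"
  proof -
    have "ennreal (near_regular_prob m (x\<^sup>2)) = emeasure ?U {b \<in> space ?L. near_regular m (x\<^sup>2) b}"
      unfolding near_regular_prob_def spaces by (simp add: emeasure_eq_measure)
    also have "\<dots> = ennreal ((1 / (2 * pi)) ^ card {..<m}) *
        emeasure ?L ((\<Pi>\<^sub>E k\<in>{..<m}. {0..<2 * pi}) \<inter> {b \<in> space ?L. near_regular m (x\<^sup>2) b})"
      unfolding angle_measure_def by (rule emeasure_PiM_uniform) (use sets in auto)
    finally show ?thesis unfolding Z_eq by simp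
  qed
  have s: "s > 0" unfolding s_def using m by (intro sin_gt_zero) (auto simp: field_simps)
  let ?\<delta> = "sqrt (deviation_const m) * x"
  have \<delta>: "sqrt (deviation_const m * x\<^sup>2) = ?\<delta>" "?\<delta> \<ge> 0"
    using x deviation_const_pos[OF m] by (auto simp: real_sqrt_mult)
  let ?\<rho> = "4 / s * (x\<^sup>2 + ?\<delta> ^ 3)"
  have nonneg: "?\<rho> \<ge> 0" using s \<delta>(2) by (intro mult_nonneg_nonneg add_nonneg_nonneg) auto
  have meas_ball: "{b \<in> space ?L. b 0 \<in> J \<and> gap_deviation m b \<le> \<rho>} \<in> sets ?L" if "J \<in> sets borel" for J \<rho>
  proof -
    have [measurable]: "(\<lambda>b. gap_deviation m b) \<in> borel_measurable ?L"
      by (intro measurable_gap_deviation measurable_PiM_component) auto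
    have [measurable]: "(\<lambda>b. b 0) \<in> borel_measurable ?L"
      using m by (intro measurable_PiM_component) auto
    note that[measurable]
    show ?thesis by measurable
  qed
  have "emeasure ?L Z \<le> emeasure ?L {b \<in> space ?L. b 0 \<in> {0..2 * pi / real m + ?\<delta>} \<and> gap_deviation m b \<le> ?\<rho>}"
  proof (intro emeasure_mono meas_ball subsetI CollectI conjI)
    fix b assume "b \<in> Z"
    then have b: "b \<in> space ?L" "near_regular m (x\<^sup>2) b" "\<And>k. k < m \<Longrightarrow> 0 \<le> b k \<and> b k < 2 * pi"
      by (simp_all add: Z_def)
    show "b \<in> space ?L" by fact
    show "b 0 \<in> {0..2 * pi / real m + ?\<delta>}" "gap_deviation m b \<le> ?\<rho>"
      using near_regular_upper[OF m b(2)] b(3) unfolding \<delta>(1) s_def by blast+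
  qed simp
  also have "\<dots> = ennreal (2 * pi / real m + ?\<delta>) * ennreal (unit_ball_vol (real k) * sqrt ?\<rho> ^ k / sqrt (real m))"
    using \<delta>(2) nonneg unfolding m_def by (subst emeasure_gap_deviation_ball) auto
  also have "\<dots> = ennreal ((2 * pi / real m + ?\<delta>) * (unit_ball_vol (real k) * sqrt ?\<rho> ^ k / sqrt (real m)))"
    using \<delta>(2) by (intro ennreal_mult'[symmetric]) auto
  finally have "ennreal (near_regular_prob m (x\<^sup>2)) \<le> ennreal ((1 / (2 * pi)) ^ m) *
    ennreal ((2 * pi / real m + ?\<delta>) * (unit_ball_vol (real k) * sqrt ?\<rho> ^ k / sqrt (real m)))"
    unfolding prob by (intro mult_left_mono) auto
  also have "\<dots> = ennreal ((1 / (2 * pi)) ^ m *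
      ((2 * pi / real m + ?\<delta>) * (unit_ball_vol (real k) * sqrt ?\<rho> ^ k / sqrt (real m))))"
    by (intro ennreal_mult'[symmetric]) auto
  also have "(1 / (2 * pi)) ^ m * ((2 * pi / real m + ?\<delta>) * (unit_ball_vol (real k) * sqrt ?\<rho> ^ k / sqrt (real m)))
    = \<kappa> * (2 * pi / real m + ?\<delta>) * sqrt ?\<rho> ^ k"
    by (simp add: \<kappa>_def)
  finally show "near_regular_prob m (x\<^sup>2) \<le> \<kappa> * (2 * pi / real m + ?\<delta>) * sqrt ?\<rho> ^ k"
    using \<delta>(2) nonneg
    by (subst (asm) ennreal_le_iff) (auto intro!: mult_nonneg_nonneg simp: \<kappa>_def)
  assume \<rho>: "\<rho> \<ge> 0" "sqrt \<rho> < 2 * pi / real m" "s / 4 * \<rho> + sqrt \<rho> ^ 3 \<le> x\<^sup>2"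
  have "ennreal (\<kappa> * (2 * pi / real m - sqrt \<rho>) * sqrt \<rho> ^ k) = ennreal ((1 / (2 * pi)) ^ m *
      ((2 * pi / real m - sqrt \<rho>) * (unit_ball_vol (real k) * sqrt \<rho> ^ k / sqrt (real m))))"
    by (simp add: \<kappa>_def mult_ac)
  also have "\<dots> = ennreal ((1 / (2 * pi)) ^ m) *
      ennreal ((2 * pi / real m - sqrt \<rho>) * (unit_ball_vol (real k) * sqrt \<rho> ^ k / sqrt (real m)))"
    by (intro ennreal_mult') auto
  also have "ennreal ((2 * pi / real m - sqrt \<rho>) * (unit_ball_vol (real k) * sqrt \<rho> ^ k / sqrt (real m)))
      = ennreal (2 * pi / real m - sqrt \<rho>) * ennreal (unit_ball_vol (real k) * sqrt \<rho> ^ k / sqrt (real m))"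
    using \<rho> by (intro ennreal_mult') auto
  also have "\<dots> = emeasure ?L {b \<in> space ?L. b 0 \<in> {0..<2 * pi / real m - sqrt \<rho>} \<and> gap_deviation m b \<le> \<rho>}"
    using \<rho> unfolding m_def by (subst emeasure_gap_deviation_ball) auto
  also have "ennreal ((1 / (2 * pi)) ^ m) * \<dots> \<le> ennreal ((1 / (2 * pi)) ^ m) * emeasure ?L Z"
  proof (intro mult_left_mono emeasure_mono Z subsetI)
    fix b assume "b \<in> {b \<in> space ?L. b 0 \<in> {0..<2 * pi / real m - sqrt \<rho>} \<and> gap_deviation m b \<le> \<rho>}"
    then have b: "b \<in> space ?L" "gap_deviation m b \<le> \<rho>" "0 \<le> b 0" "b 0 < 2 * pi / real m - sqrt \<rho>"
      by simp_all
    show "b \<in> Z"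
      unfolding Z_def using b(1) near_regular_lower[OF m b(2) \<rho>(2) b(3,4) \<rho>(3)[unfolded s_def]] by blast
  qed auto
  also have "\<dots> = ennreal (near_regular_prob m (x\<^sup>2))" by (rule prob[symmetric])
  finally show "\<kappa> * (2 * pi / real m - sqrt \<rho>) * sqrt \<rho> ^ k \<le> near_regular_prob m (x\<^sup>2)"
    by (subst (asm) ennreal_le_iff) (auto simp: near_regular_prob_def)
qed

text \<open>The function is differentiable at 0 with value 1, so its difference quotient is bounded
  near 0. It covers the correction factors of both the upper and the lower volume bound.\<close>

lemma affine_times_sqrt_power_bound:
  fixes a b :: real
  shows "\<exists>C \<delta>. \<delta> > 0 \<and> (\<forall>x. 0 < x \<and> x < \<delta> \<longrightarrow> \<bar>(1 + a * x) * sqrt (1 + b * x) ^ k - 1\<bar> \<le> C * x)"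
proof -
  define f where "f x = (1 + a * x) * sqrt (1 + b * x) ^ k" for x
  have "\<exists>D. (f has_real_derivative D) (at 0)"
    unfolding f_def by (rule exI) (auto intro!: derivative_eq_intros)
  then obtain D where "(f has_real_derivative D) (at 0)" ..
  then have "((\<lambda>h. (f h - 1) / h) \<longlongrightarrow> D) (at 0)"
    unfolding DERIV_def by (simp add: f_def)
  then have "\<forall>\<^sub>F h in at 0. dist ((f h - 1) / h) D < 1"
    by (rule tendstoD) simp
  then obtain \<delta> where \<delta>: "\<delta> > 0" "\<And>h. h \<noteq> 0 \<Longrightarrow> dist h 0 < \<delta> \<Longrightarrow> dist ((f h - 1) / h) D < 1"
    unfolding eventually_at by blast
  have "\<bar>f x - 1\<bar> \<le> (\<bar>D\<bar> + 1) * x" if "0 < x" "x < \<delta>" for x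
  proof -
    have "\<bar>(f x - 1) / x - D\<bar> < 1" using \<delta>(2)[of x] that by (simp add: dist_real_def)
    then have "\<bar>(f x - 1) / x\<bar> \<le> \<bar>D\<bar> + 1" by linarith
    then show ?thesis using that by (simp add: field_simps)
  qed
  then show ?thesis using \<delta>(1) unfolding f_def by blast
qed

text \<open>In order: the density of m uniform angles, the volume factor of the gap ellipsoid, the
  length of the range of the smallest angle, and the radius, since deviation \<le> 4 x^2 / sin (pi /
  m) is the leading form of defect \<le> x^2.\<close>

definition near_regular_const :: "nat \<Rightarrow> real" where
  "near_regular_const m = (1 / (2 * pi)) ^ m * (unit_ball_vol (real (m - 1)) / sqrt (real m))
     * (2 * pi / real m) * (2 / sqrt (sin (pi / real m))) ^ (m - 1)"

lemma near_regular_prob_asymp: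
  assumes m: "m \<ge> 2"
  shows "\<exists>C \<delta>. \<delta> > 0 \<and> (\<forall>x. 0 < x \<and> x < \<delta> \<longrightarrow>
    \<bar>near_regular_prob m (x\<^sup>2) - near_regular_const m * x ^ (m - 1)\<bar> \<le> C * x ^ m)"
proof -
  obtain k where mk: "m = Suc k" using m by (cases m) auto
  have k: "k \<ge> 1" using m mk by simp
  define s where "s = sin (pi / real m)"
  have s: "s > 0" unfolding s_def using m by (intro sin_gt_zero) (auto simp: field_simps)
  define h where "h = 2 * pi / real m"
  have h: "h > 0" using m by (simp add: h_def)
  define \<kappa> where "\<kappa> = (1 / (2 * pi)) ^ m * (unit_ball_vol (real k) / sqrt (real m))"
  have \<kappa>: "\<kappa> \<ge> 0" unfolding \<kappa>_def by simp
  define d where "d = sqrt (deviation_const m)"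
  define r where "r = 2 / sqrt s"
  have r: "r > 0" "r\<^sup>2 = 4 / s" using s by (auto simp: r_def power_divide)
  define c where "c = \<kappa> * h * r ^ k"
  have c_eq: "c = near_regular_const m"
    by (simp add: c_def near_regular_const_def \<kappa>_def h_def r_def s_def mk)
  have c: "c \<ge> 0" using \<kappa> h r unfolding c_def by simp
  have d: "d \<ge> 0" unfolding d_def using deviation_const_pos[OF m] by simp
  obtain C1 \<delta>1 where 1: "\<delta>1 > 0"
    "\<And>x. 0 < x \<Longrightarrow> x < \<delta>1 \<Longrightarrow> \<bar>(1 + (d / h) * x) * sqrt (1 + d ^ 3 * x) ^ k - 1\<bar> \<le> C1 * x"
    using affine_times_sqrt_power_bound[of "d / h" "d ^ 3" k] by blast
  obtain C2 \<delta>2 where 2: "\<delta>2 > 0"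
    "\<And>x. 0 < x \<Longrightarrow> x < \<delta>2 \<Longrightarrow> \<bar>(1 + (- (r / h)) * x) * sqrt (1 + (- (r ^ 3)) * x) ^ k - 1\<bar> \<le> C2 * x"
    using affine_times_sqrt_power_bound[of "- (r / h)" "- (r ^ 3)" k] by blast
  have upper: "near_regular_prob m (x\<^sup>2) \<le> c * x ^ k * ((1 + (d / h) * x) * sqrt (1 + d ^ 3 * x) ^ k)"
    if x: "x > 0" for x
  proof -
    have "4 / s * (x\<^sup>2 + (d * x) ^ 3) = (r * x)\<^sup>2 * (1 + d ^ 3 * x)"
      unfolding power_mult_distrib r(2) by (simp add: power2_eq_square power3_eq_cube algebra_simps add_divide_distrib)
    then have sq: "sqrt (4 / s * (x\<^sup>2 + (d * x) ^ 3)) = (r * x) * sqrt (1 + d ^ 3 * x)"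
      using r x by (simp add: real_sqrt_mult)
    have "near_regular_prob m (x\<^sup>2) \<le> \<kappa> * (h + d * x) * sqrt (4 / s * (x\<^sup>2 + (d * x) ^ 3)) ^ k"
      using near_regular_prob_bounds(1)[OF k, of x] x
      by (simp only: mk[symmetric] s_def h_def d_def \<kappa>_def)
    also have "\<dots> = \<kappa> * (h * (1 + (d / h) * x)) * ((r * x) * sqrt (1 + d ^ 3 * x)) ^ k"
      unfolding sq using h by (simp add: distrib_left)
    also have "\<dots> = c * x ^ k * ((1 + (d / h) * x) * sqrt (1 + d ^ 3 * x) ^ k)"
      unfolding c_def power_mult_distrib by (simp only: mult_ac)
    finally show ?thesis .
  qed
  have lower: "c * x ^ k * ((1 + (- (r / h)) * x) * sqrt (1 + (- (r ^ 3)) * x) ^ k) \<le> near_regular_prob m (x\<^sup>2)"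
    if x: "x > 0" "r ^ 3 * x \<le> 1" "r * x < h" for x
  proof -
    \<comment> \<open>The radius is shrunk so that
      \<open>s / 4 * \<rho> = x\<^sup>2 - (r * x) ^ 3\<close>. As
      \<open>sqrt \<rho> \<le> r * x\<close>, the cubic error fits into the amount removed.\<close>
    define \<rho> where "\<rho> = (r * x)\<^sup>2 * (1 + (- (r ^ 3)) * x)"
    have \<rho>: "\<rho> \<ge> 0" unfolding \<rho>_def using x by simp
    have sq: "sqrt \<rho> = (r * x) * sqrt (1 + (- (r ^ 3)) * x)"
      using r x by (simp add: \<rho>_def real_sqrt_mult)
    have "sqrt (1 + (- (r ^ 3)) * x) \<le> 1" using r x by simp
    then have le: "sqrt \<rho> \<le> r * x"
      unfolding sq using r x by (simp add: mult_left_le)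
    have "sqrt \<rho> ^ 3 \<le> (r * x) ^ 3"
      using le \<rho> by (intro power_mono) auto
    moreover have "s / 4 * \<rho> = x\<^sup>2 * (1 + (- (r ^ 3)) * x)"
      unfolding \<rho>_def power_mult_distrib r(2) using s by simp
    then have "s / 4 * \<rho> = x\<^sup>2 - (r * x) ^ 3"
      by (simp add: power2_eq_square power3_eq_cube algebra_simps)
    ultimately have eps: "s / 4 * \<rho> + sqrt \<rho> ^ 3 \<le> x\<^sup>2" by linarith
    have "c * x ^ k * ((1 + (- (r / h)) * x) * sqrt (1 + (- (r ^ 3)) * x) ^ k) =
        \<kappa> * (h * (1 + (- (r / h)) * x)) * ((r * x) * sqrt (1 + (- (r ^ 3)) * x)) ^ k"
      unfolding c_def power_mult_distrib by (simp only: mult_ac)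
    also have "\<dots> = \<kappa> * (h - r * x) * sqrt \<rho> ^ k"
      unfolding sq using h by (simp add: right_diff_distrib)
    also have "\<dots> \<le> \<kappa> * (h - sqrt \<rho>) * sqrt \<rho> ^ k"
      using \<kappa> le \<rho> by (intro mult_right_mono mult_left_mono) auto
    also have "\<dots> \<le> near_regular_prob m (x\<^sup>2)"
      using near_regular_prob_bounds(2)[OF k, of x \<rho>] x \<rho> le eps
      by (simp add: mk[symmetric] s_def h_def \<kappa>_def)
    finally show ?thesis .
  qed
  define \<delta> where "\<delta> = Min {\<delta>1, \<delta>2, 1 / r ^ 3, h / r}"
  have \<delta>: "\<delta> > 0" using 1(1) 2(1) r h by (simp add: \<delta>_def)
  show ?thesis
  proof (rule exI[of _ "c * max C1 C2"], rule exI[of _ \<delta>], intro conjI allI impI \<delta>)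
    fix x assume x: "0 < x \<and> x < \<delta>"
    then have x': "x < \<delta>1" "x < \<delta>2" "r ^ 3 * x \<le> 1" "r * x < h"
      using r by (auto simp: \<delta>_def field_simps)
    have cx: "c * x ^ k \<ge> 0" using c x by simp
    have "(1 + (d / h) * x) * sqrt (1 + d ^ 3 * x) ^ k \<le> 1 + max C1 C2 * x"
      using 1(2)[of x] x x' mult_right_mono[of C1 "max C1 C2" x] by linarith
    from order_trans[OF upper mult_left_mono[OF this cx]]
    have up: "near_regular_prob m (x\<^sup>2) \<le> c * x ^ k * (1 + max C1 C2 * x)" using x by simp
    have "1 - max C1 C2 * x \<le> (1 + (- (r / h)) * x) * sqrt (1 + (- (r ^ 3)) * x) ^ k"
    proof -
      have gen: "1 - e' \<le> T" if "\<bar>T - 1\<bar> \<le> e" "e \<le> e'" for T e e' :: real using that by linarith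
      show ?thesis using x x' by (intro gen[OF 2(2)] mult_right_mono) auto
    qed
    from order_trans[OF mult_left_mono[OF this cx] lower]
    have lo: "c * x ^ k * (1 - max C1 C2 * x) \<le> near_regular_prob m (x\<^sup>2)" using x x' by simp
    have eq: "c * max C1 C2 * x ^ m = c * x ^ k * (max C1 C2 * x)" by (simp add: mk)
    have "near_regular_prob m (x\<^sup>2) \<le> c * x ^ k + c * max C1 C2 * x ^ m"
      using up unfolding eq by (simp only: distrib_left mult_1_right)
    moreover have "c * x ^ k - c * max C1 C2 * x ^ m \<le> near_regular_prob m (x\<^sup>2)"
      using lo unfolding eq by (simp only: right_diff_distrib mult_1_right)
    moreover have "m - 1 = k" by (simp add: mk)
    ultimately show "\<bar>near_regular_prob m (x\<^sup>2) - near_regular_const m * x ^ (m - 1)\<bar> \<le> c * max C1 C2 * x ^ m"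
      unfolding c_eq[symmetric] by (simp only:)
  qed
qed

section \<open>Random angles\<close>

lemma emeasure_angle_measure_le:
  assumes X: "X \<in> sets borel"
  shows "emeasure angle_measure X \<le> emeasure lborel X"
proof -
  have "emeasure angle_measure X = ennreal (1 / (2 * pi)) * emeasure lborel ({0..<2 * pi} \<inter> X)"
    using X by (simp add: angle_measure_def divide_ennreal_def inverse_ennreal mult.commute inverse_eq_divide)
  also have "\<dots> \<le> 1 * emeasure lborel X"
    using X pi_gt3 by (intro mult_mono emeasure_mono) (auto simp: ennreal_le_1 divide_simps)
  finally show ?thesis by simp
qed

lemma measurable_sum_nat:
  fixes f :: "'i \<Rightarrow> 'b \<Rightarrow> nat"
  assumes "\<And>i. i \<in> T \<Longrightarrow> f i \<in> measurable N (count_space UNIV)"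
  shows "(\<lambda>x. \<Sum>i\<in>T. f i x) \<in> measurable N (count_space UNIV)"
  using assms
proof (induction T rule: infinite_finite_induct)
  case (insert i T)
  then have [measurable]: "f i \<in> measurable N (count_space UNIV)"
    "(\<lambda>x. \<Sum>i\<in>T. f i x) \<in> measurable N (count_space UNIV)"
    by auto
  show ?case using insert.hyps by simp
qed simp_all

lemma (in prob_space) indep_var_cong:
  assumes "indep_var S X T Y" "\<And>\<omega>. \<omega> \<in> space M \<Longrightarrow> X \<omega> = X' \<omega>" "\<And>\<omega>. \<omega> \<in> space M \<Longrightarrow> Y \<omega> = Y' \<omega>"
  shows "indep_var S X' T Y'"
proof -
  have "X -` B \<inter> space M = X' -` B \<inter> space M" "Y -` C \<inter> space M = Y' -` C \<inter> space M" for B C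
    using assms(2,3) by auto
  moreover have "random_variable S X \<longleftrightarrow> random_variable S X'" "random_variable T Y \<longleftrightarrow> random_variable T Y'"
    using assms(2,3) by (auto intro!: measurable_cong)
  ultimately show ?thesis using assms(1) unfolding indep_var_eq by simp
qed

section \<open>Closeness to a rotated regular polygon\<close>

lemma near_regular_offset:
  assumes m: "m \<ge> 2" and b: "near_regular m \<epsilon> b" "\<And>k. k < m \<Longrightarrow> 0 \<le> b k \<and> b k < 2 * pi" and k: "k < m"
  shows "\<bar>b k - b 0 - real k * (2 * pi / real m)\<bar> \<le> real m * sqrt (deviation_const m * \<epsilon>)"
proof -
  have gap: "\<bar>arc_gap m b i - 2 * pi / real m\<bar> \<le> sqrt (deviation_const m * \<epsilon>)" if "i < m" for i
    using abs_gap_le_sqrt_deviation[OF that, of b] real_sqrt_le_mono[OF near_regular_deviation[OF m b]]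
    by linarith
  have nonneg: "0 \<le> sqrt (deviation_const m * \<epsilon>)" using gap[of 0] m by linarith
  have "b k - b 0 - real k * (2 * pi / real m) = (\<Sum>i<k. arc_gap m b i - 2 * pi / real m)"
    using sum_arc_gap_aux[OF k, of b] by (simp add: sum_subtractf)
  then have "\<bar>b k - b 0 - real k * (2 * pi / real m)\<bar> \<le> (\<Sum>i<k. \<bar>arc_gap m b i - 2 * pi / real m\<bar>)"
    by (simp only: sum_abs)
  also have "\<dots> \<le> (\<Sum>i<k. sqrt (deviation_const m * \<epsilon>))"
    using gap k by (intro sum_mono) auto
  also have "\<dots> \<le> real m * sqrt (deviation_const m * \<epsilon>)"
    using k nonneg by (simp add: mult_right_mono)
  finally show ?thesis .
qed

text \<open>Relates two points of a nearly regular polygon without recording their ranks; l stands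
  for the unknown difference of ranks, of either sign. Thus a point shared by two polygons can serve
  as reference for both.\<close>

definition rotation_close :: "nat \<Rightarrow> real \<Rightarrow> real \<Rightarrow> real \<Rightarrow> bool" where
  "rotation_close m \<eta> a y \<longleftrightarrow> (\<exists>l\<in>{- int m..int m}. \<bar>y - a - of_int l * (2 * pi / real m)\<bar> \<le> \<eta>)"

text \<open>Both points are compared with b 0, which doubles the error of
  \<open>near_regular_offset\<close>.\<close>

lemma near_regular_rotation_close:
  assumes m: "m \<ge> 2" and b: "near_regular m \<epsilon> b" "\<And>k. k < m \<Longrightarrow> 0 \<le> b k \<and> b k < 2 * pi" and "i < m" "j < m"
  shows "rotation_close m (2 * real m * sqrt (deviation_const m * \<epsilon>)) (b i) (b j)"
  unfolding rotation_close_def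
proof (rule bexI[of _ "int j - int i"])
  have eq: "b j - b i - of_int (int j - int i) * (2 * pi / real m) =
      (b j - b 0 - real j * (2 * pi / real m)) - (b i - b 0 - real i * (2 * pi / real m))"
    by (simp add: left_diff_distrib diff_divide_distrib)
  have *: "\<bar>b k - b 0 - real k * (2 * pi / real m)\<bar> \<le> real m * sqrt (deviation_const m * \<epsilon>)"
    if "k < m" for k
    using near_regular_offset[OF m b that] by blast
  have two: "2 * real m * sqrt (deviation_const m * \<epsilon>) =
      real m * sqrt (deviation_const m * \<epsilon>) + real m * sqrt (deviation_const m * \<epsilon>)" by simp
  show "\<bar>b j - b i - of_int (int j - int i) * (2 * pi / real m)\<bar>
      \<le> 2 * real m * sqrt (deviation_const m * \<epsilon>)"
    unfolding eq two by (rule order_trans[OF abs_triangle_ineq4 add_mono[OF *[OF \<open>j < m\<close>] *[OF \<open>i < m\<close>]]])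
qed (use assms in auto)

lemma measurable_rotation_close [measurable]:
  assumes [measurable]: "f \<in> borel_measurable N" "g \<in> borel_measurable N"
  shows "Measurable.pred N (\<lambda>x. rotation_close m \<eta> (f x) (g x))"
  unfolding rotation_close_def by measurable

lemma emeasure_rotation_close_le:
  assumes "\<eta> \<ge> 0"
  shows "emeasure angle_measure {y. rotation_close m \<eta> a y} \<le> ennreal (real (2 * m + 1) * (2 * \<eta>))"
proof -
  have eq: "{y. rotation_close m \<eta> a y} =
      (\<Union>l\<in>{- int m..int m}. {a + of_int l * (2 * pi / real m) - \<eta>..a + of_int l * (2 * pi / real m) + \<eta>})"
  proof -
    have "\<bar>y - a - of_int l * (2 * pi / real m)\<bar> \<le> \<eta> \<longleftrightarrow>
        y \<in> {a + of_int l * (2 * pi / real m) - \<eta>..a + of_int l * (2 * pi / real m) + \<eta>}" for y l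
      unfolding atLeastAtMost_iff abs_le_iff by linarith
    then show ?thesis unfolding rotation_close_def by blast
  qed
  have "emeasure angle_measure {y. rotation_close m \<eta> a y} \<le> emeasure lborel {y. rotation_close m \<eta> a y}"
    unfolding eq by (intro emeasure_angle_measure_le) auto
  also have "\<dots> \<le> (\<Sum>l\<in>{- int m..int m}. emeasure lborel
      {a + of_int l * (2 * pi / real m) - \<eta>..a + of_int l * (2 * pi / real m) + \<eta>})"
    unfolding eq by (intro emeasure_subadditive_finite) auto
  also have "\<dots> = (\<Sum>l\<in>{- int m..int m}. ennreal (2 * \<eta>))"
    using assms by (intro sum.cong refl) (simp add: emeasure_lborel_Icc)
  also have "\<dots> = ennreal (real (2 * m + 1) * (2 * \<eta>))"
    using assms by (simp add: ennreal_mult ennreal_of_nat_eq_real_of_nat nat_add_distrib)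
  finally show ?thesis .
qed

text \<open>The range of the angles is required at every outcome, so that inclusions between events
  hold pointwise and not just almost surely.\<close>

locale random_angles = prob_space +
  fixes A :: "nat \<Rightarrow> 'a \<Rightarrow> real" and I :: "nat set"
  assumes indep: "indep_vars (\<lambda>_. borel) A I"
    and distr_A: "i \<in> I \<Longrightarrow> distr M borel (A i) = angle_measure"
    and range_A: "i \<in> I \<Longrightarrow> \<omega> \<in> space M \<Longrightarrow> 0 \<le> A i \<omega> \<and> A i \<omega> < 2 * pi"
begin

lemma measurable_A: "i \<in> I \<Longrightarrow> A i \<in> borel_measurable M"
  using indep by (auto simp: indep_vars_def)

lemma joint_distr:
  assumes "J \<subseteq> I" "J \<noteq> {}"
  shows "distr M (PiM J (\<lambda>_. borel)) (\<lambda>\<omega>. \<lambda>i\<in>J. A i \<omega>) = PiM J (\<lambda>_. angle_measure)"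
proof -
  have "distr M (PiM J (\<lambda>_. borel)) (\<lambda>\<omega>. \<lambda>i\<in>J. A i \<omega>) = PiM J (\<lambda>i. distr M borel (A i))"
    using indep_vars_iff_distr_eq_PiM'[of J A "\<lambda>_. borel"] indep_vars_subset[OF indep assms(1)]
      measurable_A assms by auto
  also have "\<dots> = PiM J (\<lambda>_. angle_measure)"
    using assms distr_A by (intro PiM_cong) auto
  finally show ?thesis .
qed

lemma joint_distr_list:
  assumes xs: "distinct xs" "set xs \<subseteq> I" "xs \<noteq> []"
  shows "distr M (PiM {..<length xs} (\<lambda>_. borel)) (\<lambda>\<omega>. \<lambda>k\<in>{..<length xs}. A (xs ! k) \<omega>) =
    PiM {..<length xs} (\<lambda>_. angle_measure)"
proof -
  let ?J = "set xs" and ?n = "length xs"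
  have f: "inj_on ((!) xs) {..<?n}" "(!) xs \<in> {..<?n} \<rightarrow> ?J"
    using xs by (auto simp: inj_on_nth)
  have meas: "(\<lambda>\<omega>. \<lambda>k\<in>{..<?n}. \<omega> (xs ! k)) \<in> measurable (PiM ?J (\<lambda>_. borel :: real measure)) (PiM {..<?n} (\<lambda>_. borel))"
    by (intro measurable_restrict measurable_component_singleton) auto
  have meas2: "(\<lambda>\<omega>. \<lambda>i\<in>?J. A i \<omega>) \<in> measurable M (PiM ?J (\<lambda>_. borel))"
    using xs measurable_A by (intro measurable_restrict) auto
  have "PiM {..<?n} (\<lambda>_. angle_measure) =
      distr (PiM ?J (\<lambda>_. angle_measure)) (PiM {..<?n} (\<lambda>_. angle_measure)) (\<lambda>\<omega>. \<lambda>k\<in>{..<?n}. \<omega> (xs ! k))"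
    using distr_PiM_reindex[OF _ f, of "\<lambda>_. angle_measure"] prob_space_angle_measure by simp
  also have "\<dots> = distr (PiM ?J (\<lambda>_. angle_measure)) (PiM {..<?n} (\<lambda>_. borel)) (\<lambda>\<omega>. \<lambda>k\<in>{..<?n}. \<omega> (xs ! k))"
    by (intro distr_cong sets_PiM_cong) auto
  also have "\<dots> = distr (distr M (PiM ?J (\<lambda>_. borel)) (\<lambda>\<omega>. \<lambda>i\<in>?J. A i \<omega>)) (PiM {..<?n} (\<lambda>_. borel))
      (\<lambda>\<omega>. \<lambda>k\<in>{..<?n}. \<omega> (xs ! k))"
    using xs by (subst joint_distr) auto
  also have "\<dots> = distr M (PiM {..<?n} (\<lambda>_. borel)) ((\<lambda>\<omega>. \<lambda>k\<in>{..<?n}. \<omega> (xs ! k)) \<circ> (\<lambda>\<omega>. \<lambda>i\<in>?J. A i \<omega>))"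
    by (rule distr_distr[OF meas meas2])
  also have "(\<lambda>\<omega>. \<lambda>k\<in>{..<?n}. \<omega> (xs ! k)) \<circ> (\<lambda>\<omega>. \<lambda>i\<in>?J. A i \<omega>) = (\<lambda>\<omega>. \<lambda>k\<in>{..<?n}. A (xs ! k) \<omega>)"
    by (auto simp: fun_eq_iff)
  finally show ?thesis ..
qed

text \<open>The enumeration that sorts \<alpha> by angle depends on the outcome, hence the
  existential quantifier. For two or more indices, an outcome with tied angles has no such
  enumeration and lies outside the event.\<close>

definition regular_event :: "real \<Rightarrow> nat set \<Rightarrow> 'a set" where
  "regular_event \<epsilon> \<alpha> = {\<omega> \<in> space M. \<exists>xs\<in>permutations_of_set \<alpha>. near_regular (card \<alpha>) \<epsilon> (\<lambda>k. A (xs ! k) \<omega>)}"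

lemma regular_list_event:
  assumes "set xs \<subseteq> I"
  shows "{\<omega> \<in> space M. near_regular (length xs) \<epsilon> (\<lambda>k. A (xs ! k) \<omega>)} \<in> events"
proof -
  have "Measurable.pred M (\<lambda>\<omega>. near_regular (length xs) \<epsilon> (\<lambda>k. A (xs ! k) \<omega>))"
    using assms by (intro measurable_near_regular measurable_A) auto
  then show ?thesis by (simp add: pred_def)
qed

lemma regular_event_eq:
  "regular_event \<epsilon> \<alpha> = (\<Union>xs\<in>permutations_of_set \<alpha>. {\<omega> \<in> space M. near_regular (length xs) \<epsilon> (\<lambda>k. A (xs ! k) \<omega>)})"
  by (auto simp: regular_event_def length_finite_permutations_of_set)

lemma regular_event_events: "\<alpha> \<subseteq> I \<Longrightarrow> regular_event \<epsilon> \<alpha> \<in> events"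
  unfolding regular_event_eq
  by (intro sets.finite_UN regular_list_event) (auto dest: permutations_of_setD)

lemma prob_regular_list_event:
  assumes xs: "distinct xs" "set xs \<subseteq> I" "xs \<noteq> []"
  shows "prob {\<omega> \<in> space M. near_regular (length xs) \<epsilon> (\<lambda>k. A (xs ! k) \<omega>)} = near_regular_prob (length xs) \<epsilon>"
proof -
  let ?n = "length xs"
  let ?X = "\<lambda>\<omega>. \<lambda>k\<in>{..<?n}. A (xs ! k) \<omega>"
  let ?P = "PiM {..<?n} (\<lambda>_. borel :: real measure)"
  have cong: "near_regular ?n \<epsilon> (restrict f {..<?n}) \<longleftrightarrow> near_regular ?n \<epsilon> f" for f
  proof -
    have "arc_gap ?n (restrict f {..<?n}) k = arc_gap ?n f k" if "k < ?n" for k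
      using that by (auto simp: arc_gap_def)
    then show ?thesis by (simp add: near_regular_def defect_def)
  qed
  have meas: "?X \<in> measurable M ?P"
    using xs by (intro measurable_restrict measurable_A) auto
  have "Measurable.pred ?P (near_regular ?n \<epsilon>)"
    using measurable_near_regular[of ?n "\<lambda>b. b" ?P \<epsilon>] by (simp add: measurable_component_singleton)
  then have sets: "{b \<in> space ?P. near_regular ?n \<epsilon> b} \<in> sets ?P" by (simp add: pred_def)
  have "near_regular_prob ?n \<epsilon> = measure (distr M ?P ?X) {b \<in> space ?P. near_regular ?n \<epsilon> b}"
    unfolding near_regular_prob_def joint_distr_list[OF xs] by (simp add: space_PiM)
  also have "\<dots> = prob (?X -` {b \<in> space ?P. near_regular ?n \<epsilon> b} \<inter> space M)"
    by (rule measure_distr[OF meas sets])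
  also have "?X -` {b \<in> space ?P. near_regular ?n \<epsilon> b} \<inter> space M = {\<omega> \<in> space M. near_regular ?n \<epsilon> (\<lambda>k. A (xs ! k) \<omega>)}"
    using cong by (auto simp: space_PiM)
  finally show ?thesis ..
qed

text \<open>At one outcome at most one enumeration of \<alpha> is strictly increasing, so the union
  over enumerations is disjoint; by exchangeability all parts have the same probability.\<close>

lemma prob_regular_event:
  assumes \<alpha>: "finite \<alpha>" "\<alpha> \<noteq> {}" "\<alpha> \<subseteq> I"
  shows "prob (regular_event \<epsilon> \<alpha>) = fact (card \<alpha>) * near_regular_prob (card \<alpha>) \<epsilon>"
proof -
  let ?E = "\<lambda>xs. {\<omega> \<in> space M. near_regular (length xs) \<epsilon> (\<lambda>k. A (xs ! k) \<omega>)}"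
  have perm: "distinct xs" "set xs \<subseteq> I" "xs \<noteq> []" "length xs = card \<alpha>" "set xs = \<alpha>"
    if "xs \<in> permutations_of_set \<alpha>" for xs
    using permutations_of_setD[OF that] length_finite_permutations_of_set[OF that] \<alpha> by auto
  have "disjoint_family_on ?E (permutations_of_set \<alpha>)"
    unfolding disjoint_family_on_def
  proof (intro ballI impI)
    fix xs ys assume xy: "xs \<in> permutations_of_set \<alpha>" "ys \<in> permutations_of_set \<alpha>" "xs \<noteq> ys"
    have sorted: "sorted_wrt (<) (map (\<lambda>i. A i \<omega>) zs)" if "\<omega> \<in> ?E zs" for \<omega> zs
      using that increasing_chain_less[of "length zs" "\<lambda>k. A (zs ! k) \<omega>"]
      by (auto simp: sorted_wrt_iff_nth_less near_regular_def)
    have "False" if w: "\<omega> \<in> ?E xs" "\<omega> \<in> ?E ys" for \<omega>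
    proof -
      note s = sorted[OF w(1)] sorted[OF w(2)]
      have "map (\<lambda>i. A i \<omega>) ys = map (\<lambda>i. A i \<omega>) xs"
        using perm(5)[OF xy(1)] perm(5)[OF xy(2)] by (intro strict_sorted_equal s) simp
      moreover have "inj_on (\<lambda>i. A i \<omega>) \<alpha>"
        using s(1) perm(5)[OF xy(1)] by (auto simp: strict_sorted_iff distinct_map)
      ultimately have "ys = xs"
        using perm(5)[OF xy(1)] perm(5)[OF xy(2)] by (intro map_inj_on[of "\<lambda>i. A i \<omega>"]) auto
      then show False using xy(3) by simp
    qed
    then show "?E xs \<inter> ?E ys = {}" by blast
  qed
  then have "prob (regular_event \<epsilon> \<alpha>) = (\<Sum>xs\<in>permutations_of_set \<alpha>. prob (?E xs))"
    unfolding regular_event_eq using perm(2)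
    by (intro finite_measure_finite_Union) (auto intro!: regular_list_event)
  also have "\<dots> = (\<Sum>xs\<in>permutations_of_set \<alpha>. near_regular_prob (card \<alpha>) \<epsilon>)"
  proof (intro sum.cong refl)
    fix xs assume "xs \<in> permutations_of_set \<alpha>"
    note p = perm[OF this]
    show "prob (?E xs) = near_regular_prob (card \<alpha>) \<epsilon>"
      using prob_regular_list_event[OF p(1-3)] unfolding p(4) .
  qed
  finally show ?thesis using \<alpha> by simp
qed

text \<open>Given the central angle \<open>A i\<close>, the conditions on the other angles are
  independent and each has probability at most c; Fubini over the central angle then keeps the
  product bound.\<close>

lemma prob_star_le:
  assumes S: "finite S" "S \<subseteq> I" "i \<in> I" "i \<notin> S" and c: "c \<ge> 0"
    and R: "Measurable.pred (borel \<Otimes>\<^sub>M borel) (\<lambda>x. R (fst x) (snd x))"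
    and le: "\<And>a. emeasure angle_measure {y. R a y} \<le> ennreal c"
  shows "prob {\<omega> \<in> space M. \<forall>j\<in>S. R (A i \<omega>) (A j \<omega>)} \<le> c ^ card S"
proof -
  let ?U = "\<lambda>J. PiM J (\<lambda>_. angle_measure)"
  let ?P = "PiM (insert i S) (\<lambda>_. borel :: real measure)"
  interpret angle: prob_space angle_measure by (rule prob_space_angle_measure)
  interpret product_sigma_finite "\<lambda>_::nat. angle_measure" ..
  define Y where "Y = {b \<in> space ?P. \<forall>j\<in>S. R (b i) (b j)}"
  have comp: "(\<lambda>b. b j) \<in> borel_measurable ?P" if "j \<in> insert i S" for j
    using that by (rule measurable_component_singleton)
  have "Measurable.pred ?P (\<lambda>b. R (b i) (b j))" if "j \<in> S" for j
  proof -
    have "(\<lambda>b. (b i, b j)) \<in> measurable ?P (borel \<Otimes>\<^sub>M borel)"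
      using comp[of i] comp[of j] that by simp
    from measurable_compose[OF this R] show ?thesis by simp
  qed
  then have "Measurable.pred ?P (\<lambda>b. \<forall>j\<in>S. R (b i) (b j))"
    using S(1) by (intro pred_intros_finite(3)) auto
  then have Y: "Y \<in> sets ?P" by (simp add: Y_def pred_def)
  have setsU: "sets (?U (insert i S)) = sets ?P" by (intro sets_PiM_cong) auto
  have Ra: "{y. R a y} \<in> sets borel" for a
  proof -
    have "(\<lambda>y. (a, y)) \<in> measurable borel (borel \<Otimes>\<^sub>M borel)" by simp
    from measurable_compose[OF this R] show ?thesis by (simp add: pred_def)
  qed
  have meas: "(\<lambda>\<omega>. \<lambda>j\<in>insert i S. A j \<omega>) \<in> measurable M ?P"
    using S measurable_A by (intro measurable_restrict) auto
  have "{\<omega> \<in> space M. \<forall>j\<in>S. R (A i \<omega>) (A j \<omega>)} = (\<lambda>\<omega>. \<lambda>j\<in>insert i S. A j \<omega>) -` Y \<inter> space M"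
    by (auto simp: Y_def space_PiM)
  then have "emeasure M {\<omega> \<in> space M. \<forall>j\<in>S. R (A i \<omega>) (A j \<omega>)} =
      emeasure (distr M ?P (\<lambda>\<omega>. \<lambda>j\<in>insert i S. A j \<omega>)) Y"
    by (simp only: emeasure_distr[OF meas Y])
  also have "\<dots> = emeasure (?U (insert i S)) Y"
    using S by (subst joint_distr) auto
  also have "\<dots> = (\<integral>\<^sup>+ b. indicator Y b \<partial>?U (insert i S))"
    using Y setsU by (intro nn_integral_indicator[symmetric]) auto
  also have "\<dots> = (\<integral>\<^sup>+ a. \<integral>\<^sup>+ b. indicator Y (b(i := a)) \<partial>?U S \<partial>angle_measure)"
    using S Y setsU by (intro product_nn_integral_insert_rev borel_measurable_indicator) auto
  also have "\<dots> \<le> (\<integral>\<^sup>+ a. ennreal (c ^ card S) \<partial>angle_measure)"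
  proof (intro nn_integral_mono)
    fix a
    have "(\<integral>\<^sup>+ b. indicator Y (b(i := a)) \<partial>?U S) \<le> (\<integral>\<^sup>+ b. (\<Prod>j\<in>S. indicator {y. R a y} (b j)) \<partial>?U S)"
    proof (intro nn_integral_mono)
      fix b
      show "indicator Y (b(i := a)) \<le> (\<Prod>j\<in>S. indicator {y. R a y} (b j) :: ennreal)"
      proof (cases "b(i := a) \<in> Y")
        case True
        then have "R a (b j)" if "j \<in> S" for j
          using that S(4) by (auto simp: Y_def split: if_splits)
        then have "(\<Prod>j\<in>S. indicator {y. R a y} (b j) :: ennreal) = 1"
          by (intro prod.neutral) auto
        then show ?thesis by (simp only:) (simp add: indicator_def)
      qed simp
    qed
    also have "\<dots> = (\<Prod>j\<in>S. \<integral>\<^sup>+ y. indicator {y. R a y} y \<partial>angle_measure)"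
      using S(1) Ra by (intro product_nn_integral_prod) auto
    also have "\<dots> = ennreal (angle.prob {y. R a y} ^ card S)"
      using Ra by (simp add: angle.emeasure_eq_measure ennreal_power)
    also have "\<dots> \<le> ennreal (c ^ card S)"
      using le[of a] c by (intro ennreal_leI power_mono) (auto simp: angle.emeasure_eq_measure)
    finally show "(\<integral>\<^sup>+ b. indicator Y (b(i := a)) \<partial>?U S) \<le> ennreal (c ^ card S)" .
  qed
  also have "\<dots> = ennreal (c ^ card S)" using angle.emeasure_space_1 by simp
  finally show ?thesis using c by (simp add: emeasure_eq_measure)
qed

text \<open>Two angles coincide with probability zero by the star bound with one leaf, equality as
  the relation and c = 0.\<close>

lemma AE_inj_on:
  assumes "finite J" "J \<subseteq> I"
  shows "AE \<omega> in M. inj_on (\<lambda>i. A i \<omega>) J"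
proof -
  have "AE \<omega> in M. A i \<omega> \<noteq> A j \<omega>" if ij: "i \<in> I" "j \<in> I" "i \<noteq> j" for i j
  proof -
    have "emeasure angle_measure {y. a = y} \<le> ennreal 0" for a
      using emeasure_angle_measure_le[of "{a}"] by simp
    then have "prob {\<omega> \<in> space M. \<forall>j\<in>{j}. A i \<omega> = A j \<omega>} \<le> 0 ^ card {j}"
      using ij by (intro prob_star_le[where R = "\<lambda>a y. a = y"]) auto
    then have "prob {\<omega> \<in> space M. A i \<omega> = A j \<omega>} = 0" by (simp add: measure_le_0_iff)
    moreover have "{\<omega> \<in> space M. A i \<omega> = A j \<omega>} \<in> events"
      using measurable_A[OF ij(1)] measurable_A[OF ij(2)] by measurable
    ultimately show ?thesis
      by (intro AE_I[of _ _ "{\<omega> \<in> space M. A i \<omega> = A j \<omega>}"]) (auto simp: emeasure_eq_measure)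
  qed
  then have "AE \<omega> in M. \<forall>i\<in>J. \<forall>j\<in>J. i \<noteq> j \<longrightarrow> A i \<omega> \<noteq> A j \<omega>"
    using assms by (intro AE_finite_allI AE_impI) (auto simp: subset_iff)
  then show ?thesis by eventually_elim (auto simp: inj_on_def)
qed

text \<open>Coefficient of x in the bound of \<open>emeasure_rotation_close_le\<close>: 2 m + 1
  intervals of length 2 \<eta>, where \<eta> is 2 m times the coarse gap error for defect
  x^2.\<close>

definition pair_const :: "nat \<Rightarrow> real" where
  "pair_const m = real (2 * m + 1) * (4 * real m * sqrt (deviation_const m))"

text \<open>Both polygons are close to the regular m-gon through a common point i. So each of the
  other points of the union is \<open>rotation_close\<close> to i, and these conditions form a star
  around i. The case \<alpha> = \<beta> bounds a single event.\<close>

lemma prob_regular_event_Int_le: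
  assumes m: "m \<ge> 2" and \<alpha>: "\<alpha> \<subseteq> I" "card \<alpha> = m" and \<beta>: "\<beta> \<subseteq> I" "card \<beta> = m"
    and common: "\<alpha> \<inter> \<beta> \<noteq> {}" and x: "x \<ge> 0"
  shows "prob (regular_event (x\<^sup>2) \<alpha> \<inter> regular_event (x\<^sup>2) \<beta>) \<le> (pair_const m * x) ^ (card (\<alpha> \<union> \<beta>) - 1)"
proof -
  obtain i where i: "i \<in> \<alpha>" "i \<in> \<beta>" using common by blast
  define \<eta> where "\<eta> = 2 * real m * sqrt (deviation_const m * x\<^sup>2)"
  have \<eta>: "\<eta> = 2 * real m * sqrt (deviation_const m) * x" "\<eta> \<ge> 0"
    using x deviation_const_pos[OF m] by (auto simp: \<eta>_def real_sqrt_mult)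
  have fin: "finite \<alpha>" "finite \<beta>" using \<alpha> \<beta> m by (metis card.infinite not_numeral_le_zero)+
  have close: "rotation_close m \<eta> (A i \<omega>) (A j \<omega>)"
    if \<gamma>: "\<omega> \<in> regular_event (x\<^sup>2) \<gamma>" "\<gamma> \<subseteq> I" "card \<gamma> = m" "i \<in> \<gamma>" "j \<in> \<gamma>" for \<omega> \<gamma> j
  proof -
    obtain xs where xs: "xs \<in> permutations_of_set \<gamma>" "near_regular m (x\<^sup>2) (\<lambda>k. A (xs ! k) \<omega>)" "\<omega> \<in> space M"
      using \<gamma> by (auto simp: regular_event_def)
    have len: "length xs = m" "set xs = \<gamma>"
      using length_finite_permutations_of_set[OF xs(1)] permutations_of_setD[OF xs(1)] \<gamma> by auto
    obtain p q where "p < m" "xs ! p = i" "q < m" "xs ! q = j"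
      using len \<gamma>(4,5) by (metis in_set_conv_nth)
    moreover have "0 \<le> A (xs ! k) \<omega> \<and> A (xs ! k) \<omega> < 2 * pi" if "k < m" for k
      using range_A[of "xs ! k" \<omega>] xs(3) len \<gamma>(2) that nth_mem[of k xs] by auto
    ultimately show ?thesis
      using near_regular_rotation_close[OF m xs(2), of p q] unfolding \<eta>_def by auto
  qed
  let ?S = "\<alpha> \<union> \<beta> - {i}"
  have "prob (regular_event (x\<^sup>2) \<alpha> \<inter> regular_event (x\<^sup>2) \<beta>)
      \<le> prob {\<omega> \<in> space M. \<forall>j\<in>?S. rotation_close m \<eta> (A i \<omega>) (A j \<omega>)}"
  proof (rule finite_measure_mono)
    show "regular_event (x\<^sup>2) \<alpha> \<inter> regular_event (x\<^sup>2) \<beta> \<subseteq>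
        {\<omega> \<in> space M. \<forall>j\<in>?S. rotation_close m \<eta> (A i \<omega>) (A j \<omega>)}"
      using close \<alpha> \<beta> i by (auto simp: regular_event_def)
    have "Measurable.pred M (\<lambda>\<omega>. \<forall>j\<in>?S. rotation_close m \<eta> (A i \<omega>) (A j \<omega>))"
      using \<alpha> \<beta> fin i by (intro pred_intros_finite(3) measurable_rotation_close measurable_A) auto
    then show "{\<omega> \<in> space M. \<forall>j\<in>?S. rotation_close m \<eta> (A i \<omega>) (A j \<omega>)} \<in> events"
      by (simp add: pred_def)
  qed
  also have "\<dots> \<le> (real (2 * m + 1) * (2 * \<eta>)) ^ card ?S"
    using \<alpha> \<beta> fin i \<eta>(2)
    by (intro prob_star_le emeasure_rotation_close_le measurable_rotation_close) auto
  also have "real (2 * m + 1) * (2 * \<eta>) = pair_const m * x"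
    by (simp add: \<eta>(1) pair_const_def)
  also have "card ?S = card (\<alpha> \<union> \<beta>) - 1" using i fin by simp
  finally show ?thesis .
qed

lemma indep_regular_events:
  assumes \<alpha>: "\<alpha> \<subseteq> I" and T: "\<And>\<beta>. \<beta> \<in> T \<Longrightarrow> \<beta> \<subseteq> I \<and> \<alpha> \<inter> \<beta> = {}"
  shows "indep_var (count_space UNIV) (indicator (regular_event \<epsilon> \<alpha>) :: 'a \<Rightarrow> nat)
    (count_space UNIV) (\<lambda>\<omega>. \<Sum>\<beta>\<in>T. indicator (regular_event \<epsilon> \<beta>) \<omega> :: nat)"
proof -
  \<comment> \<open>The event as a condition on the angle vector. It reads only the coordinates in
    \<beta>, so independence of disjoint blocks of coordinates carries over to the
    indicators.\<close>
  define G where "G \<beta> a \<longleftrightarrow> (\<exists>xs\<in>permutations_of_set \<beta>. near_regular (length xs) \<epsilon> (\<lambda>k. a (xs ! k)))"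
    for \<beta> and a :: "nat \<Rightarrow> real"
  have meas: "Measurable.pred (PiM J (\<lambda>_. borel)) (G \<beta>)" if "\<beta> \<subseteq> J" for \<beta> J
    unfolding G_def
  proof (intro pred_intros_finite(4) measurable_near_regular measurable_component_singleton)
    fix xs k assume "xs \<in> permutations_of_set \<beta>" "k < length xs"
    then show "xs ! k \<in> J" using permutations_of_setD(1)[of xs \<beta>] nth_mem[of k xs] that by auto
  qed simp
  have G_restrict: "G \<beta> (restrict a J) \<longleftrightarrow> G \<beta> a" if "\<beta> \<subseteq> J" for \<beta> J a
  proof -
    have "near_regular (length xs) \<epsilon> (\<lambda>k. restrict a J (xs ! k)) \<longleftrightarrow> near_regular (length xs) \<epsilon> (\<lambda>k. a (xs ! k))"
      if "xs \<in> permutations_of_set \<beta>" for xs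
    proof -
      have "xs ! k \<in> J" if "k < length xs" for k
        using \<open>\<beta> \<subseteq> J\<close> permutations_of_setD(1)[OF \<open>xs \<in> _\<close>] nth_mem[OF that] by auto
      moreover have "0 < length xs" if "k < length xs" for k using that by linarith
      ultimately have "arc_gap (length xs) (\<lambda>k. restrict a J (xs ! k)) k = arc_gap (length xs) (\<lambda>k. a (xs ! k)) k"
        if "k < length xs" for k
        using that by (auto simp: arc_gap_def)
      then show ?thesis using \<open>\<And>k. k < length xs \<Longrightarrow> xs ! k \<in> J\<close>
        by (simp add: near_regular_def defect_def)
    qed
    then show ?thesis unfolding G_def by blast
  qed
  have event: "regular_event \<epsilon> \<beta> = {\<omega> \<in> space M. G \<beta> (\<lambda>i. A i \<omega>)}" for \<beta>
    by (auto simp: regular_event_def G_def length_finite_permutations_of_set)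
  let ?J = "\<Union>T"
  have "indep_var (PiM \<alpha> (\<lambda>_. borel)) (\<lambda>\<omega>. \<lambda>i\<in>\<alpha>. A i \<omega>) (PiM ?J (\<lambda>_. borel)) (\<lambda>\<omega>. \<lambda>i\<in>?J. A i \<omega>)"
    using \<alpha> T by (intro indep_var_restrict[OF indep]) auto
  then have "indep_var (count_space UNIV) ((\<lambda>a. if G \<alpha> a then 1 else 0 :: nat) \<circ> (\<lambda>\<omega>. \<lambda>i\<in>\<alpha>. A i \<omega>))
      (count_space UNIV) ((\<lambda>a. \<Sum>\<beta>\<in>T. if G \<beta> a then 1 else 0 :: nat) \<circ> (\<lambda>\<omega>. \<lambda>i\<in>?J. A i \<omega>))"
  proof (rule indep_var_compose)
    have [measurable]: "Measurable.pred (PiM \<alpha> (\<lambda>_. borel)) (G \<alpha>)" by (rule meas) simp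
    show "(\<lambda>a. if G \<alpha> a then 1 else 0 :: nat) \<in> measurable (PiM \<alpha> (\<lambda>_. borel)) (count_space UNIV)"
      by measurable
    have "(\<lambda>a. if G \<beta> a then 1 else 0 :: nat) \<in> measurable (PiM ?J (\<lambda>_. borel)) (count_space UNIV)"
      if "\<beta> \<in> T" for \<beta>
    proof -
      have [measurable]: "Measurable.pred (PiM ?J (\<lambda>_. borel)) (G \<beta>)" using that by (intro meas) auto
      show ?thesis by measurable
    qed
    then show "(\<lambda>a. \<Sum>\<beta>\<in>T. if G \<beta> a then 1 else 0 :: nat) \<in> measurable (PiM ?J (\<lambda>_. borel)) (count_space UNIV)"
      by (rule measurable_sum_nat)
  qed
  then show ?thesis
  proof (rule indep_var_cong)
    fix \<omega> assume \<omega>: "\<omega> \<in> space M"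
    show "((\<lambda>a. if G \<alpha> a then 1 else 0 :: nat) \<circ> (\<lambda>\<omega>. \<lambda>i\<in>\<alpha>. A i \<omega>)) \<omega> = indicator (regular_event \<epsilon> \<alpha>) \<omega>"
      using \<omega> by (simp add: event G_restrict)
    show "((\<lambda>a. \<Sum>\<beta>\<in>T. if G \<beta> a then 1 else 0 :: nat) \<circ> (\<lambda>\<omega>. \<lambda>i\<in>?J. A i \<omega>)) \<omega> =
        (\<Sum>\<beta>\<in>T. indicator (regular_event \<epsilon> \<beta>) \<omega>)"
      using \<omega> by (auto simp: event intro!: sum.cong) (auto simp: G_restrict Union_upper)
  qed
qed

end

section \<open>Counting intersecting index sets\<close>

text \<open>The union can be chosen in at most n^s ways, and each of the two sets is one of its 2^s
  subsets.\<close>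

lemma card_pairs_union_le:
  "card {(\<alpha>, \<beta>). \<alpha> \<subseteq> {1..n} \<and> \<beta> \<subseteq> {1..n} \<and> card (\<alpha> \<union> \<beta>) = s} \<le> (4 * n) ^ s"
proof -
  let ?G = "{\<gamma>. \<gamma> \<subseteq> {1..n} \<and> card \<gamma> = s}"
  have fin: "finite ?G" by simp
  have "{(\<alpha>, \<beta>). \<alpha> \<subseteq> {1..n} \<and> \<beta> \<subseteq> {1..n} \<and> card (\<alpha> \<union> \<beta>) = s} \<subseteq> (\<Union>\<gamma>\<in>?G. Pow \<gamma> \<times> Pow \<gamma>)"
  proof clarify
    fix \<alpha> \<beta> :: "nat set" assume "\<alpha> \<subseteq> {1..n}" "\<beta> \<subseteq> {1..n}" "s = card (\<alpha> \<union> \<beta>)"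
    then show "(\<alpha>, \<beta>) \<in> (\<Union>\<gamma>\<in>{\<gamma>. \<gamma> \<subseteq> {1..n} \<and> card \<gamma> = card (\<alpha> \<union> \<beta>)}. Pow \<gamma> \<times> Pow \<gamma>)"
      by (intro UN_I[of "\<alpha> \<union> \<beta>"]) auto
  qed
  then have "card {(\<alpha>, \<beta>). \<alpha> \<subseteq> {1..n} \<and> \<beta> \<subseteq> {1..n} \<and> card (\<alpha> \<union> \<beta>) = s} \<le> card (\<Union>\<gamma>\<in>?G. Pow \<gamma> \<times> Pow \<gamma>)"
    using finite_subset[of _ "{1..n}"] by (intro card_mono finite_UN_I[OF fin]) auto
  also have "\<dots> \<le> (\<Sum>\<gamma>\<in>?G. card (Pow \<gamma> \<times> Pow \<gamma>))"
    by (rule card_UN_le[OF fin])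
  also have "\<dots> = (\<Sum>\<gamma>\<in>?G. 4 ^ s)"
  proof (intro sum.cong refl)
    fix \<gamma> assume "\<gamma> \<in> ?G"
    then have "finite \<gamma>" "card \<gamma> = s" by (auto intro: finite_subset)
    then show "card (Pow \<gamma> \<times> Pow \<gamma>) = 4 ^ s"
      by (simp add: card_cartesian_product card_Pow flip: power_mult_distrib)
  qed
  also have "\<dots> = (n choose s) * 4 ^ s" using n_subsets[of "{1..n}" s] by simp
  also have "\<dots> \<le> n ^ s * 4 ^ s"
    by (intro mult_right_mono) (cases "s \<le> n", auto simp: binomial_le_pow binomial_eq_0)
  finally show ?thesis by (simp add: power_mult_distrib mult.commute)
qed

lemma sum_pairs_union_le:
  fixes h :: "nat \<Rightarrow> real"
  assumes P: "P \<subseteq> {(\<alpha>, \<beta>). \<alpha> \<subseteq> {1..n} \<and> \<beta> \<subseteq> {1..n}}"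
    and S: "finite S" "\<And>\<alpha> \<beta>. (\<alpha>, \<beta>) \<in> P \<Longrightarrow> card (\<alpha> \<union> \<beta>) \<in> S" and h: "\<And>s. h s \<ge> 0"
  shows "(\<Sum>(\<alpha>, \<beta>)\<in>P. h (card (\<alpha> \<union> \<beta>))) \<le> (\<Sum>s\<in>S. real ((4 * n) ^ s) * h s)"
proof -
  have fin: "finite {(\<alpha>, \<beta>). \<alpha> \<subseteq> {1..n} \<and> \<beta> \<subseteq> {1..n}}"
    by (rule finite_subset[of _ "Pow {1..n} \<times> Pow {1..n}"]) auto
  have finP: "finite P" using P fin by (rule finite_subset)
  let ?c = "\<lambda>(\<alpha>, \<beta>). card (\<alpha> \<union> \<beta> :: nat set)"
  have "(\<Sum>(\<alpha>, \<beta>)\<in>P. h (card (\<alpha> \<union> \<beta>))) = (\<Sum>s\<in>S. \<Sum>p\<in>{p \<in> P. ?c p = s}. (case p of (\<alpha>, \<beta>) \<Rightarrow> h (card (\<alpha> \<union> \<beta>))))"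
    using S by (intro sum.group[symmetric] finP) auto
  also have "\<dots> = (\<Sum>s\<in>S. real (card {p \<in> P. ?c p = s}) * h s)"
  proof (intro sum.cong refl)
    fix s
    have "(\<Sum>p\<in>{p \<in> P. ?c p = s}. (case p of (\<alpha>, \<beta>) \<Rightarrow> h (card (\<alpha> \<union> \<beta>)))) = (\<Sum>p\<in>{p \<in> P. ?c p = s}. h s)"
      by (intro sum.cong refl) auto
    then show "(\<Sum>p\<in>{p \<in> P. ?c p = s}. (case p of (\<alpha>, \<beta>) \<Rightarrow> h (card (\<alpha> \<union> \<beta>)))) = real (card {p \<in> P. ?c p = s}) * h s"
      by simp
  qed
  also have "\<dots> \<le> (\<Sum>s\<in>S. real ((4 * n) ^ s) * h s)"
  proof (intro sum_mono mult_right_mono h)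
    fix s
    have "card {p \<in> P. ?c p = s} \<le> card {(\<alpha>, \<beta>). \<alpha> \<subseteq> {1..n} \<and> \<beta> \<subseteq> {1..n} \<and> card (\<alpha> \<union> \<beta>) = s}"
      using P by (intro card_mono finite_subset[OF _ fin]) auto
    also note card_pairs_union_le
    finally show "real (card {p \<in> P. ?c p = s}) \<le> real ((4 * n) ^ s)" by (simp only: of_nat_le_iff)
  qed
  finally show ?thesis .
qed

text \<open>With \<open>y = 4 n K x\<close>, pairs whose union has \<open>s\<close> elements contribute at most
  \<open>(4 n)^s (K x)^(s - 1) = 4 n y^(s - 1)\<close>.\<close>

lemma (in random_angles) prob_no_regular_event_poisson:
  assumes m: "m \<ge> 2" and I: "{1..n} \<subseteq> I" and x: "x \<ge> 0" and small: "4 * real n * (pair_const m * x) \<le> 1"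
  shows "\<bar>prob {\<omega> \<in> space M. \<forall>\<alpha>\<in>{\<alpha>. \<alpha> \<subseteq> {1..n} \<and> card \<alpha> = m}. \<omega> \<notin> regular_event (x\<^sup>2) \<alpha>}
      - exp (- (real (n choose m) * fact m * near_regular_prob m (x\<^sup>2)))\<bar>
    \<le> 8 * real m * real n * (4 * real n * (pair_const m * x)) ^ m"
proof -
  define F where "F = {\<alpha>. \<alpha> \<subseteq> {1..n} \<and> card \<alpha> = m}"
  define E where "E = regular_event (x\<^sup>2)"
  define N where "N \<alpha> = {\<beta> \<in> F. \<alpha> \<inter> \<beta> \<noteq> {}}" for \<alpha>
  define z where "z = pair_const m * x"
  define y where "y = 4 * real n * z"
  have z: "z \<ge> 0" using x deviation_const_pos[OF m] by (simp add: z_def pair_const_def)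
  have y: "0 \<le> y" "y \<le> 1" using z small by (auto simp: y_def z_def)
  have finF: "finite F" unfolding F_def by simp
  have FI: "\<alpha> \<subseteq> I" "card \<alpha> = m" "\<alpha> \<subseteq> {1..n}" "finite \<alpha>" "\<alpha> \<noteq> {}" if "\<alpha> \<in> F" for \<alpha>
    using that I m by (auto simp: F_def intro: finite_subset)
  have pE: "prob (E \<alpha>) = fact m * near_regular_prob m (x\<^sup>2)" if "\<alpha> \<in> F" for \<alpha>
    using FI[OF that] unfolding E_def by (simp add: prob_regular_event)
  \<comment> \<open>The pair bound with \<beta> = \<alpha>, whose union has m points.\<close>
  have pE_le: "prob (E \<alpha>) \<le> z ^ (m - 1)" if "\<alpha> \<in> F" for \<alpha>
    using prob_regular_event_Int_le[OF m FI(1,2)[OF that] FI(1,2)[OF that] _ x] FI[OF that]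
    by (simp add: E_def z_def)
  have "\<bar>prob {\<omega> \<in> space M. \<forall>\<alpha>\<in>F. \<omega> \<notin> E \<alpha>} - exp (- (\<Sum>\<alpha>\<in>F. prob (E \<alpha>)))\<bar>
    \<le> (\<Sum>\<alpha>\<in>F. (\<Sum>\<beta>\<in>N \<alpha>. prob (E \<alpha>) * prob (E \<beta>)) + (\<Sum>\<beta>\<in>N \<alpha> - {\<alpha>}. prob (E \<alpha> \<inter> E \<beta>)))"
  proof (rule prob_no_event_poisson[OF finF])
    fix \<alpha> assume \<alpha>: "\<alpha> \<in> F"
    show "E \<alpha> \<in> events" unfolding E_def using FI[OF \<alpha>] by (intro regular_event_events)
    show "\<alpha> \<in> N \<alpha>" using \<alpha> FI[OF \<alpha>] by (auto simp: N_def)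
    show "N \<alpha> \<subseteq> F" by (auto simp: N_def)
    show "indep_var (count_space UNIV) (indicator (E \<alpha>) :: 'a \<Rightarrow> nat) (count_space UNIV)
        (\<lambda>\<omega>. \<Sum>\<beta>\<in>F - N \<alpha>. indicator (E \<beta>) \<omega> :: nat)"
      unfolding E_def using FI \<alpha> by (intro indep_regular_events) (auto simp: N_def)
  qed
  also have "\<dots> = (\<Sum>\<alpha>\<in>F. \<Sum>\<beta>\<in>N \<alpha>. prob (E \<alpha>) * prob (E \<beta>)) + (\<Sum>\<alpha>\<in>F. \<Sum>\<beta>\<in>N \<alpha> - {\<alpha>}. prob (E \<alpha> \<inter> E \<beta>))"
    by (rule sum.distrib)
  \<comment> \<open>The product bound z^(2 m - 2) ignores the overlap, so the largest unions, with 2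
    m - 1 points, dominate: (4 n)^(2 m - 1) z^(2 m - 2) = 4 n y^(2 m - 2). Since m \<ge> 2 and y
    \<le> 1, this is at most 4 n y^m.\<close>
  also have "(\<Sum>\<alpha>\<in>F. \<Sum>\<beta>\<in>N \<alpha>. prob (E \<alpha>) * prob (E \<beta>)) \<le> 4 * real m * real n * y ^ m"
  proof -
    have "(\<Sum>\<alpha>\<in>F. \<Sum>\<beta>\<in>N \<alpha>. prob (E \<alpha>) * prob (E \<beta>)) \<le> (\<Sum>\<alpha>\<in>F. \<Sum>\<beta>\<in>N \<alpha>. z ^ (2 * m - 2))"
    proof (intro sum_mono)
      fix \<alpha> \<beta> assume "\<alpha> \<in> F" "\<beta> \<in> N \<alpha>"
      then have "prob (E \<alpha>) * prob (E \<beta>) \<le> z ^ (m - 1) * z ^ (m - 1)"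
        using z by (intro mult_mono pE_le) (auto simp: N_def)
      also have "\<dots> = z ^ (2 * m - 2)" using m by (simp add: mult_2 numeral_2_eq_2 flip: power_add)
      finally show "prob (E \<alpha>) * prob (E \<beta>) \<le> z ^ (2 * m - 2)" .
    qed
    also have "\<dots> = (\<Sum>(\<alpha>, \<beta>)\<in>(SIGMA \<alpha>:F. N \<alpha>). z ^ (2 * m - 2))"
      using finF by (intro sum.Sigma) (auto simp: N_def)
    also have "\<dots> \<le> (\<Sum>s\<in>{m..<2 * m}. real ((4 * n) ^ s) * z ^ (2 * m - 2))"
    proof (rule sum_pairs_union_le[where h = "\<lambda>_. z ^ (2 * m - 2)"])
      show "(SIGMA \<alpha>:F. N \<alpha>) \<subseteq> {(\<alpha>, \<beta>). \<alpha> \<subseteq> {1..n} \<and> \<beta> \<subseteq> {1..n}}"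
        by (auto simp: N_def F_def)
      fix \<alpha> \<beta> assume "(\<alpha>, \<beta>) \<in> (SIGMA \<alpha>:F. N \<alpha>)"
      then have ab: "\<alpha> \<in> F" "\<beta> \<in> F" "\<alpha> \<inter> \<beta> \<noteq> {}" by (auto simp: N_def)
      have "card (\<alpha> \<union> \<beta>) + card (\<alpha> \<inter> \<beta>) = 2 * m"
        using card_Un_Int[of \<alpha> \<beta>] FI[OF ab(1)] FI[OF ab(2)] by simp
      moreover have "card (\<alpha> \<inter> \<beta>) > 0" using ab(3) FI[OF ab(1)] by (simp add: card_gt_0_iff)
      moreover have "card \<alpha> \<le> card (\<alpha> \<union> \<beta>)" using FI[OF ab(1)] FI[OF ab(2)] by (intro card_mono) auto
      ultimately show "card (\<alpha> \<union> \<beta>) \<in> {m..<2 * m}" using FI[OF ab(1)] by auto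
    qed (use z in auto)
    also have "\<dots> \<le> (\<Sum>s\<in>{m..<2 * m}. 4 * real n * y ^ m)"
    proof (intro sum_mono)
      fix s assume s: "s \<in> {m..<2 * m}"
      have "real ((4 * n) ^ s) * z ^ (2 * m - 2) \<le> (4 * real n) ^ (2 * m - 1) * z ^ (2 * m - 2)"
      proof (cases "n = 0")
        case False
        then have "(4 * real n) ^ s \<le> (4 * real n) ^ (2 * m - 1)" using s by (intro power_increasing) auto
        then show ?thesis using z by (intro mult_right_mono) (auto simp: power_mult_distrib)
      qed (use s m in \<open>auto simp: power_0_left\<close>)
      also have "(4 * real n) ^ (2 * m - 1) = 4 * real n * (4 * real n) ^ (2 * m - 2)"
      proof -
        have "2 * m - 1 = Suc (2 * m - 2)" using m by simp
        then show ?thesis by (simp only: power_Suc)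
      qed
      also have "4 * real n * (4 * real n) ^ (2 * m - 2) * z ^ (2 * m - 2) = 4 * real n * y ^ (2 * m - 2)"
        by (simp only: y_def power_mult_distrib mult_ac)
      also have "\<dots> \<le> 4 * real n * y ^ m"
        using y m by (intro mult_left_mono power_decreasing) auto
      finally show "real ((4 * n) ^ s) * z ^ (2 * m - 2) \<le> 4 * real n * y ^ m" .
    qed
    also have "\<dots> = 4 * real m * real n * y ^ m" by simp
    finally show ?thesis .
  qed
  \<comment> \<open>Two different sets of size m have a union of at least m + 1 points, so the
    exponent of y is at least m. The diagonal \<beta> = \<alpha> would give only y^(m - 1), the
    order of the main term.\<close>
  also have "(\<Sum>\<alpha>\<in>F. \<Sum>\<beta>\<in>N \<alpha> - {\<alpha>}. prob (E \<alpha> \<inter> E \<beta>)) \<le> 4 * real m * real n * y ^ m"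
  proof -
    have "(\<Sum>\<alpha>\<in>F. \<Sum>\<beta>\<in>N \<alpha> - {\<alpha>}. prob (E \<alpha> \<inter> E \<beta>)) \<le> (\<Sum>\<alpha>\<in>F. \<Sum>\<beta>\<in>N \<alpha> - {\<alpha>}. z ^ (card (\<alpha> \<union> \<beta>) - 1))"
    proof (intro sum_mono)
      fix \<alpha> \<beta> assume ab: "\<alpha> \<in> F" "\<beta> \<in> N \<alpha> - {\<alpha>}"
      then have b: "\<beta> \<in> F" "\<alpha> \<inter> \<beta> \<noteq> {}" by (auto simp: N_def)
      show "prob (E \<alpha> \<inter> E \<beta>) \<le> z ^ (card (\<alpha> \<union> \<beta>) - 1)"
        using prob_regular_event_Int_le[OF m FI(1,2)[OF ab(1)] FI(1,2)[OF b(1)] b(2) x]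
        by (simp add: E_def z_def)
    qed
    also have "\<dots> = (\<Sum>(\<alpha>, \<beta>)\<in>(SIGMA \<alpha>:F. N \<alpha> - {\<alpha>}). z ^ (card (\<alpha> \<union> \<beta>) - 1))"
      using finF by (intro sum.Sigma) (auto simp: N_def)
    also have "\<dots> \<le> (\<Sum>s\<in>{Suc m..<2 * m}. real ((4 * n) ^ s) * z ^ (s - 1))"
    proof (rule sum_pairs_union_le[where h = "\<lambda>s. z ^ (s - 1)"])
      show "(SIGMA \<alpha>:F. N \<alpha> - {\<alpha>}) \<subseteq> {(\<alpha>, \<beta>). \<alpha> \<subseteq> {1..n} \<and> \<beta> \<subseteq> {1..n}}"
        by (auto simp: N_def F_def)
      fix \<alpha> \<beta> assume "(\<alpha>, \<beta>) \<in> (SIGMA \<alpha>:F. N \<alpha> - {\<alpha>})"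
      then have ab: "\<alpha> \<in> F" "\<beta> \<in> F" "\<alpha> \<inter> \<beta> \<noteq> {}" "\<alpha> \<noteq> \<beta>" by (auto simp: N_def)
      have "card (\<alpha> \<union> \<beta>) + card (\<alpha> \<inter> \<beta>) = 2 * m"
        using card_Un_Int[of \<alpha> \<beta>] FI[OF ab(1)] FI[OF ab(2)] by simp
      moreover have "card (\<alpha> \<inter> \<beta>) > 0" using ab(3) FI[OF ab(1)] by (simp add: card_gt_0_iff)
      moreover have "card \<alpha> < card (\<alpha> \<union> \<beta>)"
      proof (rule psubset_card_mono)
        show "finite (\<alpha> \<union> \<beta>)" using FI[OF ab(1)] FI[OF ab(2)] by simp
        have "\<not> \<beta> \<subseteq> \<alpha>"
          using card_subset_eq[of \<alpha> \<beta>] FI[OF ab(1)] FI[OF ab(2)] ab(4) by auto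
        then show "\<alpha> \<subset> \<alpha> \<union> \<beta>" by blast
      qed
      ultimately show "card (\<alpha> \<union> \<beta>) \<in> {Suc m..<2 * m}" using FI[OF ab(1)] by auto
    qed (use z in auto)
    also have "\<dots> \<le> (\<Sum>s\<in>{Suc m..<2 * m}. 4 * real n * y ^ m)"
    proof (intro sum_mono)
      fix s assume s: "s \<in> {Suc m..<2 * m}"
      then obtain r where r: "s = Suc r" "m \<le> r" by (cases s) auto
      have "real ((4 * n) ^ s) * z ^ (s - 1) = 4 * real n * y ^ r"
        by (simp add: r y_def power_mult_distrib)
      also have "\<dots> \<le> 4 * real n * y ^ m"
        using y r by (intro mult_left_mono power_decreasing) auto
      finally show "real ((4 * n) ^ s) * z ^ (s - 1) \<le> 4 * real n * y ^ m" .
    qed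
    also have "\<dots> \<le> 4 * real m * real n * y ^ m"
      using y m by (simp add: mult_right_mono)
    finally show ?thesis .
  qed
  finally have "\<bar>prob {\<omega> \<in> space M. \<forall>\<alpha>\<in>F. \<omega> \<notin> E \<alpha>} - exp (- (\<Sum>\<alpha>\<in>F. prob (E \<alpha>)))\<bar>
    \<le> 8 * real m * real n * y ^ m" by simp
  moreover have "(\<Sum>\<alpha>\<in>F. prob (E \<alpha>)) = real (n choose m) * fact m * near_regular_prob m (x\<^sup>2)"
    using pE n_subsets[of "{1..n}" m] by (simp add: F_def)
  ultimately show ?thesis unfolding F_def E_def y_def z_def by simp
qed

section \<open>Perimeters of random points on the circle\<close>

lemma cis_Arg2pi: "norm z = 1 \<Longrightarrow> cis (Arg2pi z) = z"
  by (simp add: complex_norm_eq_1_exp cis_conv_exp)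

lemma Arg2pi_cis: "0 \<le> a \<Longrightarrow> a < 2 * pi \<Longrightarrow> Arg2pi (cis a) = a"
  by (rule Arg2pi_unique[of 1]) (auto simp: cis_conv_exp)

lemma borel_measurable_Arg2pi [measurable]: "Arg2pi \<in> borel_measurable borel"
proof (rule borel_measurableI_greater)
  fix y show "{x \<in> space borel. y < Arg2pi x} \<in> sets borel"
    using borel_open[OF open_Arg2pi2pi_gt, of y] by simp
qed

lemma dist_cis: "dist (cis a) (cis b) = 2 * \<bar>sin ((a - b) / 2)\<bar>"
proof -
  have "(cos a - cos b)\<^sup>2 + (sin a - sin b)\<^sup>2 =
      ((cos a)\<^sup>2 + (sin a)\<^sup>2) + ((cos b)\<^sup>2 + (sin b)\<^sup>2) - 2 * (cos a * cos b + sin a * sin b)"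
    by (simp add: power2_eq_square algebra_simps)
  also have "\<dots> = 2 - 2 * cos (a - b)"
    by (simp add: cos_diff)
  also have "a - b = 2 * ((a - b) / 2)" by simp
  also have "2 - 2 * cos (2 * ((a - b) / 2)) = (2 * sin ((a - b) / 2))\<^sup>2"
    unfolding cos_double_sin by (simp add: power_mult_distrib)
  finally have "dist (cis a) (cis b) = sqrt ((2 * sin ((a - b) / 2))\<^sup>2)"
    by (simp add: dist_norm cmod_def)
  then show ?thesis by (simp only: real_sqrt_abs abs_mult abs_numeral)
qed

context linorder
begin

text \<open>Strictly increasing keys are injective on \<open>set xs\<close>, which is what
  interpreting \<open>folding_insort_key\<close> with that set as carrier requires.\<close>

lemma sorted_key_list_of_set_strict_sorted:
  assumes "sorted_wrt (<) (map f xs)"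
  shows "sorted_key_list_of_set f (set xs) = xs"
proof -
  interpret folding_insort_key "(\<le>)" "(<)" "set xs" f
    using assms by unfold_locales (auto simp: strict_sorted_iff distinct_map)
  show ?thesis
    using assms by (intro idem_if_sorted_distinct) (auto simp: strict_sorted_iff distinct_map)
qed

end

lemma exists_strict_sorted_key_list:
  fixes f :: "'i \<Rightarrow> 'b :: linorder"
  assumes "finite S" "inj_on f S"
  shows "\<exists>xs. set xs = S \<and> sorted_wrt (<) (map f xs)"
proof -
  obtain ys where "set ys = S" "distinct ys" using finite_distinct_list[OF assms(1)] by blast
  then have "set (sort_key f ys) = S \<and> sorted_wrt (<) (map f (sort_key f ys))"
    using assms(2) by (auto simp: strict_sorted_iff distinct_map)
  then show ?thesis ..
qed

lemma peri_set_sorted: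
  assumes "sorted_wrt (<) (map Arg2pi vs)"
  shows "peri (set vs) = closed_polygon_length vs"
  using sorted_key_list_of_set_strict_sorted[OF assms] by (simp add: peri_def)

lemma closed_polygon_length_cis:
  assumes a: "\<And>k. k < m \<Longrightarrow> 0 \<le> a k \<and> a k < 2 * pi" and inc: "\<forall>k. Suc k < m \<longrightarrow> a k < a (Suc k)"
    and vs: "length vs = m" "\<And>k. k < m \<Longrightarrow> vs ! k = cis (a k)"
  shows "closed_polygon_length vs = 2 * real m * sin (pi / real m) - defect m a"
proof -
  have "closed_polygon_length vs = (\<Sum>k<m. 2 * sin (arc_gap m a k / 2))"
    unfolding closed_polygon_length_def vs(1)
  proof (intro sum.cong refl)
    fix k assume "k \<in> {..<m}"
    then have k: "k < m" by simp
    show "dist (vs ! k) (vs ! (Suc k mod m)) = 2 * sin (arc_gap m a k / 2)"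
    proof (cases "Suc k = m")
      \<comment> \<open>The closing edge: half its gap is pi minus half of a k - a 0, and both have
        the same sine. So the chord formula holds even if the gap exceeds pi.\<close>
      case True
      have "a 0 \<le> a k"
        using increasing_chain_less[OF inc, of 0 k] k by (cases "k = 0") auto
      then have "0 \<le> sin ((a k - a 0) / 2)"
        using a[OF k] a[of 0] k by (intro sin_ge_zero) auto
      moreover have "arc_gap m a k / 2 = pi - (a k - a 0) / 2"
        using True by (simp add: arc_gap_def field_simps)
      ultimately show ?thesis
        using True k vs(2)[OF k] vs(2)[of 0] by (simp only: mod_self dist_cis sin_pi_minus abs_of_nonneg)
    next
      case False
      then have k': "Suc k < m" using k by simp
      then have "0 \<le> sin ((a (Suc k) - a k) / 2)"
        using inc a[OF k] a[of "Suc k"] by (intro sin_ge_zero) (auto intro: less_imp_le)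
      then have "dist (cis (a (Suc k))) (cis (a k)) = 2 * sin ((a (Suc k) - a k) / 2)"
        by (simp only: dist_cis abs_of_nonneg)
      then show ?thesis
        using k' vs(2)[OF k] vs(2)[OF k'] by (simp add: arc_gap_def dist_commute)
    qed
  qed
  then show ?thesis by (simp add: defect_def)
qed

locale random_circle_points = prob_space +
  fixes U :: "nat \<Rightarrow> 'a \<Rightarrow> complex"
  assumes indep_U: "indep_vars (\<lambda>_. circle_borel) U {1..}"
    and distr_U: "i \<ge> 1 \<Longrightarrow> distr M circle_borel (U i) = uniform_circle"
begin

lemma measurable_U: "i \<ge> 1 \<Longrightarrow> U i \<in> measurable M circle_borel"
  using indep_U by (auto simp: indep_vars_def)

lemma measurable_U_borel: "i \<ge> 1 \<Longrightarrow> U i \<in> borel_measurable M"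
  using measurable_U by (simp add: measurable_restrict_space2_iff)

lemma norm_U: "i \<ge> 1 \<Longrightarrow> \<omega> \<in> space M \<Longrightarrow> norm (U i \<omega>) = 1"
  using measurable_space[OF measurable_U] by (fastforce simp: space_restrict_space)

lemma distr_Arg2pi_uniform_circle: "distr uniform_circle borel Arg2pi = angle_measure"
proof -
  have cis: "cis \<in> measurable (uniform_measure lborel {0..<2 * pi}) circle_borel"
  proof (rule measurable_restrict_space2)
    have "cis \<in> borel_measurable borel"
      by (intro borel_measurable_continuous_onI continuous_intros)
    then show "cis \<in> borel_measurable (uniform_measure lborel {0..<2 * pi})"
      by (subst measurable_cong_sets[OF sets_uniform_measure refl]) simp
  qed auto
  have Arg: "Arg2pi \<in> measurable circle_borel borel"
    by (rule measurable_restrict_space1) measurable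
  have "distr uniform_circle borel Arg2pi = distr angle_measure borel (Arg2pi \<circ> cis)"
    unfolding uniform_circle_def angle_measure_def by (rule distr_distr[OF Arg cis])
  \<comment> \<open>\<open>angle_measure\<close> is a measure on the whole line, while
    \<open>Arg2pi \<circ> cis\<close> is the identity only on [0, 2 pi); hence the equality almost
    everywhere.\<close>
  also have "\<dots> = distr angle_measure borel (\<lambda>a. a)"
  proof (rule distr_cong_AE)
    have "AE a in angle_measure. a \<in> {0..<2 * pi}"
      unfolding angle_measure_def by (rule AE_uniform_measureI) auto
    then show "AE a in angle_measure. (Arg2pi \<circ> cis) a = a"
      by eventually_elim (simp add: Arg2pi_cis)
  qed (use measurable_comp[OF cis Arg] in \<open>auto simp: angle_measure_def\<close>)
  also have "\<dots> = angle_measure" by (rule distr_id2) simp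
  finally show ?thesis .
qed

sublocale random_angles M "\<lambda>i \<omega>. Arg2pi (U i \<omega>)" "{1..}"
proof unfold_locales
  have Arg: "Arg2pi \<in> measurable circle_borel borel"
    by (rule measurable_restrict_space1) measurable
  show "indep_vars (\<lambda>_. borel) (\<lambda>i \<omega>. Arg2pi (U i \<omega>)) {1..}"
    using indep_U Arg by (rule indep_vars_compose2)
  fix i :: nat assume i: "i \<in> {1..}"
  then have "distr M borel (\<lambda>\<omega>. Arg2pi (U i \<omega>)) = distr (distr M circle_borel (U i)) borel Arg2pi"
    using distr_distr[OF Arg measurable_U, of i] by (simp add: comp_def)
  also have "\<dots> = angle_measure"
    using i by (simp add: distr_U distr_Arg2pi_uniform_circle)
  finally show "distr M borel (\<lambda>\<omega>. Arg2pi (U i \<omega>)) = angle_measure" .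
  show "0 \<le> Arg2pi (U i \<omega>) \<and> Arg2pi (U i \<omega>) < 2 * pi" for \<omega>
    using Arg2pi[of "U i \<omega>"] by simp
qed

text \<open>Ties are not excluded here: \<open>M\<close> need not be complete, so measurability has to be shown everywhere.
  The event is split according to a list of indices that enumerates the distinct points in order.\<close>

lemma peri_event:
  assumes \<alpha>: "finite \<alpha>" "\<alpha> \<subseteq> {1..}"
  shows "{\<omega> \<in> space M. c \<le> peri ((\<lambda>i. U i \<omega>) ` \<alpha>)} \<in> events"
proof -
  define B where "B xs = {\<omega> \<in> space M. sorted_wrt (<) (map (\<lambda>i. Arg2pi (U i \<omega>)) xs) \<and>
      (\<forall>i\<in>\<alpha>. \<exists>j\<in>set xs. U i \<omega> = U j \<omega>) \<and> c \<le> closed_polygon_length (map (\<lambda>i. U i \<omega>) xs)}" for xs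
  let ?L = "{xs. distinct xs \<and> set xs \<subseteq> \<alpha>}"
  have sorted: "peri ((\<lambda>i. U i \<omega>) ` \<alpha>) = closed_polygon_length (map (\<lambda>i. U i \<omega>) xs)"
    if "set xs \<subseteq> \<alpha>" "\<omega> \<in> space M" "sorted_wrt (<) (map (\<lambda>i. Arg2pi (U i \<omega>)) xs)"
      "\<forall>i\<in>\<alpha>. \<exists>j\<in>set xs. U i \<omega> = U j \<omega>" for xs \<omega>
  proof -
    have "(\<lambda>i. U i \<omega>) ` \<alpha> = set (map (\<lambda>i. U i \<omega>) xs)" using that by auto
    moreover have "sorted_wrt (<) (map Arg2pi (map (\<lambda>i. U i \<omega>) xs))"
      using that(3) by (simp add: comp_def)
    ultimately show ?thesis by (simp only: peri_set_sorted)
  qed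
  have "{\<omega> \<in> space M. c \<le> peri ((\<lambda>i. U i \<omega>) ` \<alpha>)} = (\<Union>xs\<in>?L. B xs)"
  proof (intro equalityI subsetI)
    fix \<omega> assume "\<omega> \<in> {\<omega> \<in> space M. c \<le> peri ((\<lambda>i. U i \<omega>) ` \<alpha>)}"
    then have \<omega>: "\<omega> \<in> space M" "c \<le> peri ((\<lambda>i. U i \<omega>) ` \<alpha>)" by auto
    let ?u = "\<lambda>i. U i \<omega>"
    have "cis (Arg2pi v) = v" if "v \<in> ?u ` \<alpha>" for v
      using that \<alpha>(2) \<omega>(1) norm_U by (auto intro!: cis_Arg2pi)
    then have inj: "inj_on Arg2pi (?u ` \<alpha>)" by (rule inj_on_inverseI)
    obtain l where l: "set l = ?u ` \<alpha>" "sorted_wrt (<) (map Arg2pi l)"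
      using exists_strict_sorted_key_list[OF _ inj] \<alpha>(1) by blast
    have "distinct l" using l(2) by (simp add: strict_sorted_iff distinct_map)
    \<comment> \<open>One index is chosen for each distinct point, listed in angular order.\<close>
    define xs where "xs = map (inv_into \<alpha> ?u) l"
    have preimage: "?u (inv_into \<alpha> ?u v) = v" "inv_into \<alpha> ?u v \<in> \<alpha>" if "v \<in> set l" for v
      using that unfolding l(1) by (rule f_inv_into_f, rule inv_into_into)
    have u: "map ?u xs = l" unfolding xs_def map_map by (rule map_idI) (simp add: preimage)
    have "distinct xs" using \<open>distinct l\<close> unfolding u[symmetric] by (simp add: distinct_map)
    moreover have "set xs \<subseteq> \<alpha>" using preimage(2) by (auto simp: xs_def)
    moreover have s: "sorted_wrt (<) (map (\<lambda>i. Arg2pi (U i \<omega>)) xs)"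
      using l(2) unfolding u[symmetric] by (simp add: comp_def)
    moreover have cover: "\<forall>i\<in>\<alpha>. \<exists>j\<in>set xs. U i \<omega> = U j \<omega>"
    proof
      fix i assume "i \<in> \<alpha>"
      then have "U i \<omega> \<in> set (map ?u xs)" unfolding u l(1) by simp
      then show "\<exists>j\<in>set xs. U i \<omega> = U j \<omega>" by auto
    qed
    ultimately show "\<omega> \<in> (\<Union>xs\<in>?L. B xs)"
      using \<omega> sorted[OF _ \<omega>(1) s cover] by (auto simp: B_def)
  next
    fix \<omega> assume "\<omega> \<in> (\<Union>xs\<in>?L. B xs)"
    then show "\<omega> \<in> {\<omega> \<in> space M. c \<le> peri ((\<lambda>i. U i \<omega>) ` \<alpha>)}"
      using sorted by (auto simp: B_def)
  qed
  moreover have "(\<Union>xs\<in>?L. B xs) \<in> events"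
  proof (rule sets.finite_UN)
    show "finite ?L" using finite_subset_distinct[OF \<alpha>(1)] by (simp add: conj_commute)
    fix xs assume "xs \<in> ?L"
    then have xs: "set xs \<subseteq> {1..}" using \<alpha>(2) by auto
    have U: "U i \<in> borel_measurable M" if "i \<in> set xs \<union> \<alpha>" for i
      using that xs \<alpha>(2) by (intro measurable_U_borel) auto
    have A: "(\<lambda>\<omega>. Arg2pi (U i \<omega>)) \<in> borel_measurable M" if "i \<in> set xs" for i
      using measurable_compose[OF U borel_measurable_Arg2pi, of i] that by simp
    have lt: "Measurable.pred M (\<lambda>\<omega>. Arg2pi (U (xs ! i) \<omega>) < Arg2pi (U (xs ! j) \<omega>))"
      if "i < length xs" "j < length xs" for i j
    proof -
      have [measurable]: "(\<lambda>\<omega>. Arg2pi (U (xs ! i) \<omega>)) \<in> borel_measurable M"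
        "(\<lambda>\<omega>. Arg2pi (U (xs ! j) \<omega>)) \<in> borel_measurable M"
        using that by (auto intro!: A)
      show ?thesis by measurable
    qed
    have 1: "Measurable.pred M (\<lambda>\<omega>. sorted_wrt (<) (map (\<lambda>i. Arg2pi (U i \<omega>)) xs))"
    proof -
      have "(\<lambda>\<omega>. sorted_wrt (<) (map (\<lambda>i. Arg2pi (U i \<omega>)) xs)) =
          (\<lambda>\<omega>. \<forall>j\<in>{..<length xs}. \<forall>i\<in>{..<j}. Arg2pi (U (xs ! i) \<omega>) < Arg2pi (U (xs ! j) \<omega>))"
        by (auto simp: sorted_wrt_iff_nth_less fun_eq_iff)
      then show ?thesis by (simp only:) (intro pred_intros_finite(3) lt, auto)
    qed
    have 2: "Measurable.pred M (\<lambda>\<omega>. \<forall>i\<in>\<alpha>. \<exists>j\<in>set xs. U i \<omega> = U j \<omega>)"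
    proof (intro pred_intros_finite(3,4) \<alpha>(1) finite_set)
      fix i j assume "i \<in> \<alpha>" "j \<in> set xs"
      then have [measurable]: "U i \<in> borel_measurable M" "U j \<in> borel_measurable M" by (auto intro!: U)
      show "Measurable.pred M (\<lambda>\<omega>. U i \<omega> = U j \<omega>)" by measurable
    qed
    have "(\<lambda>\<omega>. closed_polygon_length (map (\<lambda>i. U i \<omega>) xs)) \<in> borel_measurable M"
    proof -
      have mod: "Suc k mod length xs < length xs" if "k < length xs" for k
        using that by (intro mod_less_divisor) auto
      have "(\<lambda>\<omega>. closed_polygon_length (map (\<lambda>i. U i \<omega>) xs)) =
          (\<lambda>\<omega>. \<Sum>k<length xs. dist (U (xs ! k) \<omega>) (U (xs ! (Suc k mod length xs)) \<omega>))"
        using mod by (intro ext) (simp add: closed_polygon_length_def)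
      then show ?thesis
        using mod by (simp only:) (intro borel_measurable_sum borel_measurable_dist U, auto)
    qed
    then have 3: "Measurable.pred M (\<lambda>\<omega>. c \<le> closed_polygon_length (map (\<lambda>i. U i \<omega>) xs))"
      by measurable
    show "B xs \<in> events" using 1 2 3 unfolding B_def by measurable
  qed
  ultimately show ?thesis by simp
qed

text \<open>Distinct angles guarantee that the polygon really has \<open>card \<alpha>\<close>
  vertices; for the enumeration sorted by angle, the perimeter deficit is then
  \<open>defect\<close>.\<close>

lemma regular_event_iff_peri:
  assumes \<alpha>: "finite \<alpha>" "\<alpha> \<subseteq> {1..}" and \<omega>: "\<omega> \<in> space M" and inj: "inj_on (\<lambda>i. Arg2pi (U i \<omega>)) \<alpha>"
  shows "\<omega> \<in> regular_event \<epsilon> \<alpha> \<longleftrightarrow>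
    2 * real (card \<alpha>) * sin (pi / real (card \<alpha>)) - peri ((\<lambda>i. U i \<omega>) ` \<alpha>) \<le> \<epsilon>"
proof -
  let ?A = "\<lambda>i. Arg2pi (U i \<omega>)" and ?m = "card \<alpha>"
  have peri: "2 * real ?m * sin (pi / real ?m) - peri ((\<lambda>i. U i \<omega>) ` \<alpha>) = defect ?m (\<lambda>k. ?A (xs ! k))"
    if xs: "xs \<in> permutations_of_set \<alpha>" and inc: "\<forall>k. Suc k < ?m \<longrightarrow> ?A (xs ! k) < ?A (xs ! Suc k)" for xs
  proof -
    have len: "length xs = ?m" "set xs = \<alpha>"
      using xs by (auto simp: length_finite_permutations_of_set permutations_of_setD)
    let ?vs = "map (\<lambda>i. U i \<omega>) xs"
    have "sorted_wrt (<) (map Arg2pi ?vs)"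
      using increasing_chain_less[OF inc] by (auto simp: sorted_wrt_iff_nth_less len)
    then have "peri (set ?vs) = closed_polygon_length ?vs" by (rule peri_set_sorted)
    also have "\<dots> = 2 * real ?m * sin (pi / real ?m) - defect ?m (\<lambda>k. ?A (xs ! k))"
    proof (rule closed_polygon_length_cis[OF _ inc])
      fix k assume k: "k < ?m"
      then have "xs ! k \<in> \<alpha>" using len nth_mem[of k xs] by simp
      then show "?vs ! k = cis (?A (xs ! k))"
        using k len \<alpha>(2) \<omega> norm_U[of "xs ! k" \<omega>] by (auto simp: cis_Arg2pi)
      show "0 \<le> ?A (xs ! k) \<and> ?A (xs ! k) < 2 * pi" using Arg2pi[of "U (xs ! k) \<omega>"] by simp
    qed (simp add: len)
    finally show ?thesis by (simp add: len)
  qed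
  show ?thesis
  proof
    assume "\<omega> \<in> regular_event \<epsilon> \<alpha>"
    then obtain xs where "xs \<in> permutations_of_set \<alpha>" "near_regular ?m \<epsilon> (\<lambda>k. ?A (xs ! k))"
      by (auto simp: regular_event_def)
    then show "2 * real ?m * sin (pi / real ?m) - peri ((\<lambda>i. U i \<omega>) ` \<alpha>) \<le> \<epsilon>"
      using peri[of xs] by (simp add: near_regular_def)
  next
    assume le: "2 * real ?m * sin (pi / real ?m) - peri ((\<lambda>i. U i \<omega>) ` \<alpha>) \<le> \<epsilon>"
    obtain xs where xs: "set xs = \<alpha>" "sorted_wrt (<) (map ?A xs)"
      using exists_strict_sorted_key_list[OF \<alpha>(1) inj] by blast
    then have "distinct xs" by (simp add: strict_sorted_iff distinct_map)
    then have perm: "xs \<in> permutations_of_set \<alpha>" using xs(1) by (intro permutations_of_setI)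
    have inc: "\<forall>k. Suc k < ?m \<longrightarrow> ?A (xs ! k) < ?A (xs ! Suc k)"
      using xs(2) length_finite_permutations_of_set[OF perm]
      by (auto simp: sorted_wrt_iff_nth_less)
    show "\<omega> \<in> regular_event \<epsilon> \<alpha>"
      using le peri[OF perm inc] inc perm \<omega> by (auto simp: regular_event_def near_regular_def)
  qed
qed

end

section \<open>Rate of convergence\<close>

text \<open>With k = m - 1, the ball volume supplies pi^(k/2) / Gamma (k/2 + 1), and k/2 + 1 = (m +
  1)/2. Of (2 pi)^m, one factor cancels against the range of the smallest angle, 2^k against the
  radius and pi^(k/2) against the ball.\<close>

lemma near_regular_const_eq:
  assumes "m \<ge> 2" "t > 0"
  shows "near_regular_const m * sqrt t ^ (m - 1) = t powr ((real m - 1) / 2) / K1 m"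
proof -
  define k where "k = m - 1"
  have m: "m = Suc k" "k \<ge> 1" using assms by (auto simp: k_def)
  define s where "s = sin (pi / real m)"
  have s: "s > 0" unfolding s_def using assms by (intro sin_gt_zero) (auto simp: field_simps)
  have half: "(real m - 1) / 2 = real k / 2" by (simp add: m)
  have pw: "y powr (real k / 2) = sqrt y ^ k" if "y > 0" for y
    using that by (simp add: powr_half_sqrt[symmetric] powr_realpow[symmetric] powr_powr)
  have gam: "unit_ball_vol (real k) = sqrt pi ^ k / Gamma ((real m + 1) / 2)"
  proof -
    have eq: "real k / 2 + 1 = (real m + 1) / 2" by (simp add: m field_simps)
    show ?thesis unfolding unit_ball_vol_def eq by (simp add: pw)
  qed
  have m32: "real m powr (3 / 2) = real m * sqrt (real m)"
  proof -
    have "real m powr (3 / 2) = real m powr (1 + 1 / 2)" by simp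
    also have "\<dots> = real m * sqrt (real m)"
      using assms by (subst powr_add) (simp add: powr_half_sqrt)
    finally show ?thesis .
  qed
  have Gp: "Gamma ((real m + 1) / 2) > 0" by (intro Gamma_real_pos) auto
  have "near_regular_const m = (sqrt pi ^ k * (2 ^ k / sqrt s ^ k) * (2 * pi)) /
      ((2 * pi) ^ m * Gamma ((real m + 1) / 2) * (real m * sqrt (real m)))"
    unfolding near_regular_const_def s_def[symmetric] k_def[symmetric] gam
    by (simp add: power_divide field_simps)
  also have "(2 * pi) ^ m = 2 * pi * (2 ^ k * (sqrt pi ^ k * sqrt pi ^ k))"
  proof -
    have "sqrt pi ^ k * sqrt pi ^ k = pi ^ k" by (simp flip: power_mult_distrib)
    then show ?thesis by (simp add: m power_mult_distrib)
  qed
  also have "(sqrt pi ^ k * (2 ^ k / sqrt s ^ k) * (2 * pi)) /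
      (2 * pi * (2 ^ k * (sqrt pi ^ k * sqrt pi ^ k)) * Gamma ((real m + 1) / 2) * (real m * sqrt (real m))) =
      1 / ((real m * sqrt (real m)) * (sqrt pi ^ k * sqrt s ^ k) * Gamma ((real m + 1) / 2))"
    using s Gp assms by (simp add: field_simps)
  also have "\<dots> = 1 / K1 m"
  proof -
    have "(pi * s) powr (real k / 2) = sqrt pi ^ k * sqrt s ^ k"
      using s by (simp add: pw real_sqrt_mult power_mult_distrib)
    then show ?thesis by (simp add: K1_def m32 half s_def)
  qed
  finally show ?thesis using assms by (simp add: half pw m)
qed

text \<open>The falling factorial is at least (n - m)^m, and Bernoulli's inequality bounds the loss
  against n^m.\<close>

lemma falling_factorial_approx:
  assumes "m \<le> n" "n > 0"
  shows "real (n choose m) * fact m \<le> real n ^ m"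
    and "real n ^ m - real (n choose m) * fact m \<le> (real m)\<^sup>2 * real n ^ m / real n"
proof -
  have "real ((n choose m) * fact m) \<le> real (n ^ m)"
    using binomial_fact_pow[of n m] by (simp only: of_nat_le_iff)
  then show "real (n choose m) * fact m \<le> real n ^ m" by simp
  have "1 - (real m)\<^sup>2 / real n = 1 + real m * (- (real m / real n))"
    by (simp add: power2_eq_square)
  also have "\<dots> \<le> (1 + (- (real m / real n))) ^ m"
    using assms by (intro Bernoulli_inequality) simp
  finally have "real n ^ m * (1 - (real m)\<^sup>2 / real n) \<le> real n ^ m * (1 + (- (real m / real n))) ^ m"
    by (intro mult_left_mono) auto
  also have "\<dots> = (real n - real m) ^ m"
    using assms by (simp add: power_mult_distrib[symmetric] algebra_simps)
  also have "\<dots> = (\<Prod>i = 0..<m. real n - real m)" by simp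
  also have "\<dots> \<le> (\<Prod>i = 0..<m. real n - real i)"
    using assms by (intro prod_mono) auto
  also have "\<dots> = real (n choose m) * fact m"
    by (simp add: binomial_gbinomial gbinomial_prod_rev)
  finally show "real n ^ m - real (n choose m) * fact m \<le> (real m)\<^sup>2 * real n ^ m / real n"
    by (simp add: algebra_simps)
qed

lemma abs_exp_minus_diff_le:
  fixes a b :: real
  assumes "a \<ge> 0" "b \<ge> 0"
  shows "\<bar>exp (- a) - exp (- b)\<bar> \<le> \<bar>a - b\<bar>"
proof -
  have *: "exp (- a) - exp (- b) \<le> b - a" if "0 \<le> a" "a \<le> b" for a b :: real
  proof -
    have "1 - exp (- (b - a)) \<le> b - a" using exp_ge_add_one_self[of "- (b - a)"] by linarith
    moreover have "0 \<le> 1 - exp (- (b - a))" using that by simp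
    moreover have "exp (- a) \<le> 1" using that by simp
    ultimately have "exp (- a) * (1 - exp (- (b - a))) \<le> 1 * (b - a)"
      using that by (intro mult_mono) auto
    moreover have "exp (- a) - exp (- b) = exp (- a) * (1 - exp (- (b - a)))"
      by (simp add: right_diff_distrib flip: exp_add)
    ultimately show ?thesis by (simp only: mult_1)
  qed
  show ?thesis
  proof (cases "a \<le> b")
    case True
    then have "exp (- b) \<le> exp (- a)" by simp
    then show ?thesis using *[OF assms(1) True] True by simp
  next
    case False
    then have "exp (- a) \<le> exp (- b)" by simp
    then show ?thesis using *[OF assms(2), of a] False by simp
  qed
qed

context random_circle_points
begin

text \<open>Reduces measurability of an event about the maximum to a finite union of events about
  fixed index sets; m \<le> n makes the family nonempty, so that \<open>Max\<close> is
  meaningful.\<close>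

lemma max_peri_event:
  assumes n: "m \<le> n" "m > 0"
  shows "{\<omega> \<in> space M. 2 * real m * sin (pi / real m) - max_peri m n (\<lambda>i. U i \<omega>) \<le> \<epsilon>} =
    (\<Union>\<alpha>\<in>{\<alpha>. \<alpha> \<subseteq> {1..n} \<and> card \<alpha> = m}.
      {\<omega> \<in> space M. 2 * real m * sin (pi / real m) - \<epsilon> \<le> peri ((\<lambda>i. U i \<omega>) ` \<alpha>)})"
proof -
  let ?F = "{\<alpha>. \<alpha> \<subseteq> {1..n} \<and> card \<alpha> = m}"
  have ne: "?F \<noteq> {}" using n by (auto intro!: exI[of _ "{1..m}"])
  have fin: "finite ?F" by simp
  have "c \<le> max_peri m n u \<longleftrightarrow> (\<exists>\<alpha>\<in>?F. c \<le> peri (u ` \<alpha>))" for c u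
  proof -
    have eq: "{peri (u ` I) | I. I \<subseteq> {1..n} \<and> card I = m} = (\<lambda>\<alpha>. peri (u ` \<alpha>)) ` ?F" by auto
    show ?thesis unfolding max_peri_def eq using fin ne by (subst Max_ge_iff) auto
  qed
  from this[of "2 * real m * sin (pi / real m) - \<epsilon>"] show ?thesis by (auto simp: algebra_simps)
qed

text \<open>The perimeter event and the union of the regular events differ only on ties, a null
  event; both are shown measurable before they are compared.\<close>

lemma prob_max_peri:
  assumes n: "m \<le> n" "m > 0"
  shows "prob {\<omega> \<in> space M. 2 * real m * sin (pi / real m) - max_peri m n (\<lambda>i. U i \<omega>) \<le> \<epsilon>} =
    1 - prob {\<omega> \<in> space M. \<forall>\<alpha>\<in>{\<alpha>. \<alpha> \<subseteq> {1..n} \<and> card \<alpha> = m}. \<omega> \<notin> regular_event \<epsilon> \<alpha>}"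
    (is "prob ?G = 1 - prob ?N")
proof -
  let ?F = "{\<alpha>. \<alpha> \<subseteq> {1..n} \<and> card \<alpha> = m}"
  have F: "finite \<alpha>" "\<alpha> \<subseteq> {1..}" "card \<alpha> = m" "\<alpha> \<subseteq> {1..n}" if "\<alpha> \<in> ?F" for \<alpha>
    using that by (auto intro: finite_subset)
  have G: "?G \<in> events"
    unfolding max_peri_event[OF n] by (intro sets.finite_UN peri_event F) auto
  have E: "regular_event \<epsilon> \<alpha> \<in> events" if "\<alpha> \<in> ?F" for \<alpha>
    using F[OF that] by (intro regular_event_events)
  have N_eq: "?N = space M - (\<Union>\<alpha>\<in>?F. regular_event \<epsilon> \<alpha>)" by auto
  have UE: "(\<Union>\<alpha>\<in>?F. regular_event \<epsilon> \<alpha>) \<in> events"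
    by (rule sets.finite_UN) (use E in auto)
  have "prob ?G = prob (\<Union>\<alpha>\<in>?F. regular_event \<epsilon> \<alpha>)"
  proof (rule finite_measure_eq_AE[OF _ G UE])
    have "AE \<omega> in M. inj_on (\<lambda>i. Arg2pi (U i \<omega>)) {1..n}"
      by (rule AE_inj_on) auto
    then show "AE \<omega> in M. \<omega> \<in> ?G \<longleftrightarrow> \<omega> \<in> (\<Union>\<alpha>\<in>?F. regular_event \<epsilon> \<alpha>)"
      using AE_space
    proof eventually_elim
      case (elim \<omega>)
      have "\<omega> \<in> regular_event \<epsilon> \<alpha> \<longleftrightarrow> 2 * real m * sin (pi / real m) - \<epsilon> \<le> peri ((\<lambda>i. U i \<omega>) ` \<alpha>)"
        if "\<alpha> \<in> ?F" for \<alpha>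
        using regular_event_iff_peri[OF F(1,2)[OF that] elim(2) inj_on_subset[OF elim(1) F(4)[OF that]], of \<epsilon>]
          F(3)[OF that] by auto
      then show ?case unfolding max_peri_event[OF n] using elim(2) by auto
    qed
  qed
  also have "\<dots> = 1 - prob ?N"
    unfolding N_eq using UE by (simp add: prob_compl)
  finally show ?thesis .
qed

lemma max_peri_rate:
  fixes m :: nat and t :: real
  assumes m: "m \<ge> 3" and t: "t > 0"
  defines "p \<equiv> \<lambda>n. prob {\<omega> \<in> space M. real n powr (2 * real m / (real m - 1))
        * (2 * real m * sin (pi / real m) - max_peri m n (\<lambda>i. U i \<omega>)) \<le> t}"
    and "L \<equiv> 1 - exp (- (t powr ((real m - 1) / 2) / K1 m))"
  shows "(\<lambda>n. \<bar>p n - L\<bar>) \<in> O(\<lambda>n. real n powr (- 1 / (real m - 1)))"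
proof -
  have m2: "m \<ge> 2" using m by simp
  define \<tau> where "\<tau> = sqrt t"
  have \<tau>: "\<tau> > 0" "\<tau>\<^sup>2 = t" using t by (auto simp: \<tau>_def)
  define c where "c = near_regular_const m"
  have c: "c * \<tau> ^ (m - 1) = t powr ((real m - 1) / 2) / K1 m"
    unfolding c_def \<tau>_def by (rule near_regular_const_eq[OF m2 t])
  have sin_pos: "sin (pi / real m) > 0" using m by (intro sin_gt_zero) (auto simp: field_simps)
  have c0: "c \<ge> 0" unfolding c_def near_regular_const_def using sin_pos by simp
  obtain C \<delta> where C: "\<delta> > 0"
    "\<And>x. 0 < x \<Longrightarrow> x < \<delta> \<Longrightarrow> \<bar>near_regular_prob m (x\<^sup>2) - c * x ^ (m - 1)\<bar> \<le> C * x ^ m"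
    using near_regular_prob_asymp[OF m2] unfolding c_def by blast
  define K where "K = pair_const m"
  define r where "r n = real n powr (- 1 / (real m - 1))" for n
  \<comment> \<open>x n is the square root of the admissible defect t n^(-2 m/(m-1)). The scaling
    rests on two identities proved below: n x = \<tau> r and r^(m-1) = 1/n.\<close>
  define x where "x n = \<tau> * real n powr (- (real m / (real m - 1)))" for n
  \<comment> \<open>The three terms bound, in this order, the Poisson approximation, the ellipsoid
    approximation of a single probability, and the replacement of the falling factorial by
    n^m.\<close>
  define D where "D = 8 * real m * (4 * K * \<tau>) ^ m + \<bar>C\<bar> * \<tau> ^ m + (real m)\<^sup>2 * (c * \<tau> ^ (m - 1))"
  have mr: "real m - 1 > 0" using m by simp
  have r0: "r \<longlonglongrightarrow> 0"
    unfolding r_def using mr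
    by (intro tendsto_neg_powr filterlim_real_sequentially) (simp add: divide_neg_pos)
  have ev1: "\<forall>\<^sub>F n in sequentially. \<tau> * r n < \<delta>"
    using tendsto_mult_left[OF r0, of \<tau>] C(1) by (intro order_tendstoD(2)) auto
  have ev2: "\<forall>\<^sub>F n in sequentially. (4 * K * \<tau>) * r n < 1"
    using tendsto_mult_left[OF r0, of "4 * K * \<tau>"] by (intro order_tendstoD(2)) auto
  have "\<forall>\<^sub>F n in sequentially. norm \<bar>p n - L\<bar> \<le> D * norm (r n)"
    using ev1 ev2 eventually_ge_at_top[of m]
  proof eventually_elim
    case (elim n)
    have n: "n \<ge> m" "n > 0" "real n \<ge> 1" using elim m by auto
    have rpos: "r n > 0" using n by (simp add: r_def)
    have xpos: "x n > 0" using n \<tau> by (simp add: x_def)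
    have nx: "real n * x n = \<tau> * r n"
    proof -
      have "real n * real n powr (- (real m / (real m - 1))) = real n powr (1 + - (real m / (real m - 1)))"
        using n by (subst powr_add) simp
      also have "1 + - (real m / (real m - 1)) = - 1 / (real m - 1)"
        using mr by (simp add: field_simps)
      finally show ?thesis by (simp add: x_def r_def mult_ac)
    qed
    have x_le: "x n \<le> \<tau> * r n"
      using mult_right_mono[of 1 "real n" "x n"] n xpos unfolding nx by simp
    have rm: "r n ^ (m - 1) = 1 / real n"
    proof -
      have "r n ^ (m - 1) = real n powr (- 1 / (real m - 1) * real (m - 1))"
        unfolding r_def using n by (simp add: powr_realpow[symmetric] powr_powr)
      also have "- 1 / (real m - 1) * real (m - 1) = - 1" using m by (simp add: of_nat_diff)
      finally show ?thesis using n by (simp add: powr_minus_divide)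
    qed
    have rle: "r n \<le> 1" unfolding r_def using powr_mono[of "- 1 / (real m - 1)" 0 "real n"] n mr by simp
    have "1 / real n \<le> r n ^ 1"
      unfolding rm[symmetric] using rle rpos m by (intro power_decreasing) auto
    then have inv_le: "1 / real n \<le> r n" by simp
    have pow: "real n ^ m * x n ^ (m - 1) = \<tau> ^ (m - 1)"
    proof -
      have "real n ^ m = real n * real n ^ (m - 1)" using m by (cases m) auto
      then have "real n ^ m * x n ^ (m - 1) = real n * (real n * x n) ^ (m - 1)"
        by (simp add: power_mult_distrib)
      also have "\<dots> = \<tau> ^ (m - 1)" unfolding nx power_mult_distrib rm using n by simp
      finally show ?thesis .
    qed
    have eps: "real n powr (2 * real m / (real m - 1)) * y \<le> t \<longleftrightarrow> y \<le> (x n)\<^sup>2" for y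
    proof -
      have "(x n)\<^sup>2 = t * real n powr (- (2 * real m / (real m - 1)))"
        unfolding x_def power_mult_distrib \<tau>(2) using n
        by (simp add: powr_realpow[symmetric] powr_powr mult_ac)
      then have eq: "(x n)\<^sup>2 = t / real n powr (2 * real m / (real m - 1))"
        by (simp add: powr_minus_divide)
      have "real n powr (2 * real m / (real m - 1)) > 0" using n by simp
      then show ?thesis unfolding eq by (simp only: pos_le_divide_eq mult.commute)
    qed
    define Q where "Q = prob {\<omega> \<in> space M. \<forall>\<alpha>\<in>{\<alpha>. \<alpha> \<subseteq> {1..n} \<and> card \<alpha> = m}. \<omega> \<notin> regular_event ((x n)\<^sup>2) \<alpha>}"
    have pQ: "p n = 1 - Q"
      unfolding p_def eps Q_def using n m by (intro prob_max_peri) auto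
    define f where "f = real (n choose m) * fact m"
    define v where "v = near_regular_prob m ((x n)\<^sup>2)"
    have v0: "v \<ge> 0" by (simp add: v_def near_regular_prob_def)
    have f0: "f \<ge> 0" by (simp add: f_def)
    have "4 * real n * (K * x n) = 4 * K * (real n * x n)" by simp
    then have y: "4 * real n * (K * x n) = (4 * K * \<tau>) * r n" unfolding nx by simp
    have "4 * real n * (K * x n) \<le> 1" unfolding y using elim(2) by (rule less_imp_le)
    then have "\<bar>Q - exp (- (f * v))\<bar> \<le> 8 * real m * real n * (4 * real n * (K * x n)) ^ m"
      unfolding Q_def f_def v_def K_def using xpos
      by (intro prob_no_regular_event_poisson m2) auto
    also have "\<dots> = 8 * real m * (4 * K * \<tau>) ^ m * (real n * r n ^ m)"
      unfolding y by (simp add: power_mult_distrib)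
    \<comment> \<open>The factor n from the choice of the reference point is absorbed by r^(m-1) =
      1/n; the one power of r that remains is the rate.\<close>
    also have "real n * r n ^ m = r n"
    proof -
      have "r n ^ m = r n * r n ^ (m - 1)" using m by (cases m) auto
      then show ?thesis using rm n by simp
    qed
    finally have 1: "\<bar>Q - exp (- (f * v))\<bar> \<le> 8 * real m * (4 * K * \<tau>) ^ m * r n" .
    have "\<bar>v - c * x n ^ (m - 1)\<bar> \<le> C * x n ^ m"
      unfolding v_def using C(2)[of "x n"] xpos x_le elim(1) by simp
    also have "\<dots> \<le> \<bar>C\<bar> * x n ^ m" using xpos by (intro mult_right_mono) auto
    finally have v: "\<bar>v - c * x n ^ (m - 1)\<bar> \<le> \<bar>C\<bar> * x n ^ m" .
    \<comment> \<open>The limiting mean is written as n^m c x^(m-1), so the error splits into the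
      one in v and the one in f.\<close>
    have "\<bar>f * v - c * \<tau> ^ (m - 1)\<bar> = \<bar>f * (v - c * x n ^ (m - 1)) - (real n ^ m - f) * (c * x n ^ (m - 1))\<bar>"
      unfolding pow[symmetric] by (simp add: algebra_simps)
    also have "\<dots> \<le> \<bar>f * (v - c * x n ^ (m - 1))\<bar> + \<bar>(real n ^ m - f) * (c * x n ^ (m - 1))\<bar>"
      by (rule abs_triangle_ineq4)
    also have "\<bar>f * (v - c * x n ^ (m - 1))\<bar> \<le> real n ^ m * (\<bar>C\<bar> * x n ^ m)"
      unfolding abs_mult using f0 falling_factorial_approx(1)[OF n(1,2)] v
      by (intro mult_mono) (auto simp: f_def)
    also have "real n ^ m * (\<bar>C\<bar> * x n ^ m) = \<bar>C\<bar> * (real n ^ m * x n ^ (m - 1)) * x n"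
      using m by (cases m) (auto simp: mult_ac)
    also have "\<dots> \<le> \<bar>C\<bar> * \<tau> ^ (m - 1) * (\<tau> * r n)"
      unfolding pow using x_le \<tau> by (intro mult_left_mono) auto
    also have "\<dots> = \<bar>C\<bar> * \<tau> ^ m * r n"
      using m by (cases m) (auto simp: mult_ac)
    also have "\<bar>(real n ^ m - f) * (c * x n ^ (m - 1))\<bar> \<le> (real m)\<^sup>2 * real n ^ m / real n * (c * x n ^ (m - 1))"
      unfolding abs_mult using falling_factorial_approx[OF n(1,2)] c0 xpos
      by (intro mult_mono) (auto simp: f_def)
    also have "\<dots> = (real m)\<^sup>2 * (c * (real n ^ m * x n ^ (m - 1))) * (1 / real n)"
      by simp
    also have "\<dots> \<le> (real m)\<^sup>2 * (c * \<tau> ^ (m - 1)) * r n"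
      unfolding pow using inv_le c0 \<tau> by (intro mult_left_mono) auto
    finally have 2: "\<bar>f * v - c * \<tau> ^ (m - 1)\<bar> \<le> \<bar>C\<bar> * \<tau> ^ m * r n + (real m)\<^sup>2 * (c * \<tau> ^ (m - 1)) * r n"
      by simp
    have "\<bar>p n - L\<bar> = \<bar>Q - exp (- (c * \<tau> ^ (m - 1)))\<bar>"
      unfolding pQ L_def c[symmetric] by simp
    also have "\<dots> \<le> \<bar>Q - exp (- (f * v))\<bar> + \<bar>exp (- (f * v)) - exp (- (c * \<tau> ^ (m - 1)))\<bar>"
      by simp
    also have "\<bar>exp (- (f * v)) - exp (- (c * \<tau> ^ (m - 1)))\<bar> \<le> \<bar>f * v - c * \<tau> ^ (m - 1)\<bar>"
      using f0 v0 c0 \<tau> by (intro abs_exp_minus_diff_le) auto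
    finally have "\<bar>p n - L\<bar> \<le> D * r n"
      using 1 2 unfolding D_def distrib_right by linarith
    then show ?case using rpos by simp
  qed
  then show ?thesis unfolding r_def by (rule bigoI)
qed

end

theorem theorem1:
  fixes M :: "'a measure" and U :: "nat \<Rightarrow> 'a \<Rightarrow> complex" and m :: nat and t :: real
  assumes "prob_space M"
    and "m \<ge> 3"
    and "prob_space.indep_vars M (\<lambda>_. circle_borel) U {1..}"
    and "\<And>i. i \<ge> 1 \<Longrightarrow> distr M circle_borel (U i) = uniform_circle"
    and "t > 0"
  defines "p \<equiv> \<lambda>n. measure M {\<omega> \<in> space M.
      real n powr (2 * real m / (real m - 1))
        * (2 * real m * sin (pi / real m) - max_peri m n (\<lambda>i. U i \<omega>)) \<le> t}"
    and "L \<equiv> 1 - exp (- (t powr ((real m - 1) / 2) / K1 m))"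
  shows "p \<longlonglongrightarrow> L \<and> (\<lambda>n. \<bar>p n - L\<bar>) \<in> O(\<lambda>n. real n powr (- 1 / (real m - 1)))"
proof -
  interpret prob_space M by fact
  interpret random_circle_points M U
    using assms(3,4) by unfold_locales auto
  have rate: "(\<lambda>n. \<bar>p n - L\<bar>) \<in> O(\<lambda>n. real n powr (- 1 / (real m - 1)))"
    unfolding p_def L_def using assms(2,5) by (rule max_peri_rate)
  have "(\<lambda>n. real n powr (- 1 / (real m - 1))) \<longlonglongrightarrow> 0"
    using assms(2) by (intro tendsto_neg_powr filterlim_real_sequentially) (simp add: divide_neg_pos)
  then have null: "(\<lambda>n. C * norm (real n powr (- 1 / (real m - 1)))) \<longlonglongrightarrow> 0" for C
    by (intro tendsto_mult_right_zero tendsto_norm_zero)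
  obtain C where "\<forall>\<^sub>F n in sequentially. norm \<bar>p n - L\<bar> \<le> C * norm (real n powr (- 1 / (real m - 1)))"
    using rate by (elim landau_o.bigE)
  then have "(\<lambda>n. \<bar>p n - L\<bar>) \<longlonglongrightarrow> 0" using null by (rule Lim_null_comparison)
  then have "p \<longlonglongrightarrow> L" by (simp add: tendsto_rabs_zero_iff LIM_zero_cancel)
  from this rate show ?thesis ..
qed

end
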